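(* Let $G$ be an open subset of $\mathbb{R}$ containing $0$. Let $A$ and $B$ be complex unital Banach algebras with continuous involutions, and let $\pi : G \to \mathcal{B}(A,B)$ be a real analytic map such that for every $\lambda \in G$ the value $\pi(\lambda)$ is a (unital, continuous) $^*$-homomorphism $A \to B$, and such that $\pi(0)$ is surjective. Suppose that for each $x \in \operatorname{Ker}\pi(0)$ the spectrum $\sigma(x)$ is totally disconnected. Let $q : G \to S(B)$ be a real analytic map. Then there exist an open set $H \subset \mathbb{R}$ with $0 \in H \subset G$ and a real analytic map $p : H \to S(A)$ such that $\pi(\lambda)p(\lambda) = q(\lambda)$ for each $\lambda \in H$.
   Context: All Banach algebras are over $\mathbb{C}$ and unital; all Banach algebra homomorphisms are continuous and preserve $1$. $\mathcal{B}(A,B)$ is the Banach space of bounded linear operators from $A$ to $B$ (with the operator norm). For a Banach algebra $A$ with involution $^*$, $S(A) = \{p \in A : p^2 = p = p^*\}$ is the set of self-adjoint idempotents. The involutions are assumed continuous, but not necessarily isometric. A $^*$-homomorphism is an algebra homomorphism commuting with the involutions. A real analytic map $f$ from an open set $G \subset \mathbb{R}$ to a Banach space is a map that near each $x_0 \in G$ has a power series expansion $f(x) = \sum_{n=0}^\infty a_n (x-x_0)^n$ with coefficients $a_n$ in the Banach space; a real analytic map into $S(A)$ is a real analytic map into $A$ with values in $S(A)$. $\sigma(x)$ denotes the spectrum of $x$; for $x \in \operatorname{Ker}\pi(0) \subset A$ it is taken with respect to $A$. A set is totally disconnected if it contains no connected subset consisting of more than one point. *)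

theory Defs
  imports "HOL-Analysis.Analysis"
begin

text \<open>
  Complex unital Banach algebras.  Submultiplicativity of the norm and the real vector space
  structure come from \<^class>\<open>real_normed_algebra\<close>; the class adds a compatible complex scalar
  multiplication.  The unit comes from \<^class>\<open>monoid_mult\<close> and not from
  \<^class>\<open>real_normed_algebra_1\<close>, so neither \<open>norm 1 = 1\<close> nor \<open>0 \<noteq> 1\<close> is imposed.
\<close>

class scaleC =
  fixes scaleC :: "complex \<Rightarrow> 'a \<Rightarrow> 'a" (infixr "*\<^sub>C" 75)

class complex_banach_algebra = real_normed_algebra + banach + monoid_mult + scaleC +
  assumes scaleC_add_right: "c *\<^sub>C (x + y) = c *\<^sub>C x + c *\<^sub>C y"
    and scaleC_add_left: "(c + d) *\<^sub>C x = c *\<^sub>C x + d *\<^sub>C x"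
    and scaleC_scaleC: "c *\<^sub>C d *\<^sub>C x = (c * d) *\<^sub>C x"
    and scaleC_of_real: "complex_of_real r *\<^sub>C x = r *\<^sub>R x"
    and mult_scaleC_left: "(c *\<^sub>C x) * y = c *\<^sub>C (x * y)"
    and mult_scaleC_right: "x * (c *\<^sub>C y) = c *\<^sub>C (x * y)"
    and norm_scaleC: "norm (c *\<^sub>C x) = cmod c * norm x"

definition involution :: "('a::complex_banach_algebra \<Rightarrow> 'a) \<Rightarrow> bool" where
  "involution star \<longleftrightarrow>
     (\<forall>x y. star (x + y) = star x + star y) \<and>
     (\<forall>c x. star (c *\<^sub>C x) = cnj c *\<^sub>C star x) \<and>
     (\<forall>x y. star (x * y) = star y * star x) \<and>
     (\<forall>x. star (star x) = x)"

definition self_adjoint_idempotents :: "('a::complex_banach_algebra \<Rightarrow> 'a) \<Rightarrow> 'a set" where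
  "self_adjoint_idempotents star = {p. p ^ 2 = p \<and> p = star p}"

definition spectrum :: "'a::complex_banach_algebra \<Rightarrow> complex set" where
  "spectrum x = {c. \<not> (\<exists>y. y * (c *\<^sub>C 1 - x) = 1 \<and> (c *\<^sub>C 1 - x) * y = 1)}"

definition unital_star_hom ::
  "('a::complex_banach_algebra \<Rightarrow> 'a) \<Rightarrow> ('b::complex_banach_algebra \<Rightarrow> 'b) \<Rightarrow> ('a \<Rightarrow> 'b) \<Rightarrow> bool"
  where
  "unital_star_hom starA starB f \<longleftrightarrow>
     (\<forall>x y. f (x + y) = f x + f y) \<and>
     (\<forall>c x. f (c *\<^sub>C x) = c *\<^sub>C f x) \<and>
     (\<forall>x y. f (x * y) = f x * f y) \<and>
     f 1 = 1 \<and>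
     (\<forall>x. f (starA x) = starB (f x))"

definition totally_disconnected :: "'a::topological_space set \<Rightarrow> bool" where
  "totally_disconnected S \<longleftrightarrow> \<not> (\<exists>C\<subseteq>S. connected C \<and> (\<exists>x\<in>C. \<exists>y\<in>C. x \<noteq> y))"

text \<open>
  Intended for open \<open>G\<close>.  For maps into the space of bounded complex-linear operators this is
  used with the type of bounded real-linear operators: the complex-linear ones form a closed
  real subspace with the same operator norm, so if all values on \<open>G\<close> are complex-linear then so
  are the coefficients (they are derivatives divided by factorials).
\<close>

definition real_analytic_on ::
  "(real \<Rightarrow> 'a::real_normed_vector) \<Rightarrow> real set \<Rightarrow> bool" (infix "real'_analytic'_on" 50)
  where
  "f real_analytic_on G \<longleftrightarrow>
     (\<forall>x0\<in>G. \<exists>r>0. \<exists>a. \<forall>x\<in>G. \<bar>x - x0\<bar> < r \<longrightarrow> (\<lambda>n. (x - x0) ^ n *\<^sub>R a n) sums f x)"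

end

theory Submission
  imports Defs "HOL-Complex_Analysis.Complex_Analysis"
    "HOL-Computational_Algebra.Fundamental_Theorem_Algebra"
begin

text \<open>
  First lift \<open>q 0\<close>.  A self-adjoint preimage \<open>x\<close> of \<open>q 0\<close> has totally disconnected spectrum, because
  \<open>x\<^sup>2 - x\<close> lies in the kernel of \<open>\<pi> 0\<close>.  Hence \<open>1\<close> and \<open>0\<close> are separated by a
  conjugation-invariant clopen partition of the spectrum, and Runge's argument (a Cauchy integral along
  a grid of squares) gives a rational function with real coefficients which is close to \<open>1\<close> on one
  part and to \<open>- 1\<close> on the other, with values exactly \<open>1\<close> at \<open>1\<close> and \<open>- 1\<close> at \<open>0\<close>.  Applied to
  \<open>x\<close> it yields a self-adjoint \<open>e\<close> lying over the symmetry \<open>2 q 0 - 1\<close> such that \<open>e\<^sup>2 - 1\<close> has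
  spectral radius below \<open>1\<close>; then \<open>e (e\<^sup>2) powr (- 1 / 2)\<close>, formed with the binomial series, is an exact
  self-adjoint symmetry.

  Next, the open mapping theorem lets one lift \<open>q\<close> coefficient by coefficient to a convergent power
  series starting at the lift of \<open>q 0\<close>.  After symmetrisation it is idempotent at \<open>0\<close>, so near \<open>0\<close> the
  binomial series corrects it again, and the result is real analytic.
\<close>


text \<open>An approximate symmetry suffices because its correction is invisible in
  \<open>B\<close>. If \<open>e\<close> lies over \<open>2 q - 1\<close>, then
  \<open>u = e * e - 1\<close> lies in the kernel, so the binomial series in \<open>u\<close> is
  sent to \<open>1\<close> and the corrected symmetry has the same image as \<open>e\<close>. Hence
  the rational function needs exact values at \<open>0\<close> and \<open>1\<close> only, while on
  the rest of the spectrum closeness is enough. Real coefficients, and with them a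
  conjugation-invariant partition, are what keeps \<open>e\<close> self-adjoint. For a rational
  function, \<open>e\<close> is one polynomial in \<open>x\<close> times the inverse of another, so
  no integral with values in \<open>A\<close> occurs. Since a small spectrum of \<open>u\<close>
  says nothing about its norm, convergence of the series has to come from the growth of the powers
  of \<open>u\<close>. The coefficientwise lift of \<open>q\<close> solves the equation but need not
  consist of idempotents, and nothing is assumed about kernels at \<open>t \<noteq> 0\<close>. There
  the smallness of \<open>u t\<close> comes only from \<open>u 0 = 0\<close>, which is why the
  series must start at an exact lift of \<open>q 0\<close>.\<close>

section \<open>Invertibility and spectrum in a complex Banach algebra\<close>

definition invertible_elt :: "'a::complex_banach_algebra \<Rightarrow> bool" where
  "invertible_elt x \<longleftrightarrow> (\<exists>y. y * x = 1 \<and> x * y = 1)"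

lemma spectrum_iff: "c \<in> spectrum x \<longleftrightarrow> \<not> invertible_elt (c *\<^sub>C 1 - x)"
  by (simp add: spectrum_def invertible_elt_def)

lemma scaleC_zero [simp]: "c *\<^sub>C (0 :: 'a::complex_banach_algebra) = 0"
  by (metis add_cancel_left_right scaleC_add_right)

lemma zero_scaleC [simp]: "0 *\<^sub>C (x :: 'a::complex_banach_algebra) = 0"
  by (metis add_cancel_left_right scaleC_add_left)

lemma one_scaleC [simp]: "1 *\<^sub>C (x :: 'a::complex_banach_algebra) = x"
  by (metis of_real_1 scaleC_of_real scaleR_one)

lemma scaleC_minus_left: "(- c) *\<^sub>C (x :: 'a::complex_banach_algebra) = - (c *\<^sub>C x)"
  by (metis add.right_inverse eq_neg_iff_add_eq_0 add.commute scaleC_add_left zero_scaleC)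

lemma scaleC_minus_right: "c *\<^sub>C (- x :: 'a::complex_banach_algebra) = - (c *\<^sub>C x)"
  by (metis add.right_inverse eq_neg_iff_add_eq_0 add.commute scaleC_add_right scaleC_zero)

lemma scaleC_diff_left: "(c - d) *\<^sub>C (x :: 'a::complex_banach_algebra) = c *\<^sub>C x - d *\<^sub>C x"
  by (metis scaleC_add_left diff_add_cancel add_diff_cancel)

lemma scaleC_diff_right: "c *\<^sub>C (x - y :: 'a::complex_banach_algebra) = c *\<^sub>C x - c *\<^sub>C y"
  by (metis scaleC_add_right diff_add_cancel add_diff_cancel)

lemma power_scaleC: "(c *\<^sub>C (x :: 'a::complex_banach_algebra)) ^ n = c ^ n *\<^sub>C x ^ n"
  by (induction n) (auto simp: mult_scaleC_left mult_scaleC_right scaleC_scaleC mult.commute)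

text \<open>The class does not normalise the unit, so the exponent \<open>0\<close> forces the
  factor \<open>norm 1\<close>.\<close>

lemma norm_power_le:
  "norm ((x :: 'a::complex_banach_algebra) ^ n) \<le> norm (1::'a) * norm x ^ n"
proof (induction n)
  case (Suc n)
  have "norm (x ^ Suc n) \<le> norm x * norm (x ^ n)"
    by (simp add: norm_mult_ineq)
  also have "\<dots> \<le> norm x * (norm (1::'a) * norm x ^ n)"
    by (intro mult_left_mono Suc) auto
  finally show ?case by (simp add: mult_ac)
qed auto

lemma summable_norm_power:
  assumes "norm (x :: 'a::complex_banach_algebra) < 1"
  shows "summable (\<lambda>n. norm (x ^ n))"
proof (rule summable_comparison_test')
  show "summable (\<lambda>n. norm (1::'a) * norm x ^ n)"
    using assms by (intro summable_mult summable_geometric) auto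
  show "norm (norm (x ^ n)) \<le> norm (1::'a) * norm x ^ n" if "n \<ge> 0" for n
    using norm_power_le[of x n] by simp
qed

lemma geometric_telescope:
  "(1 - x) * (\<Sum>i<n. x ^ i) = 1 - (x :: 'a::complex_banach_algebra) ^ n"
  "(\<Sum>i<n. x ^ i) * (1 - x) = 1 - x ^ n"
proof -
  show 1: "(1 - x) * (\<Sum>i<n. x ^ i) = 1 - x ^ n"
    by (induction n) (simp_all add: distrib_left, simp add: left_diff_distrib)
  show "(\<Sum>i<n. x ^ i) * (1 - x) = 1 - x ^ n"
    by (induction n) (simp_all add: distrib_right power_Suc2 del: power_Suc, simp add: right_diff_distrib)
qed

text \<open>The hypothesis is summability of the powers instead of \<open>norm x < 1\<close>,
  because for the lift of \<open>q 0\<close> only the spectrum is controlled.\<close>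

lemma neumann_series:
  fixes x :: "'a::complex_banach_algebra"
  assumes "summable (\<lambda>n. norm (x ^ n))"
  shows "(1 - x) * (\<Sum>n. x ^ n) = 1" and "(\<Sum>n. x ^ n) * (1 - x) = 1"
proof -
  have sm: "summable (\<lambda>n. x ^ n)"
    using assms by (rule summable_norm_cancel)
  have lim: "(\<lambda>n. \<Sum>i<n. x ^ i) \<longlonglongrightarrow> (\<Sum>n. x ^ n)"
    using sm by (rule summable_LIMSEQ)
  have z: "(\<lambda>n. 1 - x ^ n) \<longlonglongrightarrow> 1 - 0"
    by (intro tendsto_diff tendsto_const summable_LIMSEQ_zero sm)
  have "(\<lambda>n. (1 - x) * (\<Sum>i<n. x ^ i)) \<longlonglongrightarrow> (1 - x) * (\<Sum>n. x ^ n)"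
    by (intro tendsto_intros lim)
  then show "(1 - x) * (\<Sum>n. x ^ n) = 1"
    using z LIMSEQ_unique by (fastforce simp: geometric_telescope)
  have "(\<lambda>n. (\<Sum>i<n. x ^ i) * (1 - x)) \<longlonglongrightarrow> (\<Sum>n. x ^ n) * (1 - x)"
    by (intro tendsto_intros lim)
  then show "(\<Sum>n. x ^ n) * (1 - x) = 1"
    using z LIMSEQ_unique by (fastforce simp: geometric_telescope)
qed

lemma invertible_near_one:
  "norm x < 1 \<Longrightarrow> invertible_elt (1 - (x :: 'a::complex_banach_algebra))"
  unfolding invertible_elt_def using neumann_series[OF summable_norm_power] by blast

lemma invertible_elt_mult:
  assumes "invertible_elt x" "invertible_elt (y :: 'a::complex_banach_algebra)"
  shows "invertible_elt (x * y)"
proof -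
  obtain u v where "u * x = 1" "x * u = 1" "v * y = 1" "y * v = 1"
    using assms by (auto simp: invertible_elt_def)
  then have "(v * u) * (x * y) = 1" "(x * y) * (v * u) = 1"
    by (metis mult.assoc mult_1_right)+
  then show ?thesis unfolding invertible_elt_def by blast
qed

text \<open>If \<open>u\<close> inverts the product, then \<open>u * y\<close> is a left inverse of
  \<open>x\<close> by commutation and \<open>y * u\<close> is a right inverse; a left and a right
  inverse coincide.\<close>

lemma invertible_elt_commuting_factor:
  assumes "invertible_elt (x * y)" "x * y = y * (x :: 'a::complex_banach_algebra)"
  shows "invertible_elt x"
proof -
  obtain u where u: "u * (x * y) = 1" "(x * y) * u = 1"
    using assms by (auto simp: invertible_elt_def)
  have 1: "(u * y) * x = 1" using u assms by (simp add: mult.assoc)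
  have 2: "x * (y * u) = 1" using u by (simp add: mult.assoc)
  have "u * y = y * u" using 1 2 by (metis mult.assoc mult_1_left mult_1_right)
  with 1 2 show ?thesis unfolding invertible_elt_def by metis
qed

lemma invertible_elt_scaleC:
  assumes "invertible_elt (x :: 'a::complex_banach_algebra)" "c \<noteq> 0"
  shows "invertible_elt (c *\<^sub>C x)"
proof -
  obtain u where u: "u * x = 1" "x * u = 1"
    using assms by (auto simp: invertible_elt_def)
  have "(inverse c *\<^sub>C u) * (c *\<^sub>C x) = 1" "(c *\<^sub>C x) * (inverse c *\<^sub>C u) = 1"
    using u assms(2) by (auto simp: mult_scaleC_left mult_scaleC_right scaleC_scaleC)
  then show ?thesis unfolding invertible_elt_def by blast
qed

lemma invertible_elt_one [simp]: "invertible_elt 1"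
  unfolding invertible_elt_def by (metis mult_1_left)

text \<open>With \<open>y\<close> inverse to \<open>c 1 - x\<close>, the element
  \<open>d 1 - x\<close> factors as \<open>(c 1 - x) * (1 - (c - d) y)\<close>, and the second
  factor is a Neumann perturbation of \<open>1\<close> for \<open>d\<close> near
  \<open>c\<close>.\<close>

lemma open_resolvent_set: "open (- spectrum (x :: 'a::complex_banach_algebra))"
proof (subst open_dist, intro ballI)
  fix c assume "c \<in> - spectrum x"
  then obtain y where y: "y * (c *\<^sub>C 1 - x) = 1" "(c *\<^sub>C 1 - x) * y = 1"
    by (auto simp: spectrum_def)
  \<comment> \<open>Adding \<open>1\<close> keeps the radius positive in the zero algebra too, where
    \<open>y = 0\<close>.\<close>
  have "d \<in> - spectrum x" if "dist d c < inverse (norm y + 1)" for d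
  proof -
    have "norm ((c - d) *\<^sub>C y) = dist d c * norm y"
      by (simp add: norm_scaleC dist_norm norm_minus_commute)
    also have "\<dots> \<le> dist d c * (norm y + 1)"
      by (simp add: mult_left_mono)
    also have "\<dots> < 1"
      using that by (simp add: less_divide_eq inverse_eq_divide add_nonneg_pos)
    finally have "invertible_elt (1 - (c - d) *\<^sub>C y)" by (rule invertible_near_one)
    moreover have "invertible_elt (c *\<^sub>C 1 - x)" using y by (auto simp: invertible_elt_def)
    ultimately have "invertible_elt ((c *\<^sub>C 1 - x) * (1 - (c - d) *\<^sub>C y))"
      by (intro invertible_elt_mult)
    also have "(c *\<^sub>C 1 - x) * (1 - (c - d) *\<^sub>C y) = (c *\<^sub>C 1 - x) - (c - d) *\<^sub>C 1"
      by (simp add: right_diff_distrib mult_scaleC_right y)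
    also have "\<dots> = d *\<^sub>C 1 - x" by (simp add: scaleC_diff_left)
    finally show ?thesis by (simp add: spectrum_iff)
  qed
  then show "\<exists>e>0. \<forall>y. dist y c < e \<longrightarrow> y \<in> - spectrum x"
    by (intro exI[of _ "inverse (norm y + 1)"]) (auto simp: add_nonneg_pos)
qed

lemma compact_spectrum: "compact (spectrum (x :: 'a::complex_banach_algebra))"
  unfolding compact_eq_bounded_closed
proof
  show "closed (spectrum x)" using open_resolvent_set[of x] by (simp add: open_closed)
  have "norm c \<le> norm x" if c: "c \<in> spectrum x" for c
  proof (rule ccontr)
    assume lt: "\<not> norm c \<le> norm x"
    then have "c \<noteq> 0" by auto
    have "norm (inverse c *\<^sub>C x) < 1"
      using lt \<open>c \<noteq> 0\<close> by (simp add: norm_scaleC norm_inverse inverse_eq_divide norm_divide)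
    then have "invertible_elt (c *\<^sub>C (1 - inverse c *\<^sub>C x))"
      by (intro invertible_elt_scaleC invertible_near_one \<open>c \<noteq> 0\<close>)
    then show False using c \<open>c \<noteq> 0\<close> by (simp add: spectrum_iff scaleC_diff_right scaleC_scaleC)
  qed
  then show "bounded (spectrum x)" by (auto simp: bounded_iff)
qed

text \<open>One inclusion of the spectral mapping theorem: \<open>c 1 - x\<close> is a commuting
  factor of \<open>(c\<^sup>2 - c) 1 - (x * x - x)\<close>, the cofactor belonging to the other root
  \<open>1 - c\<close>.\<close>

lemma spectrum_square_minus_self:
  assumes "c \<in> spectrum (x :: 'a::complex_banach_algebra)"
  shows "c\<^sup>2 - c \<in> spectrum (x * x - x)"
proof -
  define y where "y = (c - 1) *\<^sub>C 1 + x"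
  have 1: "(c *\<^sub>C 1 - x) * y = (c\<^sup>2 - c) *\<^sub>C 1 - (x * x - x)"
    by (simp add: y_def algebra_simps mult_scaleC_left mult_scaleC_right scaleC_add_left
        scaleC_diff_left scaleC_minus_left scaleC_diff_right scaleC_add_right scaleC_scaleC power2_eq_square)
  have 2: "y * (c *\<^sub>C 1 - x) = (c\<^sup>2 - c) *\<^sub>C 1 - (x * x - x)"
    by (simp add: y_def algebra_simps mult_scaleC_left mult_scaleC_right scaleC_add_left
        scaleC_diff_left scaleC_minus_left scaleC_diff_right scaleC_add_right scaleC_scaleC power2_eq_square)
  show ?thesis using assms invertible_elt_commuting_factor[of "c *\<^sub>C 1 - x" y] 1 2
    by (auto simp: spectrum_iff)
qed

subsection \<open>Power growth from the resolvent\<close>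

text \<open>Writing \<open>1 - v = 1 - (g - 1) * (1 - v)\<close> puts half of the unknown norm on
  the right, where it can be absorbed. This turns closeness of an average of resolvents to
  \<open>1\<close> into a bound on a power.\<close>

lemma neumann_inverse_bound:
  fixes g :: "'a::complex_banach_algebra"
  assumes "g * (1 - v) = 1" "norm (g - 1) \<le> 1 / 2"
  shows "norm (1 - v) \<le> 2 * norm (1::'a)"
proof -
  have "1 - v = 1 - (g - 1) * (1 - v)"
    using assms(1) by (simp add: left_diff_distrib)
  then have "norm (1 - v) \<le> norm (1::'a) + norm ((g - 1) * (1 - v))"
    using norm_triangle_ineq4[of 1 "(g - 1) * (1 - v)"] by simp
  also have "norm ((g - 1) * (1 - v)) \<le> 1 / 2 * norm (1 - v)"
    by (rule order_trans[OF norm_mult_ineq]) (intro mult_right_mono assms, simp)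
  finally show ?thesis by simp
qed

lemma sum_roots_of_unity_powers:
  fixes n j :: nat
  assumes "0 < j" "j < n"
  shows "(\<Sum>k<n. cis (2 * pi / n) ^ (k * j)) = 0"
proof -
  define w where "w = cis (2 * pi / n) ^ j"
  have w: "w = cis (2 * pi * j / n)"
    by (simp add: w_def Complex.DeMoivre mult_ac)
  have "w ^ n = 1"
    using assms by (simp add: w Complex.DeMoivre cis_multiple_2pi)
  moreover have "w \<noteq> 1"
  proof
    assume "w = 1"
    then have "cos (2 * pi * j / n) = 1" by (simp add: w complex_eq_iff)
    then obtain m :: int where "2 * pi * j / n = m * 2 * pi"
      by (auto simp: cos_one_2pi_int)
    then have "real j = m * real n" using assms by (simp add: field_simps)
    then have "int j = m * int n"
      by (metis of_int_eq_iff of_int_mult of_int_of_nat_eq)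
    then have "n dvd j" by (metis dvd_triv_right int_dvd_int_iff)
    then show False using assms by (simp add: nat_dvd_not_less)
  qed
  ultimately have "(\<Sum>k<n. w ^ k) = 0"
    by (simp add: geometric_sum)
  then show ?thesis by (simp add: w_def power_mult [symmetric] mult.commute)
qed

text \<open>This average over roots of unity replaces the contour integral in the usual proof of the spectral
  radius formula, so that no Banach-valued integration is needed.\<close>
lemma resolvent_average:
  fixes u :: "'a::complex_banach_algebra" and f :: "complex \<Rightarrow> 'a"
  assumes f: "\<And>l. norm l \<le> R \<Longrightarrow> f l * (1 - l *\<^sub>C u) = 1 \<and> (1 - l *\<^sub>C u) * f l = 1"
    and "0 < n" "0 \<le> r" "r \<le> R"
  shows "((1 / real n) *\<^sub>R (\<Sum>k<n. f (of_real r * cis (2 * pi / n) ^ k)))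
           * (1 - of_real (r ^ n) *\<^sub>C u ^ n) = 1"
proof -
  define w where "w = cis (2 * pi / n)"
  have wn: "w ^ n = 1" using assms by (simp add: w_def Complex.DeMoivre)
  have nw: "norm w = 1" by (simp add: w_def)
  \<comment> \<open>The factor on the left is \<open>1 - (l u)\<^sup>n\<close> for each of the
    \<open>n\<close> points \<open>l\<close>, since \<open>w\<close> is an \<open>n\<close>-th root
    of unity. It turns each resolvent into a finite geometric sum, and averaging over
    \<open>k\<close> leaves only the term \<open>j = 0\<close>.\<close>
  have *: "f (of_real r * w ^ k) * (1 - of_real (r ^ n) *\<^sub>C u ^ n)
      = (\<Sum>j<n. (of_real r ^ j * w ^ (k * j)) *\<^sub>C u ^ j)" for k
  proof -
    define l where "l = of_real r * w ^ k"
    have "norm l \<le> R" using assms nw by (simp add: l_def norm_mult norm_power)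
    have ln: "l ^ n = of_real (r ^ n)"
      by (simp add: l_def power_mult_distrib power_mult [symmetric] mult.commute[of k n])
        (simp add: power_mult wn)
    have "f l * (1 - of_real (r ^ n) *\<^sub>C u ^ n) = f l * ((1 - l *\<^sub>C u) * (\<Sum>j<n. (l *\<^sub>C u) ^ j))"
      by (simp only: geometric_telescope(1)) (simp only: power_scaleC ln)
    also have "\<dots> = (\<Sum>j<n. (l *\<^sub>C u) ^ j)"
      using f[OF \<open>norm l \<le> R\<close>] by (simp add: mult.assoc [symmetric])
    also have "\<dots> = (\<Sum>j<n. (of_real r ^ j * w ^ (k * j)) *\<^sub>C u ^ j)"
      by (simp add: power_scaleC l_def power_mult_distrib power_mult)
    finally show ?thesis by (simp add: l_def)
  qed
  have "(\<Sum>k<n. f (of_real r * w ^ k)) * (1 - of_real (r ^ n) *\<^sub>C u ^ n)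
      = (\<Sum>k<n. \<Sum>j<n. (of_real r ^ j * w ^ (k * j)) *\<^sub>C u ^ j)"
    by (simp add: sum_distrib_right * del: of_real_power)
  also have "\<dots> = (\<Sum>j<n. \<Sum>k<n. (of_real r ^ j * w ^ (k * j)) *\<^sub>C u ^ j)"
    by (rule sum.swap)
  also have "\<dots> = (\<Sum>j<n. (of_real r ^ j * (\<Sum>k<n. w ^ (k * j))) *\<^sub>C u ^ j)"
  proof (rule sum.cong[OF refl])
    fix j
    have "(\<Sum>k\<in>K. (c * h k) *\<^sub>C x) = (c * (\<Sum>k\<in>K. h k)) *\<^sub>C x"
      for K :: "nat set" and c and h :: "nat \<Rightarrow> complex" and x :: 'a
      by (induction K rule: infinite_finite_induct) (auto simp: scaleC_add_left distrib_left)
    then show "(\<Sum>k<n. (of_real r ^ j * w ^ (k * j)) *\<^sub>C u ^ j)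
        = (of_real r ^ j * (\<Sum>k<n. w ^ (k * j))) *\<^sub>C u ^ j" .
  qed
  also have "\<dots> = (\<Sum>j<n. if j = 0 then of_nat n *\<^sub>C 1 else 0)"
    using sum_roots_of_unity_powers[of _ n] by (intro sum.cong) (auto simp: w_def)
  also have "\<dots> = real n *\<^sub>R 1"
    using \<open>0 < n\<close> by (simp add: sum.delta flip: scaleC_of_real)
  finally show ?thesis using \<open>0 < n\<close> by (simp add: w_def)
qed

lemma continuous_on_resolvent:
  fixes u :: "'a::complex_banach_algebra" and f :: "complex \<Rightarrow> 'a"
  assumes f: "\<And>l. l \<in> S \<Longrightarrow> f l * (1 - l *\<^sub>C u) = 1 \<and> (1 - l *\<^sub>C u) * f l = 1"
  shows "continuous_on S f"
proof (subst continuous_on_iff, intro ballI allI impI)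
  fix l and e :: real assume l: "l \<in> S" and "0 < e"
  define K where "K = norm u * norm (f l) + 1"
  have "K > 0" by (simp add: K_def add_nonneg_pos)
  \<comment> \<open>The second bound lets the resolvent identity give
    \<open>norm (f m) \<le> 2 * norm (f l)\<close>; with that a priori bound, the first one yields
    \<open>e\<close>.\<close>
  define d where "d = min (e / (2 * (norm (f l) + 1) * K)) (1 / (2 * K))"
  have "d > 0" using \<open>e > 0\<close> \<open>K > 0\<close> by (simp add: d_def add_nonneg_pos)
  have "dist (f m) (f l) < e" if m: "m \<in> S" "dist m l < d" for m
  proof -
    have eq: "f m - f l = (m - l) *\<^sub>C (f m * u * f l)"
    proof -
      have "f m - f l = f m * ((1 - l *\<^sub>C u) * f l) - (f m * (1 - m *\<^sub>C u)) * f l"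
        by (simp only: f[OF l] f[OF m(1)] mult_1_left mult_1_right)
      also have "\<dots> = f m * ((1 - l *\<^sub>C u) - (1 - m *\<^sub>C u)) * f l"
        by (simp only: mult.assoc left_diff_distrib right_diff_distrib)
      also have "(1 - l *\<^sub>C u) - (1 - m *\<^sub>C u) = (m - l) *\<^sub>C u"
        by (simp add: scaleC_diff_left)
      also have "f m * ((m - l) *\<^sub>C u) * f l = (m - l) *\<^sub>C (f m * u * f l)"
        by (simp add: mult_scaleC_left mult_scaleC_right)
      finally show ?thesis .
    qed
    have ul: "norm (f m * u * f l) \<le> norm (f m) * K"
    proof -
      have "norm (f m * u * f l) \<le> norm (f m) * (norm u * norm (f l))"
        unfolding mult.assoc
        by (rule order_trans[OF norm_mult_ineq]) (intro mult_left_mono norm_mult_ineq norm_ge_zero)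
      also have "\<dots> \<le> norm (f m) * K"
        by (intro mult_left_mono) (auto simp: K_def)
      finally show ?thesis .
    qed
    have n1: "norm (f m - f l) \<le> dist m l * (norm (f m) * K)"
      unfolding eq norm_scaleC dist_norm by (rule mult_left_mono[OF ul]) simp
    have h: "dist m l * K \<le> 1 / 2"
      using m(2) \<open>K > 0\<close> by (simp add: d_def field_simps)
    have "norm (f m) \<le> norm (f l) + dist m l * K * norm (f m)"
      using n1 norm_triangle_sub[of "f m" "f l"] by (simp add: mult_ac)
    also have "dist m l * K * norm (f m) \<le> 1 / 2 * norm (f m)"
      by (intro mult_right_mono h) simp
    finally have "norm (f m) \<le> 2 * norm (f l)" by simp
    then have "norm (f m) * K \<le> 2 * (norm (f l) + 1) * K"
      using \<open>K > 0\<close> by (intro mult_right_mono) auto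
    then have "norm (f m - f l) \<le> dist m l * (2 * (norm (f l) + 1) * K)"
      by (intro order_trans[OF n1] mult_left_mono) auto
    also have "\<dots> < e"
      using m(2) \<open>K > 0\<close> by (simp add: d_def less_divide_eq add_nonneg_pos)
    finally show ?thesis by (simp add: dist_norm)
  qed
  then show "\<exists>d>0. \<forall>x'\<in>S. dist x' l < d \<longrightarrow> dist (f x') (f l) < e"
    using \<open>d > 0\<close> by blast
qed

text \<open>A substitute for the spectral radius formula. Decay of
  \<open>r ^ n * norm (u ^ n)\<close> is carried from \<open>r = 0\<close> past \<open>r = 1\<close>
  in steps whose length depends only on the uniform continuity of the resolvent, so finitely many
  steps suffice.\<close>

lemma summable_norm_power_of_resolvent:
  fixes u :: "'a::complex_banach_algebra"
  assumes inv: "\<And>l. norm l \<le> 2 \<Longrightarrow> invertible_elt (1 - l *\<^sub>C u)"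
  shows "summable (\<lambda>n. norm (u ^ n))"
proof -
  define f where "f l = (SOME y. y * (1 - l *\<^sub>C u) = 1 \<and> (1 - l *\<^sub>C u) * y = 1)" for l
  have f: "f l * (1 - l *\<^sub>C u) = 1 \<and> (1 - l *\<^sub>C u) * f l = 1" if "norm l \<le> 2" for l
    unfolding f_def by (rule someI_ex) (use inv[OF that] in \<open>auto simp: invertible_elt_def\<close>)
  have "continuous_on (cball 0 2) f"
    by (rule continuous_on_resolvent[of _ _ u]) (use f in auto)
  then have "uniformly_continuous_on (cball 0 2) f"
    by (simp add: compact_uniformly_continuous)
  then obtain d where "d > 0" and d: "\<And>l m. norm l \<le> 2 \<Longrightarrow> norm m \<le> 2 \<Longrightarrow> dist m l < d \<Longrightarrow>
      dist (f m) (f l) < 1 / 4"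
    unfolding uniformly_continuous_on_def
    by (metis mem_cball_0 zero_less_divide_1_iff zero_less_numeral)
  define F where "F n r = (1 / real n) *\<^sub>R (\<Sum>k<n. f (of_real r * cis (2 * pi / n) ^ k))" for n r
  have F: "F n r * (1 - of_real (r ^ n) *\<^sub>C u ^ n) = 1" if "0 < n" "0 \<le> r" "r \<le> 2" for n r
    unfolding F_def by (rule resolvent_average[where R = 2]) (use f that in auto)
  have Fd: "norm (F n r' - F n r) \<le> 1 / 4" if "0 < n" "0 \<le> r" "r \<le> r'" "r' \<le> 2" "r' - r < d" for n r r'
  proof -
    have "norm (\<Sum>k<n. f (of_real r' * cis (2 * pi / n) ^ k) - f (of_real r * cis (2 * pi / n) ^ k))
        \<le> (\<Sum>k<n. 1 / 4)"
    proof (rule sum_norm_le)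
      fix k
      define z where "z = cis (2 * pi / real n) ^ k"
      have "norm z = 1" by (simp add: z_def norm_power)
      have "dist (of_real r' * z) (of_real r * z) = \<bar>r' - r\<bar>"
        unfolding dist_norm left_diff_distrib [symmetric] norm_mult \<open>norm z = 1\<close>
        by (metis mult_1_right norm_of_real of_real_diff)
      then have "dist (f (of_real r' * z)) (f (of_real r * z)) < 1 / 4"
        using that \<open>norm z = 1\<close> by (intro d) (auto simp: norm_mult)
      then show "norm (f (of_real r' * cis (2 * pi / n) ^ k) - f (of_real r * cis (2 * pi / n) ^ k)) \<le> 1 / 4"
        by (simp add: z_def dist_norm)
    qed
    then have "norm (\<Sum>k<n. f (of_real r' * cis (2 * pi / n) ^ k) - f (of_real r * cis (2 * pi / n) ^ k))
        \<le> n * (1 / 4)" by simp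
    moreover have "F n r' - F n r = (1 / real n) *\<^sub>R
        (\<Sum>k<n. f (of_real r' * cis (2 * pi / n) ^ k) - f (of_real r * cis (2 * pi / n) ^ k))"
      by (simp add: F_def sum_subtractf scaleR_diff_right)
    ultimately show ?thesis using \<open>0 < n\<close> by (simp add: divide_le_eq)
  qed
  define P where "P r \<longleftrightarrow> (\<lambda>n. (r::real) ^ n * norm (u ^ n)) \<longlonglongrightarrow> 0" for r
  \<comment> \<open>Adding \<open>1\<close> allows division by \<open>N\<close> even when
    \<open>norm 1 = 0\<close>.\<close>
  define N where "N = norm (1::'a) + 1"
  have "N \<ge> 1" by (simp add: N_def)
  \<comment> \<open>Decay at \<open>r\<close> puts \<open>F n r\<close> within \<open>1 / 4\<close>
    of \<open>1\<close> for large \<open>n\<close>, uniform continuity costs another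
    \<open>1 / 4\<close> at \<open>r'\<close>, and the resulting bound at \<open>r'\<close> becomes
    decay at every smaller \<open>r''\<close>.\<close>
  have step: "P r''" if "P r" "0 \<le> r" "r \<le> r''" "r'' < r'" "r' - r < d" "r' \<le> 2" for r r' r''
  proof -
    have "\<forall>\<^sub>F n in sequentially. r ^ n * norm (u ^ n) < 1 / (8 * N)"
      using \<open>P r\<close> unfolding P_def by (rule order_tendstoD) (use \<open>N \<ge> 1\<close> in simp)
    moreover have "\<forall>\<^sub>F n in sequentially. n > 0" by (rule eventually_gt_at_top)
    ultimately have "\<forall>\<^sub>F n in sequentially. r' ^ n * norm (u ^ n) \<le> 3 * norm (1::'a)"
    proof eventually_elim
      case (elim n)
      define v where "v = of_real (r ^ n) *\<^sub>C u ^ n"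
      have F1: "F n r * (1 - v) = 1" unfolding v_def by (rule F) (use elim that in auto)
      have nv: "norm v < 1 / (8 * N)"
        using elim that by (simp add: v_def norm_scaleC norm_power)
      have v8: "norm v \<le> 1 / 8"
        by (rule order_trans[OF less_imp_le[OF nv]]) (use \<open>N \<ge> 1\<close> in \<open>simp add: divide_le_eq\<close>)
      have "norm (F n r - 1) \<le> 1 / 4"
      proof -
        have "F n r = 1 + F n r * v" using F1 by (simp add: right_diff_distrib algebra_simps)
        then have e: "norm (F n r - 1) \<le> norm (F n r) * norm v"
          by (metis add_diff_cancel_left' norm_mult_ineq)
        have "norm (F n r) \<le> norm (1::'a) + norm (F n r - 1)"
          by (metis add.commute diff_add_cancel norm_triangle_ineq)
        moreover have "norm (F n r - 1) \<le> norm (F n r) / 8"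
          using order_trans[OF e mult_left_mono[OF v8]] by simp
        ultimately have "norm (F n r) \<le> norm (1::'a) + norm (F n r) / 8" by linarith
        then have "norm (F n r) \<le> 2 * N"
          using \<open>N \<ge> 1\<close> N_def by argo
        then have "norm (F n r) * norm v \<le> 2 * N * (1 / (8 * N))"
          using nv \<open>N \<ge> 1\<close> by (intro mult_mono) auto
        also have "\<dots> = 1 / 4" using \<open>N \<ge> 1\<close> by simp
        finally show ?thesis using e by simp
      qed
      moreover have "norm (F n r' - F n r) \<le> 1 / 4"
        using that elim by (intro Fd) auto
      ultimately have "norm (F n r' - 1) \<le> 1 / 2"
        using norm_triangle_ineq[of "F n r' - F n r" "F n r - 1"] by simp
      then have "norm (1 - of_real (r' ^ n) *\<^sub>C u ^ n) \<le> 2 * norm (1::'a)"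
        using that elim by (intro neumann_inverse_bound[of "F n r'"] F) auto
      then have "norm (of_real (r' ^ n) *\<^sub>C u ^ n) \<le> 3 * norm (1::'a)"
        using norm_triangle_ineq4[of 1 "1 - of_real (r' ^ n) *\<^sub>C u ^ n"] by simp
      then show ?case using that by (simp add: norm_scaleC norm_power)
    qed
    moreover have "(\<lambda>n. 3 * norm (1::'a) * (r'' / r') ^ n) \<longlonglongrightarrow> 0"
      using that by (intro tendsto_mult_right_zero LIMSEQ_power_zero) auto
    ultimately show "P r''" unfolding P_def
    proof (rule_tac tendsto_sandwich[OF _ _ tendsto_const])
      assume "\<forall>\<^sub>F n in sequentially. r' ^ n * norm (u ^ n) \<le> 3 * norm (1::'a)"
      then show "\<forall>\<^sub>F n in sequentially. r'' ^ n * norm (u ^ n) \<le> 3 * norm (1::'a) * (r'' / r') ^ n"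
      proof eventually_elim
        case (elim n)
        have "r'' ^ n * norm (u ^ n) = (r'' / r') ^ n * (r' ^ n * norm (u ^ n))"
          using that by (simp add: power_divide)
        also have "\<dots> \<le> (r'' / r') ^ n * (3 * norm (1::'a))"
          using that elim by (intro mult_left_mono) auto
        finally show ?case by (simp add: mult_ac)
      qed
    qed (use that in auto)
  qed
  \<comment> \<open>A step advances by \<open>h\<close> and looks ahead by a further
    \<open>h\<close>: \<open>3 * h \<le> d\<close> keeps \<open>2 * h\<close> below
    \<open>d\<close>, and \<open>h \<le> 1 / 4\<close> keeps the look-ahead below
    \<open>2\<close>.\<close>
  define h where "h = min (d / 3) (1 / 4)"
  have "h > 0" "3 * h \<le> d" "h \<le> 1 / 4" using \<open>d > 0\<close> by (simp_all add: h_def)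
  have P0: "P 0"
    unfolding P_def by (rule tendsto_eventually) (auto intro!: eventually_sequentiallyI[of 1])
  have "real j * h \<le> 3 / 2 \<longrightarrow> P (real j * h)" for j
  proof (induction j)
    case (Suc j)
    show ?case
    proof
      assume le: "real (Suc j) * h \<le> 3 / 2"
      have "P (real j * h)" using Suc le \<open>h > 0\<close> by (auto simp: algebra_simps)
      then show "P (real (Suc j) * h)"
        by (rule step[where r' = "real (Suc j) * h + h"])
          (use le \<open>h > 0\<close> \<open>3 * h \<le> d\<close> \<open>h \<le> 1 / 4\<close> in \<open>auto simp: distrib_right\<close>)
    qed
  qed (use P0 in auto)
  \<comment> \<open>The last multiple of \<open>h\<close> up to \<open>3 / 2\<close> is at least
    \<open>5 / 4\<close>, which leaves the geometric ratio \<open>4 / 5\<close> for the powers of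
    \<open>u\<close>.\<close>
  moreover obtain j where j: "real j * h \<le> 3 / 2" "5 / 4 \<le> real j * h"
  proof -
    define j where "j = nat \<lfloor>(3 / 2) / h\<rfloor>"
    have "real j = of_int \<lfloor>(3 / 2) / h\<rfloor>" using \<open>h > 0\<close> by (simp add: j_def)
    then have "real j \<le> (3 / 2) / h" "(3 / 2) / h < real j + 1" by linarith+
    then have "real j * h \<le> 3 / 2" "3 / 2 < real j * h + h"
      using \<open>h > 0\<close> by (simp_all add: field_simps)
    then show ?thesis using that[of j] \<open>h \<le> 1 / 4\<close> by linarith
  qed
  ultimately have "P (real j * h)" by blast
  then have lim: "(\<lambda>n. (real j * h) ^ n * norm (u ^ n)) \<longlonglongrightarrow> 0" by (simp add: P_def)
  then have "\<forall>\<^sub>F n in sequentially. (real j * h) ^ n * norm (u ^ n) < 1"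
    by (rule order_tendstoD) simp
  then have "\<forall>\<^sub>F n in sequentially. norm (norm (u ^ n)) \<le> (4 / 5) ^ n"
  proof eventually_elim
    case (elim n)
    have "(5 / 4) ^ n * norm (u ^ n) \<le> (real j * h) ^ n * norm (u ^ n)"
      using j by (intro mult_right_mono power_mono) auto
    also have "\<dots> < 1" by fact
    finally show ?case by (simp add: power_divide field_simps)
  qed
  then show ?thesis
    by (rule summable_comparison_test_ev) (simp add: summable_geometric)
qed

subsection \<open>Polynomials evaluated in a Banach algebra\<close>

text \<open>Horner's scheme with the coefficients entering as multiples of the unit, since they are
  complex numbers while the argument lives in a noncommutative algebra.\<close>

definition poly_eval :: "'a::complex_banach_algebra \<Rightarrow> complex poly \<Rightarrow> 'a" where
  "poly_eval x P = fold_coeffs (\<lambda>a v. a *\<^sub>C 1 + x * v) P 0"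

lemma poly_eval_0 [simp]: "poly_eval x 0 = 0"
  by (simp add: poly_eval_def)

lemma poly_eval_pCons [simp]: "poly_eval x (pCons a P) = a *\<^sub>C 1 + x * poly_eval x P"
  by (cases "P = 0 \<and> a = 0") (auto simp: poly_eval_def)

lemma poly_eval_add [simp]: "poly_eval x (P + Q) = poly_eval x P + poly_eval x Q"
  by (induction P Q rule: poly_induct2) (simp_all add: algebra_simps scaleC_add_left)

lemma poly_eval_smult [simp]: "poly_eval x (smult c P) = c *\<^sub>C poly_eval x P"
  by (induction P) (simp_all add: scaleC_add_right scaleC_scaleC mult_scaleC_right)

lemma poly_eval_uminus [simp]: "poly_eval x (- P) = - poly_eval x P"
  using poly_eval_smult[of x "-1" P] by (simp add: scaleC_minus_left)

lemma poly_eval_diff [simp]: "poly_eval x (P - Q) = poly_eval x P - poly_eval x Q"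
  using poly_eval_add[of x P "- Q"] by simp

lemma poly_eval_commute_self: "x * poly_eval x P = poly_eval x P * x"
proof (induction P)
  case (pCons a P)
  then have "x * (x * poly_eval x P) = (x * poly_eval x P) * x"
    by (metis mult.assoc)
  then show ?case
    by (simp add: distrib_left distrib_right mult_scaleC_left mult_scaleC_right)
qed simp

lemma poly_eval_mult [simp]: "poly_eval x (P * Q) = poly_eval x P * poly_eval x Q"
  by (induction P) (simp_all add: algebra_simps mult_scaleC_left mult.assoc)

lemma poly_eval_commute: "poly_eval x P * poly_eval x Q = poly_eval x Q * poly_eval x P"
proof -
  have "poly_eval x (P * Q) = poly_eval x (Q * P)" by (simp only: mult.commute)
  then show ?thesis by (simp only: poly_eval_mult)
qed

text \<open>All roots of \<open>P\<close> lie off the spectrum, so \<open>P\<close> splits over the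
  complex numbers into linear factors that become invertible at \<open>x\<close>.\<close>

lemma invertible_poly_eval:
  fixes x :: "'a::complex_banach_algebra"
  assumes "P \<noteq> 0" and "\<And>z. z \<in> spectrum x \<Longrightarrow> poly P z \<noteq> 0"
  shows "invertible_elt (poly_eval x P)"
  using assms
proof (induction "degree P" arbitrary: P rule: less_induct)
  case less
  show ?case
  proof (cases "degree P = 0")
    case True
    then obtain a where "P = [:a:]" by (metis degree_eq_zeroE)
    then show ?thesis using less.prems by (simp add: invertible_elt_scaleC)
  next
    case False
    then have "\<not> constant (poly P)" by (simp add: constant_degree)
    then obtain z where z: "poly P z = 0"
      using fundamental_theorem_of_algebra by blast
    then obtain Q where Q: "P = [:-z, 1:] * Q" by (auto simp: poly_eq_0_iff_dvd)
    have "z \<notin> spectrum x" using z less.prems by blast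
    then have "invertible_elt ((-1) *\<^sub>C (z *\<^sub>C 1 - x))"
      by (intro invertible_elt_scaleC) (auto simp: spectrum_iff)
    then have 1: "invertible_elt (poly_eval x [:-z, 1:])"
      by (simp add: scaleC_minus_left)
    have "Q \<noteq> 0" using less.prems Q by auto
    then have "degree P = Suc (degree Q)" by (simp add: Q degree_mult_eq del: mult_pCons_left)
    moreover have "poly Q w \<noteq> 0" if "w \<in> spectrum x" for w
      using less.prems(2)[OF that] by (simp add: Q)
    ultimately have "invertible_elt (poly_eval x Q)"
      using \<open>Q \<noteq> 0\<close> by (intro less.hyps) auto
    then show ?thesis using 1 unfolding Q poly_eval_mult by (rule invertible_elt_mult[rotated])
  qed
qed

section \<open>Involutions and star homomorphisms on polynomials\<close>

lemma involutionD:
  assumes "involution star"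
  shows "star (x + y) = star x + star y" "star (c *\<^sub>C x) = cnj c *\<^sub>C star x"
    "star (x * y) = star y * star x" "star (star x) = x"
  using assms by (auto simp: involution_def)

lemma involution_zero: "involution star \<Longrightarrow> star 0 = 0"
  using involutionD(1)[of star 0 0] by simp

lemma involution_one: "involution star \<Longrightarrow> star 1 = 1"
  using involutionD(3)[of star "star 1" 1] by (simp add: involutionD(4))

lemma involution_minus: "involution star \<Longrightarrow> star (- x) = - star x"
  using involutionD(1)[of star x "- x"] by (simp add: involution_zero eq_neg_iff_add_eq_0 add.commute)

lemma involution_diff: "involution star \<Longrightarrow> star (x - y) = star x - star y"
  using involutionD(1)[of star x "- y"] by (simp add: involution_minus)

lemma involution_scaleR: "involution star \<Longrightarrow> star (r *\<^sub>R x) = r *\<^sub>R star x"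
  using involutionD(2)[of star "complex_of_real r" x] by (simp add: scaleC_of_real)

lemma involution_power: "involution star \<Longrightarrow> star (x ^ n) = star x ^ n"
  by (induction n) (simp_all add: involution_one involutionD power_commutes)

lemma involution_poly_eval:
  assumes "involution star"
  shows "star (poly_eval x P) = poly_eval (star x) (map_poly cnj P)"
  by (induction P) (simp_all add: assms involution_zero involution_one involutionD map_poly_pCons
      poly_eval_commute_self)

lemma spectrum_self_adjoint:
  assumes "involution star" "star x = x" "c \<in> spectrum x"
  shows "cnj c \<in> spectrum x"
proof -
  have "invertible_elt (star y)" if "invertible_elt y" for y
    using that assms(1) unfolding invertible_elt_def by (metis involutionD(3) involution_one)
  then have "\<not> invertible_elt (star (c *\<^sub>C 1 - x))"
    using assms by (metis involutionD(4) spectrum_iff)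
  then show ?thesis
    using assms(1,2) by (simp add: spectrum_iff involution_diff involutionD involution_one)
qed

lemma unital_star_homD:
  assumes "unital_star_hom starA starB f"
  shows "f (x + y) = f x + f y" "f (c *\<^sub>C x) = c *\<^sub>C f x" "f (x * y) = f x * f y" "f 1 = 1"
    "f (starA x) = starB (f x)"
  using assms by (auto simp: unital_star_hom_def)

lemma unital_star_hom_zero: "unital_star_hom starA starB f \<Longrightarrow> f 0 = 0"
  using unital_star_homD(1)[of starA starB f 0 0] by simp

lemma unital_star_hom_scaleR: "unital_star_hom starA starB f \<Longrightarrow> f (r *\<^sub>R x) = r *\<^sub>R f x"
  using unital_star_homD(2)[of starA starB f "complex_of_real r" x] by (simp add: scaleC_of_real)

lemma unital_star_hom_diff: "unital_star_hom starA starB f \<Longrightarrow> f (x - y) = f x - f y"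
  using unital_star_homD(1)[of starA starB f "x - y" y] by (simp add: eq_diff_eq)

lemma unital_star_hom_poly_eval:
  "unital_star_hom starA starB f \<Longrightarrow> f (poly_eval x P) = poly_eval (f x) P"
  by (induction P) (simp_all add: unital_star_homD unital_star_hom_zero)

text \<open>An idempotent acts as \<open>1\<close> on one complementary part and as \<open>0\<close>
  on the other. Hence the image in \<open>B\<close> of a rational expression in \<open>x\<close>
  depends only on its values at \<open>0\<close> and \<open>1\<close>.\<close>

lemma poly_eval_idempotent:
  assumes "q * q = q"
  shows "poly_eval q P = poly P 0 *\<^sub>C (1 - q) + poly P 1 *\<^sub>C q"
proof (induction P)
  case (pCons a P)
  have "poly_eval q (pCons a P) = a *\<^sub>C 1 + poly P 1 *\<^sub>C q"
    by (simp add: pCons assms distrib_left right_diff_distrib mult_scaleC_right)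
  then show ?case by (simp add: scaleC_diff_right scaleC_add_left)
qed auto

section \<open>The inverse square root series and exact symmetries\<close>

text \<open>The binomial series of \<open>(1 + u) powr (- 1 / 2)\<close>; for \<open>u = e\<^sup>2 - 1\<close> it turns the near symmetry \<open>e\<close> into an exact one.\<close>
definition inv_sqrt_series :: "'a::complex_banach_algebra \<Rightarrow> 'a" where
  "inv_sqrt_series u = (\<Sum>n. ((- 1 / 2 :: real) gchoose n) *\<^sub>R u ^ n)"

text \<open>Successive coefficients have ratio \<open>(n + 1 / 2) / (n + 1)\<close> in absolute
  value, so they never grow; the series then converges whenever the norms of the powers are
  summable.\<close>

lemma abs_gbinomial_minus_half_le: "\<bar>(- 1 / 2 :: real) gchoose n\<bar> \<le> 1"
proof (induction n)
  case (Suc n)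
  let ?b = "\<lambda>n. (- 1 / 2 :: real) gchoose n"
  have "real (Suc n) * ?b (Suc n) = (- 1 / 2 - real n) * ?b n"
    using gbinomial_mult_1[of "- 1 / 2 :: real" n] by (simp only: left_diff_distrib)
  then have "?b (Suc n) = (- 1 / 2 - real n) / real (Suc n) * ?b n"
    by (metis nonzero_mult_div_cancel_left of_nat_eq_0_iff old.nat.distinct(2) times_divide_eq_left)
  then have "\<bar>?b (Suc n)\<bar> = \<bar>(- 1 / 2 - real n) / real (Suc n)\<bar> * \<bar>?b n\<bar>"
    by (simp only: abs_mult)
  also have "\<dots> \<le> 1 * 1"
    by (intro mult_mono Suc) (auto simp: field_simps abs_if)
  finally show ?case by simp
qed auto

lemma power_minus_scaleR: "(- x) ^ n = (- 1 :: real) ^ n *\<^sub>R (x :: 'a::complex_banach_algebra) ^ n"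
  by (induction n) simp_all

context
  fixes u :: "'a::complex_banach_algebra"
  assumes sm: "summable (\<lambda>n. norm (u ^ n))"
begin

lemma summable_norm_inv_sqrt_series: "summable (\<lambda>n. norm (((- 1 / 2 :: real) gchoose n) *\<^sub>R u ^ n))"
  by (rule summable_comparison_test'[OF sm])
    (use abs_gbinomial_minus_half_le in \<open>auto intro: mult_left_le_one_le\<close>)

lemma inv_sqrt_series_sums: "(\<lambda>n. ((- 1 / 2 :: real) gchoose n) *\<^sub>R u ^ n) sums inv_sqrt_series u"
  unfolding inv_sqrt_series_def
  by (rule summable_sums[OF summable_norm_cancel[OF summable_norm_inv_sqrt_series]])

text \<open>By Vandermonde the Cauchy square of the coefficients is \<open>(- 1) gchoose n\<close>,
  so the square of the series is the Neumann series of \<open>1 + u\<close>.\<close>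

lemma inv_sqrt_series_square: "inv_sqrt_series u * inv_sqrt_series u * (1 + u) = 1"
proof -
  let ?b = "\<lambda>n. (- 1 / 2 :: real) gchoose n"
  have "inv_sqrt_series u * inv_sqrt_series u
      = (\<Sum>n. \<Sum>i\<le>n. (?b i *\<^sub>R u ^ i) * (?b (n - i) *\<^sub>R u ^ (n - i)))"
    unfolding inv_sqrt_series_def
    by (rule Cauchy_product) (rule summable_norm_inv_sqrt_series)+
  also have "\<dots> = (\<Sum>n. (- u) ^ n)"
  proof (rule suminf_cong)
    fix n
    have "(\<Sum>i\<le>n. (?b i *\<^sub>R u ^ i) * (?b (n - i) *\<^sub>R u ^ (n - i))) = (\<Sum>i\<le>n. (?b i * ?b (n - i)) *\<^sub>R u ^ n)"
      by (intro sum.cong) (auto simp flip: power_add)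
    also have "\<dots> = (\<Sum>i\<in>{0..n}. ?b i * ?b (n - i)) *\<^sub>R u ^ n"
      by (simp add: scaleR_sum_left atLeast0AtMost)
    also have "\<dots> = ((- 1) gchoose n) *\<^sub>R u ^ n"
      by (simp only: gbinomial_Vandermonde) simp
    also have "\<dots> = (- 1) ^ n *\<^sub>R u ^ n"
      by (simp add: gbinomial_minus[of "1::real" n] flip: binomial_gbinomial)
    finally show "(\<Sum>i\<le>n. (?b i *\<^sub>R u ^ i) * (?b (n - i) *\<^sub>R u ^ (n - i))) = (- u) ^ n"
      by (simp only: power_minus_scaleR)
  qed
  finally have *: "inv_sqrt_series u * inv_sqrt_series u = (\<Sum>n. (- u) ^ n)" .
  have "norm ((- u) ^ n) = norm (u ^ n)" for n
    by (simp add: power_minus_scaleR)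
  then show ?thesis
    using neumann_series(2)[of "- u"] sm by (simp add: *)
qed

lemma inv_sqrt_series_commute:
  assumes "e * u = u * e"
  shows "e * inv_sqrt_series u = inv_sqrt_series u * e"
proof -
  have "e * u ^ n = u ^ n * e" for n
    by (induction n) (simp_all, metis assms mult.assoc)
  then have "(\<lambda>n. e * (((- 1 / 2 :: real) gchoose n) *\<^sub>R u ^ n)) sums (inv_sqrt_series u * e)"
    using sums_mult2[OF inv_sqrt_series_sums, of e] by simp
  then show ?thesis
    using sums_mult[OF inv_sqrt_series_sums, of e] by (rule sums_unique2[rotated])
qed

lemma involution_inv_sqrt_series:
  assumes "involution star" "continuous_on UNIV star" "star u = u"
  shows "star (inv_sqrt_series u) = inv_sqrt_series u"
proof -
  have fin: "star (\<Sum>n\<in>I. f n) = (\<Sum>n\<in>I. star (f n))" for f :: "nat \<Rightarrow> 'a" and I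
    by (induction I rule: infinite_finite_induct)
      (auto simp: assms(1) involution_zero involutionD)
  have "isCont star (inv_sqrt_series u)"
    using assms(2) by (simp add: continuous_on_eq_continuous_at)
  then have "(\<lambda>n. star (\<Sum>i<n. ((- 1 / 2 :: real) gchoose i) *\<^sub>R u ^ i)) \<longlonglongrightarrow> star (inv_sqrt_series u)"
    using inv_sqrt_series_sums unfolding sums_def by (rule isCont_tendsto_compose)
  then have "(\<lambda>n. ((- 1 / 2 :: real) gchoose n) *\<^sub>R u ^ n) sums star (inv_sqrt_series u)"
    by (simp add: sums_def fin involution_scaleR involution_power assms)
  then show ?thesis using inv_sqrt_series_sums by (rule sums_unique2)
qed

lemma hom_inv_sqrt_series:
  assumes "unital_star_hom starA starB \<phi>" "bounded_linear \<phi>" "\<phi> u = 0"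
  shows "\<phi> (inv_sqrt_series u) = 1"
proof -
  have pow: "\<phi> (u ^ n) = 0 ^ n" for n
    by (induction n) (simp_all add: unital_star_homD[OF assms(1)] assms(3))
  have "(\<lambda>n. \<phi> (((- 1 / 2 :: real) gchoose n) *\<^sub>R u ^ n)) sums \<phi> (inv_sqrt_series u)"
    by (rule bounded_linear.sums[OF assms(2) inv_sqrt_series_sums])
  moreover have "(\<lambda>n. \<phi> (((- 1 / 2 :: real) gchoose n) *\<^sub>R u ^ n)) sums 1"
  proof -
    have "\<phi> (((- 1 / 2 :: real) gchoose n) *\<^sub>R u ^ n) = (if n = 0 then 1 else 0)" for n
      by (cases n) (simp_all add: unital_star_hom_scaleR[OF assms(1)] unital_star_homD(3,4)[OF assms(1)] assms(3))
    then show ?thesis by (simp only: sums_single[of 0 "\<lambda>_. 1"])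
  qed
  ultimately show ?thesis by (rule sums_unique2)
qed

end

lemma idempotent_symmetry_square:
  fixes q :: "'a::complex_banach_algebra"
  assumes "q * q = q"
  shows "(2 *\<^sub>R q - 1) * (2 *\<^sub>R q - 1) = 1"
proof -
  define v where "v = 2 *\<^sub>R q"
  have "v * v = v + v" by (simp add: v_def assms flip: scaleR_2)
  then have "(v - 1) * (v - 1) = 1" by (simp add: left_diff_distrib right_diff_distrib)
  then show ?thesis by (simp only: v_def)
qed

text \<open>The series \<open>s\<close> in \<open>u = e * e - 1\<close> commutes with
  \<open>e\<close> and satisfies \<open>s * s * (e * e) = 1\<close>, so \<open>e * s\<close> is a
  symmetry and \<open>p\<close> its idempotent. The lemma serves twice: for the single lift of
  \<open>q 0\<close>, and at each \<open>t\<close> near \<open>0\<close>.\<close>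

lemma self_adjoint_idempotents_of_near_symmetry:
  fixes e :: "'a::complex_banach_algebra"
  assumes star: "involution starA" "continuous_on UNIV starA" "starA e = e"
    and sm: "summable (\<lambda>n. norm ((e * e - 1) ^ n))"
  defines "p \<equiv> (1 / 2) *\<^sub>R (1 + e * inv_sqrt_series (e * e - 1))"
  shows "p \<in> self_adjoint_idempotents starA"
    and "unital_star_hom starA starB \<phi> \<Longrightarrow> bounded_linear \<phi> \<Longrightarrow> q * q = q \<Longrightarrow>
      \<phi> e = 2 *\<^sub>R q - 1 \<Longrightarrow> \<phi> p = q"
proof -
  define u where "u = e * e - 1"
  define s where "s = inv_sqrt_series u"
  have p: "p = (1 / 2) *\<^sub>R (1 + e * s)" by (simp add: p_def u_def s_def)
  have sm': "summable (\<lambda>n. norm (u ^ n))" using sm by (simp add: u_def)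
  have eu: "e * u = u * e" by (simp add: u_def algebra_simps)
  have es: "e * s = s * e" unfolding s_def by (rule inv_sqrt_series_commute[OF sm' eu])
  have us: "s * s * (1 + u) = 1" unfolding s_def by (rule inv_sqrt_series_square[OF sm'])
  have su: "starA u = u"
    by (simp add: u_def star involutionD(3)[OF star(1)] involution_diff involution_one)
  have ss: "starA s = s"
    unfolding s_def by (rule involution_inv_sqrt_series[OF sm' star(1,2) su])
  have "(e * s) * (e * s) = s * s * (e * e)"
    by (metis es mult.assoc)
  then have sq: "(e * s) * (e * s) = 1" using us by (simp add: u_def)
  have "p * p = (1 / 4) *\<^sub>R (1 + e * s + (e * s + (e * s) * (e * s)))"
  proof -
    have "p * p = (1 / 4) *\<^sub>R ((1 + e * s) * (1 + e * s))" by (simp add: p)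
    also have "(1 + e * s) * (1 + e * s) = 1 + e * s + (e * s + (e * s) * (e * s))"
      by (simp only: distrib_left distrib_right mult_1_left mult_1_right add.assoc)
    finally show ?thesis .
  qed
  also have "\<dots> = (1 / 4) *\<^sub>R (2 *\<^sub>R (1 + e * s))"
    unfolding sq by (simp add: scaleR_2)
  also have "\<dots> = p" by (simp add: p)
  finally have "p ^ 2 = p" by (simp add: power2_eq_square)
  moreover have "starA p = p"
    by (simp add: p star involutionD(1,3)[OF star(1)] involution_one involution_scaleR ss flip: es)
  ultimately show "p \<in> self_adjoint_idempotents starA"
    by (simp add: self_adjoint_idempotents_def)
  assume hom: "unital_star_hom starA starB \<phi>" "bounded_linear \<phi>" "q * q = q" "\<phi> e = 2 *\<^sub>R q - 1"
  have "\<phi> u = 0"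
    using idempotent_symmetry_square[OF hom(3)]
    by (simp add: u_def unital_star_homD(3,4)[OF hom(1)] unital_star_hom_diff[OF hom(1)] hom(4))
  then have "\<phi> s = 1" unfolding s_def by (intro hom_inv_sqrt_series[OF sm' hom(1,2)])
  then show "\<phi> p = q"
    by (simp add: p unital_star_homD[OF hom(1)] unital_star_hom_scaleR[OF hom(1)] hom(4))
qed

subsection \<open>Rational approximation of locally constant functions\<close>

definition rational_on :: "complex set \<Rightarrow> (complex \<Rightarrow> complex) \<Rightarrow> bool" where
  "rational_on K f \<longleftrightarrow> (\<exists>N D. \<forall>z\<in>K. poly D z \<noteq> 0 \<and> f z = poly N z / poly D z)"

text \<open>Uniform approximation as in Runge's theorem. The poles may lie anywhere off
  \<open>K\<close>, so the shape of the complement of \<open>K\<close> imposes nothing.\<close>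

definition rational_limit_on :: "complex set \<Rightarrow> (complex \<Rightarrow> complex) \<Rightarrow> bool" where
  "rational_limit_on K f \<longleftrightarrow> (\<forall>e>0. \<exists>g. rational_on K g \<and> (\<forall>z\<in>K. norm (f z - g z) < e))"

lemma rational_on_const: "rational_on K (\<lambda>z. c)"
  unfolding rational_on_def by (rule exI[of _ "[:c:]"], rule exI[of _ 1]) auto

lemma rational_on_add:
  assumes "rational_on K f" "rational_on K g"
  shows "rational_on K (\<lambda>z. f z + g z)"
proof -
  obtain N D N' D' where "\<forall>z\<in>K. poly D z \<noteq> 0 \<and> f z = poly N z / poly D z"
    "\<forall>z\<in>K. poly D' z \<noteq> 0 \<and> g z = poly N' z / poly D' z"
    using assms unfolding rational_on_def by blast
  then have "\<forall>z\<in>K. poly (D * D') z \<noteq> 0 \<and> f z + g z = poly (N * D' + N' * D) z / poly (D * D') z"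
    by (auto simp: add_frac_eq)
  then show ?thesis unfolding rational_on_def by blast
qed

lemma rational_on_cmult:
  assumes "rational_on K f"
  shows "rational_on K (\<lambda>z. c * f z)"
proof -
  obtain N D where "\<forall>z\<in>K. poly D z \<noteq> 0 \<and> f z = poly N z / poly D z"
    using assms unfolding rational_on_def by blast
  then have "\<forall>z\<in>K. poly D z \<noteq> 0 \<and> c * f z = poly (smult c N) z / poly D z" by auto
  then show ?thesis unfolding rational_on_def by blast
qed

lemma rational_on_sum:
  "(\<And>i. i \<in> I \<Longrightarrow> rational_on K (f i)) \<Longrightarrow> rational_on K (\<lambda>z. \<Sum>i\<in>I. f i z)"
  by (induction I rule: infinite_finite_induct) (auto intro: rational_on_const rational_on_add)

lemma rational_on_pole: "a \<notin> K \<Longrightarrow> rational_on K (\<lambda>z. c / (a - z))"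
  unfolding rational_on_def by (rule exI[of _ "[:c:]"], rule exI[of _ "[:a, -1:]"]) auto

lemma rational_limit_on_cong:
  "rational_limit_on K f \<Longrightarrow> (\<And>z. z \<in> K \<Longrightarrow> f z = g z) \<Longrightarrow> rational_limit_on K g"
  by (auto simp: rational_limit_on_def)

lemma rational_limit_on_rational: "rational_on K f \<Longrightarrow> rational_limit_on K f"
  unfolding rational_limit_on_def by (intro allI impI exI[of _ f]) auto

lemma rational_limit_on_add:
  assumes "rational_limit_on K f" "rational_limit_on K g"
  shows "rational_limit_on K (\<lambda>z. f z + g z)"
  unfolding rational_limit_on_def
proof (intro allI impI)
  fix e :: real assume "e > 0"
  then have "e / 2 > 0" by simp
  then obtain f' g' where *: "rational_on K f'" "\<forall>z\<in>K. norm (f z - f' z) < e / 2"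
    "rational_on K g'" "\<forall>z\<in>K. norm (g z - g' z) < e / 2"
    using assms unfolding rational_limit_on_def by meson
  have "norm (f z + g z - (f' z + g' z)) < e" if "z \<in> K" for z
    using norm_triangle_ineq[of "f z - f' z" "g z - g' z"] *(2,4) that
    by (auto simp: algebra_simps dest!: bspec)
  then show "\<exists>h. rational_on K h \<and> (\<forall>z\<in>K. norm (f z + g z - h z) < e)"
    using rational_on_add[OF *(1,3)] by blast
qed

lemma rational_limit_on_cmult:
  assumes "rational_limit_on K f"
  shows "rational_limit_on K (\<lambda>z. c * f z)"
  unfolding rational_limit_on_def
proof (intro allI impI)
  fix e :: real assume "e > 0"
  then have "e / (norm c + 1) > 0" by (simp add: add_nonneg_pos)
  then obtain f' where *: "rational_on K f'" "\<forall>z\<in>K. norm (f z - f' z) < e / (norm c + 1)"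
    using assms unfolding rational_limit_on_def by meson
  have "norm (c * f z - c * f' z) < e" if "z \<in> K" for z
  proof -
    have "norm (c * f z - c * f' z) \<le> (norm c + 1) * norm (f z - f' z)"
      by (simp add: mult_right_mono norm_mult flip: right_diff_distrib)
    also have "\<dots> < e"
      using *(2) that by (simp add: less_divide_eq add_nonneg_pos mult.commute)
    finally show ?thesis .
  qed
  then show "\<exists>h. rational_on K h \<and> (\<forall>z\<in>K. norm (c * f z - h z) < e)"
    using rational_on_cmult[OF *(1)] by blast
qed

lemma rational_limit_on_sum:
  "(\<And>i. i \<in> I \<Longrightarrow> rational_limit_on K (f i)) \<Longrightarrow> rational_limit_on K (\<lambda>z. \<Sum>i\<in>I. f i z)"
  by (induction I rule: infinite_finite_induct)
    (auto intro: rational_on_const rational_limit_on_rational rational_limit_on_add)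

text \<open>The error is expressed through the oscillation alone, so that one \<open>n\<close> can
  serve a whole family of integrands.\<close>

lemma riemann_sum_unit_interval:
  fixes g :: "real \<Rightarrow> 'a::banach"
  assumes cont: "continuous_on {0..1} g" and "0 < n"
    and e: "\<And>s t. s \<in> {0..1} \<Longrightarrow> t \<in> {0..1} \<Longrightarrow> \<bar>s - t\<bar> \<le> 1 / real n \<Longrightarrow> norm (g s - g t) \<le> e"
  shows "norm (integral {0..1} g - (\<Sum>k<n. (1 / real n) *\<^sub>R g (real k / real n))) \<le> e"
proof -
  have int: "g integrable_on {a..b}" if "0 \<le> a" "b \<le> 1" for a b
    by (rule integrable_continuous_real) (rule continuous_on_subset[OF cont], use that in auto)
  have split: "integral {0..real m / n} g = (\<Sum>k<m. integral {real k / n..real (Suc k) / n} g)"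
    if "m \<le> n" for m
    using that
  proof (induction m)
    case (Suc m)
    have "integral {0..real m / n} g + integral {real m / n..real (Suc m) / n} g
        = integral {0..real (Suc m) / n} g"
      using Suc.prems \<open>0 < n\<close>
      by (intro Henstock_Kurzweil_Integration.integral_combine int) (auto simp: field_simps)
    then show ?case using Suc by simp
  qed auto
  have piece: "norm (integral {real k / n..real (Suc k) / n} g - (1 / real n) *\<^sub>R g (real k / real n))
      \<le> e * (1 / n)" if "k < n" for k
  proof -
    have kn: "0 \<le> real k / n" "real k / n \<le> real (Suc k) / n" "real (Suc k) / n \<le> 1"
      using that by (auto simp: field_simps)
    have len: "real (Suc k) / n - real k / n = 1 / n" using that by (simp add: field_simps)
    have "integral {real k / n..real (Suc k) / n} g - (1 / real n) *\<^sub>R g (real k / real n)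
        = integral {real k / n..real (Suc k) / n} (\<lambda>s. g s - g (real k / n))"
      using kn len by (subst integral_diff) (auto intro: int)
    also have "norm \<dots> \<le> e * (real (Suc k) / n - real k / n)"
    proof (rule integral_bound)
      show "continuous_on {real k / n..real (Suc k) / n} (\<lambda>s. g s - g (real k / n))"
        by (intro continuous_intros continuous_on_subset[OF cont]) (use kn in auto)
      show "norm (g s - g (real k / n)) \<le> e" if "s \<in> {real k / n..real (Suc k) / n}" for s
        using that kn(1) order_trans[OF _ kn(3)] order_trans[OF kn(1)] len by (intro e) auto
    qed (use kn in auto)
    finally show ?thesis unfolding len .
  qed
  have "integral {0..1} g = (\<Sum>k<n. integral {real k / n..real (Suc k) / n} g)"
    using split[of n] \<open>0 < n\<close> by simp
  then have "norm (integral {0..1} g - (\<Sum>k<n. (1 / real n) *\<^sub>R g (real k / real n)))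
      = norm (\<Sum>k<n. integral {real k / n..real (Suc k) / n} g - (1 / real n) *\<^sub>R g (real k / real n))"
    by (simp add: sum_subtractf)
  also have "\<dots> \<le> (\<Sum>k<n. e * (1 / n))"
    by (rule sum_norm_le) (use piece in auto)
  also have "\<dots> = e" using \<open>0 < n\<close> by simp
  finally show ?thesis .
qed

section \<open>Cauchy integrals along segments and squares\<close>

text \<open>The integral of \<open>1 / (w - z)\<close> along the segment, without the factor
  \<open>1 / (2 * pi * \<i>)\<close>, parametrised over the unit interval so that its Riemann sums
  are visibly rational in \<open>z\<close>.\<close>

definition cauchy_segment :: "complex \<Rightarrow> complex \<Rightarrow> complex \<Rightarrow> complex" where
  "cauchy_segment a b z = integral {0..1} (\<lambda>s. (b - a) / (linepath a b s - z))"

lemma linepath_in_segment: "s \<in> {0..1} \<Longrightarrow> linepath a b s \<in> closed_segment a b"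
  by (metis image_eqI linepath_image_01)

lemma continuous_on_cauchy_kernel:
  fixes a b :: complex
  assumes "closed_segment a b \<inter> K = {}"
  shows "continuous_on (K \<times> {0..1}) (\<lambda>(z, s). (b - a) / (linepath a b s - z))"
  unfolding case_prod_beta
proof (rule continuous_on_divide)
  show "continuous_on (K \<times> {0..1}) (\<lambda>p. linepath a b (snd p) - fst p)"
    unfolding linepath_def by (intro continuous_intros)
qed (use assms linepath_in_segment[of _ a b] in \<open>auto simp: disjoint_iff\<close>)

lemma continuous_on_cauchy_segment:
  assumes "closed_segment a b \<inter> K = {}"
  shows "continuous_on K (cauchy_segment a b)"
  unfolding cauchy_segment_def
  using integral_continuous_on_param[of K 0 "1::real" "\<lambda>z s. (b - a) / (linepath a b s - z)"]
    continuous_on_cauchy_kernel[OF assms] by simp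

lemma continuous_on_cauchy_kernel_path:
  fixes a b :: complex
  assumes "z \<notin> closed_segment a b"
  shows "continuous_on {0..1} (\<lambda>s. (b - a) / (linepath a b s - z))"
  by (rule continuous_on_divide)
    (use assms linepath_in_segment[of _ a b] in \<open>auto intro!: continuous_intros continuous_on_linepath\<close>)

lemma contour_integral_cauchy_segment:
  assumes "z \<notin> closed_segment a b"
  shows "contour_integral (linepath a b) (\<lambda>w. 1 / (w - z)) = cauchy_segment a b z"
proof (rule contour_integral_unique)
  have "((\<lambda>s. (b - a) / (linepath a b s - z)) has_integral cauchy_segment a b z) {0..1}"
    unfolding cauchy_segment_def
    by (intro integrable_integral integrable_continuous_real continuous_on_cauchy_kernel_path assms)
  then show "((\<lambda>w. 1 / (w - z)) has_contour_integral cauchy_segment a b z) (linepath a b)"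
    by (simp add: has_contour_integral_linepath)
qed

text \<open>A Riemann sum of the kernel is rational in \<open>z\<close> with poles on the segment.
  The kernel is uniformly continuous on the compact product of \<open>K\<close> and the unit
  interval, so one mesh works for every \<open>z\<close>.\<close>

lemma rational_limit_cauchy_segment:
  assumes K: "compact K" and disj: "closed_segment a b \<inter> K = {}"
  shows "rational_limit_on K (cauchy_segment a b)"
  unfolding rational_limit_on_def
proof (intro allI impI)
  fix e :: real assume "e > 0"
  let ?f = "\<lambda>z s. (b - a) / (linepath a b s - z)"
  have "uniformly_continuous_on (K \<times> {0..1}) (\<lambda>(z, s). ?f z s)"
    by (intro compact_uniformly_continuous continuous_on_cauchy_kernel disj compact_Times K) auto
  then obtain d where "d > 0" and d': "\<forall>x\<in>K \<times> {0..1}. \<forall>x'\<in>K \<times> {0..1}. dist x' x < d \<longrightarrow>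
      dist (case x' of (z, s) \<Rightarrow> ?f z s) (case x of (z, s) \<Rightarrow> ?f z s) < e / 2"
    unfolding uniformly_continuous_on_def using \<open>e > 0\<close> by (meson half_gt_zero)
  have d: "dist (?f z s) (?f z t) < e / 2"
    if "z \<in> K" "s \<in> {0..1}" "t \<in> {0..1}" "dist s t < d" for z s t
    using d'[rule_format, of "(z, t)" "(z, s)"] that by (simp add: dist_Pair_Pair)
  obtain n where n: "1 / real (Suc n) < d"
    using \<open>d > 0\<close> nat_approx_posE by blast
  let ?g = "\<lambda>z. \<Sum>k<Suc n. (1 / real (Suc n)) *\<^sub>R ?f z (real k / real (Suc n))"
  have "rational_on K ?g"
  proof (rule rational_on_sum)
    fix k assume "k \<in> {..<Suc n}"
    then have "linepath a b (real k / real (Suc n)) \<in> closed_segment a b"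
      by (intro linepath_in_segment) auto
    then have "linepath a b (real k / real (Suc n)) \<notin> K" using disj by blast
    then show "rational_on K (\<lambda>z. (1 / real (Suc n)) *\<^sub>R ?f z (real k / real (Suc n)))"
      unfolding scaleR_conv_of_real by (intro rational_on_cmult rational_on_pole)
  qed
  moreover have "norm (cauchy_segment a b z - ?g z) < e" if "z \<in> K" for z
  proof -
    have "norm (cauchy_segment a b z - ?g z) \<le> e / 2"
      unfolding cauchy_segment_def
    proof (rule riemann_sum_unit_interval)
      show "continuous_on {0..1} (?f z)"
        by (rule continuous_on_cauchy_kernel_path) (use that disj in auto)
      show "norm (?f z s - ?f z t) \<le> e / 2"
        if "s \<in> {0..1}" "t \<in> {0..1}" "\<bar>s - t\<bar> \<le> 1 / real (Suc n)" for s t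
        using d[OF \<open>z \<in> K\<close> that(1,2)] that(3) n by (simp add: dist_norm)
    qed auto
    then show ?thesis using \<open>e > 0\<close> by linarith
  qed
  ultimately show "\<exists>g. rational_on K g \<and> (\<forall>z\<in>K. norm (cauchy_segment a b z - g z) < e)"
    by blast
qed

text \<open>The value is the winding number of the rectangle. Opposite sides are written in the same
  direction with opposite signs, which is the form in which edges shared by neighbouring cells
  cancel.\<close>

lemma cauchy_segment_square:
  assumes "Re a < Re b" "Im a < Im b" and z: "z \<notin> cbox a b - box a b"
  shows "cauchy_segment a (Complex (Re b) (Im a)) z + cauchy_segment (Complex (Re b) (Im a)) b z
      - cauchy_segment (Complex (Re a) (Im b)) b z - cauchy_segment a (Complex (Re a) (Im b)) z
      = (if z \<in> box a b then 2 * pi * \<i> else 0)"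
proof -
  define c d where "c = Complex (Re b) (Im a)" and "d = Complex (Re a) (Im b)"
  let ?f = "\<lambda>w. 1 / (w - z)"
  have np: "z \<notin> path_image (rectpath a b)"
    using z assms by (subst path_image_rectpath_cbox_minus_box) auto
  have rp: "rectpath a b = linepath a c +++ linepath c b +++ linepath b d +++ linepath d a"
    by (simp add: rectpath_def Let_def c_def d_def)
  have nz: "z \<notin> closed_segment a c" "z \<notin> closed_segment c b" "z \<notin> closed_segment b d" "z \<notin> closed_segment d a"
    using np by (auto simp: rp path_image_join)
  have ci: "?f contour_integrable_on linepath u v" if "z \<notin> closed_segment u v" for u v
    by (rule contour_integrable_continuous_linepath) (intro continuous_intros, use that in auto)
  have rev: "contour_integral (linepath u v) ?f = - contour_integral (linepath v u) ?f"
    if "z \<notin> closed_segment u v" for u v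
    by (rule contour_integral_reverse_linepath) (intro continuous_intros, use that in auto)
  have "contour_integral (rectpath a b) ?f = contour_integral (linepath a c) ?f
      + (contour_integral (linepath c b) ?f + (contour_integral (linepath b d) ?f + contour_integral (linepath d a) ?f))"
    unfolding rp using nz by (simp add: ci)
  also have "\<dots> = cauchy_segment a c z + (cauchy_segment c b z + (- cauchy_segment d b z + - cauchy_segment a d z))"
    using nz unfolding rev[OF nz(3)] rev[OF nz(4)]
    by (simp add: contour_integral_cauchy_segment closed_segment_commute)
  finally have 1: "contour_integral (rectpath a b) ?f
      = cauchy_segment a c z + cauchy_segment c b z - cauchy_segment d b z - cauchy_segment a d z" by simp
  have "winding_number (rectpath a b) z = 1 / (2 * pi * \<i>) * contour_integral (rectpath a b) ?f"
    by (rule winding_number_valid_path) (use np in auto)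
  then have 2: "contour_integral (rectpath a b) ?f = 2 * pi * \<i> * winding_number (rectpath a b) z"
    by simp
  have "winding_number (rectpath a b) z = (if z \<in> box a b then 1 else 0)"
    using z assms winding_number_rectpath winding_number_rectpath_outside[of a b z] by auto
  then have "contour_integral (rectpath a b) ?f = (if z \<in> box a b then 2 * pi * \<i> else 0)"
    unfolding 2 by simp
  then show ?thesis unfolding 1 c_def d_def .
qed

section \<open>Grid contours and the indicator of a clopen part\<close>

lemma sum_eq_sum_of_bool:
  fixes g :: "'i \<Rightarrow> 'b::ring_1"
  assumes "finite U" "S \<subseteq> U"
  shows "sum g S = (\<Sum>p\<in>U. of_bool (p \<in> S) * g p)"
proof -
  have "sum g S = (\<Sum>p\<in>U. if p \<in> S then g p else 0)"
    using assms by (simp add: sum.If_cases Int_absorb1)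
  also have "\<dots> = (\<Sum>p\<in>U. of_bool (p \<in> S) * g p)"
    by (rule sum.cong) auto
  finally show ?thesis .
qed

text \<open>Summation by parts: edges shared by two cells of \<open>S\<close> cancel in the sum of the boundaries.\<close>
lemma grid_boundary_sum:
  fixes H V :: "int \<Rightarrow> int \<Rightarrow> complex"
  assumes "finite S"
  defines "U \<equiv> S \<union> (\<lambda>(i, j). (i, j + 1)) ` S \<union> (\<lambda>(i, j). (i + 1, j)) ` S"
  shows "(\<Sum>(i, j)\<in>S. H i j + V (i + 1) j - H i (j + 1) - V i j)
    = (\<Sum>(i, j)\<in>U. (of_bool ((i, j) \<in> S) - of_bool ((i, j - 1) \<in> S)) * H i j)
      + (\<Sum>(i, j)\<in>U. (of_bool ((i - 1, j) \<in> S) - of_bool ((i, j) \<in> S)) * V i j)"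
proof -
  have fin: "finite U" using assms by simp
  \<comment> \<open>The top edge of a cell is the bottom edge of the cell above; after the shift all
    sums run over \<open>U\<close> and differ only in their indicator weights.\<close>
  have up: "(\<Sum>(i, j)\<in>S. H i (j + 1)) = (\<Sum>(i, j)\<in>U. of_bool ((i, j - 1) \<in> S) * H i j)"
  proof -
    have "(\<Sum>(i, j)\<in>S. H i (j + 1)) = (\<Sum>(i, j)\<in>(\<lambda>(i, j). (i, j + 1)) ` S. H i j)"
      by (subst sum.reindex) (auto simp: inj_on_def case_prod_beta)
    also have "\<dots> = (\<Sum>p\<in>U. of_bool (p \<in> (\<lambda>(i, j). (i, j + 1)) ` S) * (case p of (i, j) \<Rightarrow> H i j))"
      by (rule sum_eq_sum_of_bool[OF fin]) (auto simp: U_def)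
    also have "\<dots> = (\<Sum>(i, j)\<in>U. of_bool ((i, j - 1) \<in> S) * H i j)"
      by (intro sum.cong) (auto simp: image_iff case_prod_beta intro!: arg_cong[where f = of_bool] bexI)
    finally show ?thesis .
  qed
  have right: "(\<Sum>(i, j)\<in>S. V (i + 1) j) = (\<Sum>(i, j)\<in>U. of_bool ((i - 1, j) \<in> S) * V i j)"
  proof -
    have "(\<Sum>(i, j)\<in>S. V (i + 1) j) = (\<Sum>(i, j)\<in>(\<lambda>(i, j). (i + 1, j)) ` S. V i j)"
      by (subst sum.reindex) (auto simp: inj_on_def case_prod_beta)
    also have "\<dots> = (\<Sum>p\<in>U. of_bool (p \<in> (\<lambda>(i, j). (i + 1, j)) ` S) * (case p of (i, j) \<Rightarrow> V i j))"
      by (rule sum_eq_sum_of_bool[OF fin]) (auto simp: U_def)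
    also have "\<dots> = (\<Sum>(i, j)\<in>U. of_bool ((i - 1, j) \<in> S) * V i j)"
      by (intro sum.cong) (auto simp: image_iff case_prod_beta intro!: arg_cong[where f = of_bool] bexI)
    finally show ?thesis .
  qed
  have here: "(\<Sum>(i, j)\<in>S. g i j) = (\<Sum>(i, j)\<in>U. of_bool ((i, j) \<in> S) * g i j)"
    for g :: "int \<Rightarrow> int \<Rightarrow> complex"
    using sum_eq_sum_of_bool[OF fin, of S "\<lambda>(i, j). g i j"] by (auto simp: U_def case_prod_beta)
  have "(\<Sum>(i, j)\<in>S. H i j + V (i + 1) j - H i (j + 1) - V i j)
      = (\<Sum>(i, j)\<in>S. H i j) + (\<Sum>(i, j)\<in>S. V (i + 1) j) - (\<Sum>(i, j)\<in>S. H i (j + 1)) - (\<Sum>(i, j)\<in>S. V i j)"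
    by (simp add: case_prod_beta sum.distrib sum_subtractf)
  also have "\<dots> = (\<Sum>(i, j)\<in>U. of_bool ((i, j) \<in> S) * H i j) + (\<Sum>(i, j)\<in>U. of_bool ((i - 1, j) \<in> S) * V i j)
      - (\<Sum>(i, j)\<in>U. of_bool ((i, j - 1) \<in> S) * H i j) - (\<Sum>(i, j)\<in>U. of_bool ((i, j) \<in> S) * V i j)"
    unfolding up right here[of H] here[of V] ..
  also have "\<dots> = (\<Sum>(i, j)\<in>U. (of_bool ((i, j) \<in> S) - of_bool ((i, j - 1) \<in> S)) * H i j)
      + (\<Sum>(i, j)\<in>U. (of_bool ((i - 1, j) \<in> S) - of_bool ((i, j) \<in> S)) * V i j)"
    by (simp add: case_prod_beta sum_subtractf left_diff_distrib)
  finally show ?thesis .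
qed

text \<open>\<open>K1\<close> is covered by grid cells too small to reach \<open>K0\<close>. The
  Cauchy integral over the boundary of their union is \<open>2 * pi * \<i>\<close> on
  \<open>K1\<close> and \<open>0\<close> on \<open>K0\<close>, and it involves only edges that avoid
  both sets.\<close>

lemma rational_limit_indicator:
  assumes K0: "compact K0" and K1: "compact K1" and disj: "K0 \<inter> K1 = {}"
  shows "rational_limit_on (K0 \<union> K1) (\<lambda>z. of_bool (z \<in> K1))"
proof -
  obtain d where "d > 0" and d: "\<And>x y. x \<in> K0 \<Longrightarrow> y \<in> K1 \<Longrightarrow> d \<le> dist x y"
    using separate_compact_closed[OF K0 compact_imp_closed[OF K1] disj] by blast
  \<comment> \<open>Two points of a cell are at most \<open>2 * \<delta>\<close> apart, so with this
    mesh no cell meets both sets.\<close>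
  define \<delta> where "\<delta> = d / 3"
  have "\<delta> > 0" using \<open>d > 0\<close> by (simp add: \<delta>_def)
  define c where "c i j = Complex (\<delta> * of_int i) (\<delta> * of_int j)" for i j
  define Q where "Q i j = cbox (c i j) (c (i + 1) (j + 1))" for i j
  define S where "S = {(i, j). Q i j \<inter> K1 \<noteq> {}}"
  define H where "H z i j = cauchy_segment (c i j) (c (i + 1) j) z" for z i j
  define V where "V z i j = cauchy_segment (c i j) (c i (j + 1)) z" for z i j
  have Q_iff: "z \<in> Q i j \<longleftrightarrow> \<delta> * of_int i \<le> Re z \<and> Re z \<le> \<delta> * of_int (i + 1) \<and>
      \<delta> * of_int j \<le> Im z \<and> Im z \<le> \<delta> * of_int (j + 1)" for z i j
    by (auto simp: Q_def c_def in_cbox_complex_iff)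
  have Q_dist: "dist z w < d" if "z \<in> Q i j" "w \<in> Q i j" for z w i j
  proof -
    have "\<bar>Re (z - w)\<bar> \<le> \<delta>" "\<bar>Im (z - w)\<bar> \<le> \<delta>"
      using that by (auto simp: Q_iff algebra_simps abs_le_iff)
    then have "dist z w \<le> 2 * \<delta>" using cmod_le[of "z - w"] by (simp add: dist_norm)
    then show ?thesis using \<open>d > 0\<close> by (simp add: \<delta>_def)
  qed
  have S_K0: "z \<notin> K0" if "(i, j) \<in> S" "z \<in> Q i j" for z i j
    using that d Q_dist by (fastforce simp: S_def)
  have S_K1: "(i, j) \<in> S" if "z \<in> K1" "z \<in> Q i j" for z i j
    using that by (auto simp: S_def)
  have "finite S"
  proof -
    obtain B where B: "\<And>z. z \<in> K1 \<Longrightarrow> norm z \<le> B"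
      using compact_imp_bounded[OF K1] by (auto simp: bounded_iff)
    define M where "M = \<lceil>B / \<delta>\<rceil> + 1"
    have int_bound: "i \<in> {-M..M}" if "\<delta> * of_int i \<le> x" "x \<le> \<delta> * of_int (i + 1)" "\<bar>x\<bar> \<le> B" for i x
    proof -
      have "real_of_int i \<le> B / \<delta>" "- (B / \<delta>) \<le> real_of_int (i + 1)"
        using that \<open>\<delta> > 0\<close> by (simp_all add: field_simps abs_le_iff)
      then show ?thesis unfolding M_def by (simp; linarith)
    qed
    have "S \<subseteq> {-M..M} \<times> {-M..M}"
    proof (clarsimp simp: S_def simp del: atLeastAtMost_iff)
      fix i j assume "Q i j \<inter> K1 \<noteq> {}"
      then obtain z where z: "z \<in> Q i j" "z \<in> K1" by blast
      then show "i \<in> {-M..M} \<and> j \<in> {-M..M}"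
        using int_bound[of i "Re z"] int_bound[of j "Im z"] B[OF z(2)]
          abs_Re_le_cmod[of z] abs_Im_le_cmod[of z] by (auto simp: Q_iff simp del: atLeastAtMost_iff)
    qed
    then show ?thesis by (rule finite_subset) auto
  qed
  define U where "U = S \<union> (\<lambda>(i, j). (i, j + 1)) ` S \<union> (\<lambda>(i, j). (i + 1, j)) ` S"
  \<comment> \<open>\<open>F\<close> is defined by the weights left after cancellation, because only
    the edges with nonzero weight are known to avoid \<open>K0\<close> and \<open>K1\<close>; the
    sum over cells is an algebraic identity, valid at every \<open>z\<close>.\<close>
  define F where "F z = (\<Sum>(i, j)\<in>U. (of_bool ((i, j) \<in> S) - of_bool ((i, j - 1) \<in> S)) * H z i j)
      + (\<Sum>(i, j)\<in>U. (of_bool ((i - 1, j) \<in> S) - of_bool ((i, j) \<in> S)) * V z i j)" for z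
  have F_eq: "F z = (\<Sum>(i, j)\<in>S. H z i j + V z (i + 1) j - H z i (j + 1) - V z i j)" for z
    unfolding F_def U_def by (rule grid_boundary_sum[OF \<open>finite S\<close>, symmetric])
  have square: "H z i j + V z (i + 1) j - H z i (j + 1) - V z i j
      = (if z \<in> box (c i j) (c (i + 1) (j + 1)) then 2 * pi * \<i> else 0)"
    if "z \<notin> Q i j \<or> z \<in> box (c i j) (c (i + 1) (j + 1))" for z i j
    using cauchy_segment_square[of "c i j" "c (i + 1) (j + 1)" z] that \<open>\<delta> > 0\<close>
    by (auto simp: H_def V_def c_def Q_def)
  have outside: "H z i j + V z (i + 1) j - H z i (j + 1) - V z i j = 0" if "z \<notin> Q i j" for z i j
    using square[of z i j] that box_subset_cbox[of "c i j" "c (i + 1) (j + 1)"] by (auto simp: Q_def)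
  have F_K0: "F z = 0" if "z \<in> K0" for z
    unfolding F_eq
  proof (rule sum.neutral, clarify)
    fix i j assume "(i, j) \<in> S"
    then show "H z i j + V z (i + 1) j - H z i (j + 1) - V z i j = 0"
      using S_K0 that by (intro outside) blast
  qed
  have F_box: "F z = 2 * pi * \<i>" if ij: "(i, j) \<in> S" and z: "z \<in> box (c i j) (c (i + 1) (j + 1))" for i j z
  proof -
    have zr: "\<delta> * of_int i < Re z" "Re z < \<delta> * of_int (i + 1)" "\<delta> * of_int j < Im z" "Im z < \<delta> * of_int (j + 1)"
      using z by (auto simp: c_def in_box_complex_iff)
    have uniq: "k = i" if "\<delta> * of_int k \<le> x" "x \<le> \<delta> * of_int (k + 1)"
      "\<delta> * of_int i < x" "x < \<delta> * of_int (i + 1)" for k i x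
    proof -
      have "\<delta> * of_int k < \<delta> * of_int (i + 1)" "\<delta> * of_int i < \<delta> * of_int (k + 1)"
        using that by linarith+
      then have "k < i + 1" "i < k + 1"
        using \<open>\<delta> > 0\<close> by (simp_all only: mult_less_cancel_left_pos of_int_less_iff)
      then show ?thesis by simp
    qed
    have other: "z \<notin> Q k l" if "(k, l) \<noteq> (i, j)" for k l
      using that uniq zr by (auto simp: Q_iff)
    have "F z = (\<Sum>p\<in>S. if p = (i, j) then 2 * pi * \<i> else 0)"
      unfolding F_eq
    proof (rule sum.cong[OF refl], clarify)
      fix k l
      show "H z k l + V z (k + 1) l - H z k (l + 1) - V z k l = (if (k, l) = (i, j) then 2 * pi * \<i> else 0)"
      proof (cases "(k, l) = (i, j)")
        case True
        then show ?thesis using square[of z i j] z by simp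
      next
        case False
        then show ?thesis using outside[OF other] by auto
      qed
    qed
    then show ?thesis using ij \<open>finite S\<close> by simp
  qed
  have Hseg: "closed_segment (c i j) (c (i + 1) j) \<subseteq> Q i j \<inter> Q i (j - 1)" for i j
    unfolding Q_def using \<open>\<delta> > 0\<close>
    by (intro Int_greatest closed_segment_subset convex_box) (auto simp: in_cbox_complex_iff c_def)
  have Vseg: "closed_segment (c i j) (c i (j + 1)) \<subseteq> Q i j \<inter> Q (i - 1) j" for i j
    unfolding Q_def using \<open>\<delta> > 0\<close>
    by (intro Int_greatest closed_segment_subset convex_box) (auto simp: in_cbox_complex_iff c_def)
  \<comment> \<open>An edge lies in both adjacent cells. If it met \<open>K1\<close>, both would
    belong to \<open>S\<close>; if it met \<open>K0\<close>, neither would.\<close>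
  have Hoff: "closed_segment (c i j) (c (i + 1) j) \<inter> (K0 \<union> K1) = {}"
    if "((i, j) \<in> S) \<noteq> ((i, j - 1) \<in> S)" for i j
    using Hseg[of i j] S_K0 S_K1 that by blast
  have Voff: "closed_segment (c i j) (c i (j + 1)) \<inter> (K0 \<union> K1) = {}"
    if "((i - 1, j) \<in> S) \<noteq> ((i, j) \<in> S)" for i j
    using Vseg[of i j] S_K0 S_K1 that by blast
  have lim: "rational_limit_on (K0 \<union> K1) F"
    unfolding F_def
  proof (intro rational_limit_on_add rational_limit_on_sum, safe)
    have cK: "compact (K0 \<union> K1)" using K0 K1 by (rule compact_Un)
    fix i j
    show "rational_limit_on (K0 \<union> K1) (\<lambda>z. (of_bool ((i, j) \<in> S) - of_bool ((i, j - 1) \<in> S)) * H z i j)"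
    proof (cases "((i, j) \<in> S) = ((i, j - 1) \<in> S)")
      case True
      then show ?thesis using rational_limit_on_rational[OF rational_on_const[of _ 0]] by simp
    next
      case False
      then show ?thesis unfolding H_def
        by (intro rational_limit_on_cmult rational_limit_cauchy_segment cK Hoff)
    qed
    show "rational_limit_on (K0 \<union> K1) (\<lambda>z. (of_bool ((i - 1, j) \<in> S) - of_bool ((i, j) \<in> S)) * V z i j)"
    proof (cases "((i - 1, j) \<in> S) = ((i, j) \<in> S)")
      case True
      then show ?thesis using rational_limit_on_rational[OF rational_on_const[of _ 0]] by simp
    next
      case False
      then show ?thesis unfolding V_def
        by (intro rational_limit_on_cmult rational_limit_cauchy_segment cK Voff)
    qed
  qed
  \<comment> \<open>A point of \<open>K1\<close> may lie on a grid line, where the formula for a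
    square is silent. But \<open>F\<close> is continuous away from the uncancelled edges, so its
    value there is the limit from the interior of a cell of \<open>S\<close>.\<close>
  have F_K1: "F z = 2 * pi * \<i>" if "z \<in> K1" for z
  proof -
    define i j where "i = \<lfloor>Re z / \<delta>\<rfloor>" and "j = \<lfloor>Im z / \<delta>\<rfloor>"
    have "real_of_int i \<le> Re z / \<delta>" "Re z / \<delta> \<le> real_of_int (i + 1)"
      "real_of_int j \<le> Im z / \<delta>" "Im z / \<delta> \<le> real_of_int (j + 1)"
      unfolding i_def j_def by linarith+
    then have zQ: "z \<in> Q i j"
      using \<open>\<delta> > 0\<close> by (simp add: Q_iff field_simps)
    then have ij: "(i, j) \<in> S" using that S_K1 by blast
    let ?B = "box (c i j) (c (i + 1) (j + 1))"
    have "?B \<noteq> {}"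
      using \<open>\<delta> > 0\<close> by (auto simp: box_ne_empty Basis_complex_def c_def)
    then have zcl: "z \<in> closure ?B" using zQ by (simp add: Q_def closure_box)
    define E where "E = {e. (\<exists>i j. e = closed_segment (c i j) (c (i + 1) j) \<and> (i, j) \<in> U \<and> ((i, j) \<in> S) \<noteq> ((i, j - 1) \<in> S))
       \<or> (\<exists>i j. e = closed_segment (c i j) (c i (j + 1)) \<and> (i, j) \<in> U \<and> ((i - 1, j) \<in> S) \<noteq> ((i, j) \<in> S))}"
    define W where "W = - \<Union>E"
    have "finite U" using \<open>finite S\<close> by (simp add: U_def)
    have "E \<subseteq> (\<lambda>(i, j). closed_segment (c i j) (c (i + 1) j)) ` U \<union> (\<lambda>(i, j). closed_segment (c i j) (c i (j + 1))) ` U"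
      by (auto simp: E_def image_iff)
    then have "finite E" using \<open>finite U\<close> by (auto intro: finite_subset)
    have "closed e" if "e \<in> E" for e using that by (auto simp: E_def)
    then have "open W" unfolding W_def using \<open>finite E\<close> by (intro open_Compl closed_Union) auto
    have "z \<in> W"
      unfolding W_def E_def using that Hoff Voff by blast
    have contF: "continuous_on W F"
      unfolding F_def
    proof (intro continuous_on_add continuous_on_sum, safe)
      fix i j assume U: "(i, j) \<in> U"
      show "continuous_on W (\<lambda>z. (of_bool ((i, j) \<in> S) - of_bool ((i, j - 1) \<in> S)) * H z i j)"
      proof (cases "((i, j) \<in> S) = ((i, j - 1) \<in> S)")
        case False
        then have "closed_segment (c i j) (c (i + 1) j) \<in> E" using U by (auto simp: E_def)
        then have "closed_segment (c i j) (c (i + 1) j) \<inter> W = {}" by (auto simp: W_def)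
        then show ?thesis unfolding H_def by (intro continuous_intros continuous_on_cauchy_segment)
      qed simp
      show "continuous_on W (\<lambda>z. (of_bool ((i - 1, j) \<in> S) - of_bool ((i, j) \<in> S)) * V z i j)"
      proof (cases "((i - 1, j) \<in> S) = ((i, j) \<in> S)")
        case False
        then have "closed_segment (c i j) (c i (j + 1)) \<in> E" using U by (auto simp: E_def)
        then have "closed_segment (c i j) (c i (j + 1)) \<inter> W = {}" by (auto simp: W_def)
        then show ?thesis unfolding V_def by (intro continuous_intros continuous_on_cauchy_segment)
      qed simp
    qed
    then have "isCont F z" using \<open>open W\<close> \<open>z \<in> W\<close> continuous_on_eq_continuous_at by blast
    obtain x where x: "\<And>n. x n \<in> ?B" "x \<longlonglongrightarrow> z"
      using zcl unfolding closure_sequential by blast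
    have "(\<lambda>n. F (x n)) \<longlonglongrightarrow> F z" by (rule isCont_tendsto_compose[OF \<open>isCont F z\<close> x(2)])
    moreover have "F (x n) = 2 * pi * \<i>" for n by (rule F_box[OF ij x(1)])
    ultimately have "(\<lambda>n. complex_of_real (2 * pi) * \<i>) \<longlonglongrightarrow> F z" by (simp only:)
    then show ?thesis by (simp add: LIMSEQ_const_iff)
  qed
  have "rational_limit_on (K0 \<union> K1) (\<lambda>z. 1 / (2 * pi * \<i>) * F z)"
    by (rule rational_limit_on_cmult[OF lim])
  then show ?thesis
    by (rule rational_limit_on_cong) (use disj F_K0 F_K1 in auto)
qed

subsection \<open>Lifting a single idempotent\<close>

lemma totally_disconnected_singleton:
  assumes "totally_disconnected S" "connected C" "C \<subseteq> S" "x \<in> C"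
  shows "C = {x}"
  using assms unfolding totally_disconnected_def by blast

text \<open>The component of \<open>x\<close> is a point, and by Sura-Bura a compact component has
  clopen neighbourhoods inside any given open one, here the complement of \<open>y\<close>.\<close>

lemma clopen_separation:
  fixes K :: "complex set"
  assumes K: "compact K" "totally_disconnected K" and "x \<in> K" "x \<noteq> y"
  obtains K1 where "compact K1" "compact (K - K1)" "K1 \<subseteq> K" "x \<in> K1" "y \<notin> K1"
proof -
  define C where "C = connected_component_set K x"
  have "C \<in> components K" using \<open>x \<in> K\<close> by (auto simp: C_def components_def)
  moreover have "C = {x}"
    by (rule totally_disconnected_singleton[OF K(2)])
      (use \<open>x \<in> K\<close> in \<open>auto simp: C_def connected_component_subset\<close>)
  ultimately obtain K1 where K1: "openin (top_of_set K) K1" "compact K1" "C \<subseteq> K1" "K1 \<subseteq> - {y}"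
    using Sura_Bura_clopen_subset[of K C "- {y}"] closed_imp_locally_compact[OF compact_imp_closed[OF K(1)]]
      \<open>x \<noteq> y\<close> by auto
  obtain T where T: "open T" "K1 = K \<inter> T" using K1(1) by (auto simp: openin_open)
  have "K - K1 = K - T" using T by blast
  then have "compact (K - K1)" using compact_diff[OF K(1) T(1)] by simp
  then show ?thesis using that[of K1] K1 T \<open>C = {x}\<close> by auto
qed

lemma poly_cnj_real:
  assumes "map_poly cnj P = P"
  shows "cnj (poly P z) = poly P (cnj z)"
  using assms by (metis poly_cnj)

lemma map_poly_cnj_add: "map_poly cnj (P + Q) = map_poly cnj P + map_poly cnj Q"
  by (rule poly_eqI) (simp add: coeff_map_poly)

lemma map_poly_cnj_diff: "map_poly cnj (P - Q) = map_poly cnj P - map_poly cnj Q"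
  by (rule poly_eqI) (simp add: coeff_map_poly)

lemma map_poly_cnj_mult: "map_poly cnj (P * Q) = map_poly cnj P * map_poly cnj Q"
  by (rule poly_eqI) (simp add: coeff_map_poly coeff_mult)

lemma map_poly_cnj_smult: "map_poly cnj (smult c P) = smult (cnj c) (map_poly cnj P)"
  by (rule poly_eqI) (simp add: coeff_map_poly)

lemma map_poly_cnj_cnj: "map_poly cnj (map_poly cnj P) = P"
  by (rule poly_eqI) (simp add: coeff_map_poly)

text \<open>As \<open>0\<close> and \<open>1\<close> are real, intersecting a separating clopen set
  with its mirror image keeps \<open>1\<close> and still omits \<open>0\<close>.\<close>

lemma cnj_invariant_separation:
  fixes K :: "complex set"
  assumes K: "compact K" "totally_disconnected K" "0 \<in> K" "1 \<in> K"
    and sym: "\<And>z. z \<in> K \<Longrightarrow> cnj z \<in> K"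
  obtains L where "compact L" "compact (K - L)" "L \<subseteq> K" "1 \<in> L" "0 \<notin> L" "\<forall>z. cnj z \<in> L \<longleftrightarrow> z \<in> L"
proof -
  obtain K1 where K1: "compact K1" "compact (K - K1)" "K1 \<subseteq> K" "1 \<in> K1" "0 \<notin> K1"
    using clopen_separation[OF K(1,2,4), of 0] by auto
  have cc: "continuous_on A cnj" for A by (intro continuous_intros)
  define L where "L = K1 \<inter> cnj ` K1"
  have memL: "z \<in> L \<longleftrightarrow> z \<in> K1 \<and> cnj z \<in> K1" for z
    unfolding L_def by (metis Int_iff complex_cnj_cnj image_iff)
  have "compact L" unfolding L_def by (intro compact_Int compact_continuous_image cc K1)
  moreover have "K - L = (K - K1) \<union> cnj ` (K - K1)"
  proof (rule set_eqI)
    fix z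
    have "z \<in> cnj ` (K - K1) \<longleftrightarrow> cnj z \<in> K - K1" by (metis complex_cnj_cnj image_iff)
    then show "z \<in> K - L \<longleftrightarrow> z \<in> (K - K1) \<union> cnj ` (K - K1)"
      using sym[of z] sym[of "cnj z"] by (auto simp: memL)
  qed
  then have "compact (K - L)"
    by (simp only:) (intro compact_Un compact_continuous_image cc K1)
  ultimately show ?thesis using K1 by (intro that[of L]) (auto simp: memL)
qed

text \<open>The approximant is averaged with its conjugate, which makes its coefficients real, and
  then normalised affinely to hit the two prescribed values. The bound \<open>1 / 2\<close> is
  matched to the disc of radius \<open>2\<close> in
  \<open>summable_norm_power_of_resolvent\<close>.\<close>

lemma real_rational_separation:
  fixes K :: "complex set"
  assumes K: "compact K" "totally_disconnected K" "0 \<in> K" "1 \<in> K"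
    and sym: "\<And>z. z \<in> K \<Longrightarrow> cnj z \<in> K"
  obtains N D where "map_poly cnj N = N" "map_poly cnj D = D" "\<And>z. z \<in> K \<Longrightarrow> poly D z \<noteq> 0"
    "poly N 0 = - poly D 0" "poly N 1 = poly D 1"
    "\<And>z. z \<in> K \<Longrightarrow> norm ((poly N z / poly D z)\<^sup>2 - 1) < 1 / 2"
proof -
  obtain L where L: "compact L" "compact (K - L)" "L \<subseteq> K" "1 \<in> L" "0 \<notin> L" "\<forall>z. cnj z \<in> L \<longleftrightarrow> z \<in> L"
    using cnj_invariant_separation[OF assms] by blast
  define h where "h z = (of_bool (z \<in> L) :: complex)" for z
  have KL: "(K - L) \<union> L = K" using L by blast
  have "rational_limit_on K h"
    using rational_limit_indicator[OF L(2,1)] unfolding KL h_def[abs_def] by blast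
  then obtain g where "rational_on K g" and g: "\<And>z. z \<in> K \<Longrightarrow> norm (h z - g z) < 1 / 100"
    unfolding rational_limit_on_def by (metis zero_less_divide_1_iff zero_less_numeral)
  then obtain P Q where PQ: "\<And>z. z \<in> K \<Longrightarrow> poly Q z \<noteq> 0" "\<And>z. z \<in> K \<Longrightarrow> g z = poly P z / poly Q z"
    unfolding rational_on_def by blast
  let ?P = "map_poly cnj P" and ?Q = "map_poly cnj Q"
  have cP: "poly ?P z = cnj (poly P (cnj z))" and cQ: "poly ?Q z = cnj (poly Q (cnj z))" for z
    by (metis complex_cnj_cnj poly_cnj)+
  \<comment> \<open>The quotient is the mean of \<open>g z\<close> and
    \<open>cnj (g (cnj z))\<close>; since \<open>h\<close> is conjugation-invariant and real,
    averaging loses no accuracy.\<close>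
  define N1 D1 where "N1 = P * ?Q + ?P * Q" and "D1 = smult 2 (Q * ?Q)"
  have real: "map_poly cnj N1 = N1" "map_poly cnj D1 = D1"
    by (simp_all add: N1_def D1_def map_poly_cnj_add map_poly_cnj_mult map_poly_cnj_smult map_poly_cnj_cnj
        add.commute mult.commute)
  have D1: "poly D1 z \<noteq> 0" if "z \<in> K" for z
    using PQ(1)[OF that] PQ(1)[OF sym[OF that]] by (simp add: D1_def cQ)
  define R where "R z = poly N1 z / poly D1 z" for z
  have R: "norm (h z - R z) < 1 / 100" if "z \<in> K" for z
  proof -
    have "R z = (g z + cnj (g (cnj z))) / 2"
      using PQ(1)[OF that] PQ(1)[OF sym[OF that]]
      by (simp add: R_def N1_def D1_def PQ(2) that sym cP cQ field_simps)
    moreover have "h z = (h z + cnj (h (cnj z))) / 2"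
      by (simp add: h_def L(6))
    ultimately have "h z - R z = ((h z - g z) + cnj (h (cnj z) - g (cnj z))) / 2"
      by (simp add: field_simps)
    then have "norm (h z - R z) \<le> (norm (h z - g z) + norm (cnj (h (cnj z) - g (cnj z)))) / 2"
      by (metis norm_triangle_ineq norm_divide norm_numeral divide_right_mono zero_le_numeral)
    also have "\<dots> = (norm (h z - g z) + norm (h (cnj z) - g (cnj z))) / 2"
      by (simp only: complex_mod_cnj)
    finally show ?thesis using g[OF that] g[OF sym[OF that]] by argo
  qed
  define r0 r1 where "r0 = R 0" and "r1 = R 1"
  have real_r: "cnj r0 = r0" "cnj r1 = r1"
    by (simp_all add: r0_def r1_def R_def poly_cnj_real real)
  have r0: "norm r0 < 1 / 100" using R[OF K(3)] L by (simp add: r0_def h_def)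
  have r1: "norm (r1 - 1) < 1 / 100"
    using R[OF K(4)] L by (simp add: r1_def h_def norm_minus_commute)
  have r10: "norm (r1 - r0) > 98 / 100"
  proof -
    have "1 \<le> norm (r1 - r0) + norm (r1 - 1) + norm r0"
      using norm_triangle_ineq4[of "r1 - r0" "r1 - 1 - r0"] norm_triangle_ineq4[of "r1 - 1" r0] by simp
    then show ?thesis using r0 r1 by linarith
  qed
  then have ne: "r1 - r0 \<noteq> 0" by auto
  \<comment> \<open>The affine map sending \<open>r0\<close> to \<open>- 1\<close> and
    \<open>r1\<close> to \<open>1\<close>, with denominators cleared. Coefficients stay real because
    \<open>r0\<close> and \<open>r1\<close> are real.\<close>
  define N D where "N = smult 2 N1 - smult (r0 + r1) D1" and "D = smult (r1 - r0) D1"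
  have quot: "poly N z / poly D z = 2 * ((R z - r0) / (r1 - r0)) - 1" if "z \<in> K" for z
    using D1[OF that] ne by (simp add: N_def D_def R_def field_simps)
  have small: "norm ((poly N z / poly D z)\<^sup>2 - 1) < 1 / 2" if "z \<in> K" for z
  proof -
    \<comment> \<open>With \<open>\<eta>\<close> the error after normalising,
      \<open>h * h = h\<close> gives \<open>4 * \<eta> * (\<eta> + (2 * h - 1))\<close> for the
      quantity to be bounded. As \<open>2 * h - 1\<close> has modulus \<open>1\<close>,
      \<open>norm \<eta> < 1 / 10\<close> yields \<open>0.44\<close>; the tolerance
      \<open>1 / 100\<close> is ample for this.\<close>
    define \<eta> where "\<eta> = (R z - r0) / (r1 - r0) - h z"
    have h01: "h z = 0 \<or> h z = 1" by (simp add: h_def)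
    have eq: "(r1 - r0) * \<eta> = (R z - h z) - r0 * (1 - h z) - h z * (r1 - 1)"
      using ne by (simp add: \<eta>_def field_simps)
    have "norm ((r1 - r0) * \<eta>) \<le> norm (R z - h z) + norm (r0 * (1 - h z)) + norm (h z * (r1 - 1))"
      unfolding eq using norm_triangle_ineq4[of "R z - h z - r0 * (1 - h z)" "h z * (r1 - 1)"]
        norm_triangle_ineq4[of "R z - h z" "r0 * (1 - h z)"] by linarith
    also have "\<dots> < 2 / 100"
      using h01 R[OF that] r0 r1 by (auto simp: norm_minus_commute)
    finally have "norm (r1 - r0) * norm \<eta> < 2 / 100" by (simp only: norm_mult)
    moreover have "98 / 100 * norm \<eta> \<le> norm (r1 - r0) * norm \<eta>"
      using r10 by (intro mult_right_mono) auto
    ultimately have \<eta>: "norm \<eta> < 1 / 10" by linarith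
    have "poly N z / poly D z = 2 * (\<eta> + h z) - 1"
      using quot[OF that] by (simp add: \<eta>_def)
    then have "(poly N z / poly D z)\<^sup>2 - 1 = 4 * (\<eta> * (\<eta> + (2 * h z - 1)) + (h z * h z - h z))"
      by (simp only: power2_eq_square) (simp add: algebra_simps)
    also have "\<dots> = 4 * (\<eta> * (\<eta> + (2 * h z - 1)))" using h01 by auto
    finally have "norm ((poly N z / poly D z)\<^sup>2 - 1) = 4 * (norm \<eta> * norm (\<eta> + (2 * h z - 1)))"
      by (simp add: norm_mult)
    also have "\<dots> \<le> 4 * (1 / 10 * (1 / 10 + 1))"
    proof (intro mult_left_mono mult_mono)
      show "norm (\<eta> + (2 * h z - 1)) \<le> 1 / 10 + 1"
        by (rule order_trans[OF norm_triangle_ineq]) (use \<eta> h01 in auto)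
    qed (use \<eta> in auto)
    finally show ?thesis by simp
  qed
  have DK: "poly D z \<noteq> 0" if "z \<in> K" for z using D1[OF that] ne by (simp add: D_def)
  have "poly N 0 / poly D 0 = - 1" using quot[OF K(3)] by (simp add: r0_def)
  then have "poly N 0 = - poly D 0" using DK[OF K(3)] by (simp add: divide_eq_eq)
  moreover have "poly N 1 / poly D 1 = 1" using quot[OF K(4)] ne by (simp add: r1_def)
  then have "poly N 1 = poly D 1" using DK[OF K(4)] by (simp add: divide_eq_eq)
  moreover have "map_poly cnj N = N" "map_poly cnj D = D"
    by (simp_all add: N_def D_def map_poly_cnj_diff map_poly_cnj_smult real real_r)
  ultimately show ?thesis using that[of N D] DK small by blast
qed

text \<open>A new point is separated from the closed set \<open>S\<close>, so a connected set
  containing it can contain nothing else. This allows \<open>0\<close> and \<open>1\<close> to be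
  adjoined to a spectrum.\<close>

lemma totally_disconnected_insert:
  fixes S :: "complex set"
  assumes "totally_disconnected S" "closed S"
  shows "totally_disconnected (insert a S)"
  unfolding totally_disconnected_def
proof clarify
  fix C x y assume C: "C \<subseteq> insert a S" "connected C" and xy: "x \<in> C" "y \<in> C" "x \<noteq> y"
  have "a \<notin> S \<Longrightarrow> a \<in> C \<Longrightarrow> False"
  proof -
    assume a: "a \<notin> S" "a \<in> C"
    have "closed {a}" by simp
    have "{a} \<inter> C = {} \<or> S \<inter> C = {}"
      using connected_closedD[OF C(2), of "{a}" S] C(1) a assms(2) by auto
    then have "C \<subseteq> {a}" using C(1) a by auto
    then show False using xy by auto
  qed
  then have "C \<subseteq> S" using C(1) by blast
  then show False using assms(1) C(2) xy unfolding totally_disconnected_def by blast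
qed

text \<open>The map \<open>c\<^sup>2 - c\<close> sends a connected part of the spectrum to a single
  point, and its fibres \<open>{y, 1 - y}\<close> are finite; a finite connected set is a
  point.\<close>

lemma totally_disconnected_spectrum:
  fixes x :: "'a::complex_banach_algebra"
  assumes "totally_disconnected (spectrum (x * x - x))"
  shows "totally_disconnected (spectrum x)"
  unfolding totally_disconnected_def
proof clarify
  fix C y z assume C: "C \<subseteq> spectrum x" "connected C" and yz: "y \<in> C" "z \<in> C" "y \<noteq> z"
  let ?f = "\<lambda>c::complex. c\<^sup>2 - c"
  have "connected (?f ` C)" by (intro connected_continuous_image continuous_intros C)
  moreover have "?f ` C \<subseteq> spectrum (x * x - x)" using C spectrum_square_minus_self by blast
  ultimately have "?f ` C = {?f y}"
    using totally_disconnected_singleton[OF assms] yz by blast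
  then have "C \<subseteq> {y, 1 - y}"
  proof (intro subsetI)
    fix c assume "?f ` C = {?f y}" "c \<in> C"
    then have "?f c = ?f y" by blast
    then have "(c - y) * (c - (1 - y)) = 0" by (simp add: power2_eq_square algebra_simps)
    then show "c \<in> {y, 1 - y}" by simp
  qed
  then have "finite C" by (rule finite_subset) auto
  then show False using connected_finite_iff_sing[OF C(2)] yz by auto
qed

lemma lift_idempotent:
  fixes \<phi> :: "'a::complex_banach_algebra \<Rightarrow> 'b::complex_banach_algebra"
  assumes star: "involution starA" "continuous_on UNIV starA" "involution starB"
    and hom: "unital_star_hom starA starB \<phi>" "bounded_linear \<phi>" "surj \<phi>"
    and td: "\<And>x. \<phi> x = 0 \<Longrightarrow> totally_disconnected (spectrum x)"
    and q: "q \<in> self_adjoint_idempotents starB"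
  obtains p where "p \<in> self_adjoint_idempotents starA" "\<phi> p = q"
proof -
  have q2: "q * q = q" and qs: "starB q = q"
    using q by (auto simp: self_adjoint_idempotents_def power2_eq_square)
  obtain x' where x': "\<phi> x' = q" using hom(3) by (metis surjD)
  define x where "x = (1 / 2) *\<^sub>R (x' + starA x')"
  have xs: "starA x = x"
    by (simp add: x_def involution_scaleR star(1) involutionD(1,4)[OF star(1)] add.commute)
  have \<phi>x: "\<phi> x = q"
    by (simp add: x_def unital_star_hom_scaleR[OF hom(1)] unital_star_homD(1,5)[OF hom(1)] x' qs)
  have "\<phi> (x * x - x) = 0"
    by (simp add: unital_star_hom_diff[OF hom(1)] unital_star_homD(3)[OF hom(1)] \<phi>x q2)
  then have "totally_disconnected (spectrum x)" by (rule totally_disconnected_spectrum[OF td])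
  \<comment> \<open>\<open>0\<close> and \<open>1\<close> need not be spectral values of
    \<open>x\<close>, yet the normalisation takes place there.\<close>
  define K where "K = insert 0 (insert 1 (spectrum x))"
  have cK: "compact K" unfolding K_def by (intro compact_insert compact_spectrum)
  have tK: "totally_disconnected K"
    unfolding K_def using compact_spectrum[of x] \<open>totally_disconnected (spectrum x)\<close>
    by (intro totally_disconnected_insert) (auto intro: compact_imp_closed)
  have sK: "cnj z \<in> K" if "z \<in> K" for z
    using that spectrum_self_adjoint[OF star(1) xs] by (auto simp: K_def)
  obtain N D where real: "map_poly cnj N = N" "map_poly cnj D = D"
    and D: "\<And>z. z \<in> K \<Longrightarrow> poly D z \<noteq> 0"
    and ND: "poly N 0 = - poly D 0" "poly N 1 = poly D 1"
    and small: "\<And>z. z \<in> K \<Longrightarrow> norm ((poly N z / poly D z)\<^sup>2 - 1) < 1 / 2"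
    using real_rational_separation[OF cK tK _ _ sK] by (auto simp: K_def)
  let ?N = "poly_eval x N" and ?D = "poly_eval x D"
  have K0: "0 \<in> K" and Kx: "\<And>z. z \<in> spectrum x \<Longrightarrow> z \<in> K" by (auto simp: K_def)
  have "invertible_elt ?D"
    by (rule invertible_poly_eval) (use D K0 Kx in force)+
  then obtain d where d: "d * ?D = 1" "?D * d = 1" by (auto simp: invertible_elt_def)
  have ds: "starA d = d"
  proof -
    have "starA ?D = ?D" using involution_poly_eval[OF star(1), of x D] by (simp add: xs real)
    then have "starA d * ?D = 1" using d(2) involutionD(3)[OF star(1), of ?D d] by (simp add: involution_one[OF star(1)])
    then show ?thesis using d(2) by (metis mult.assoc mult_1_left mult_1_right)
  qed
  have Nd: "?N * d = d * ?N"
  proof -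
    have "?N * d = d * (?D * ?N) * d" using d by (simp flip: mult.assoc)
    also have "\<dots> = d * (?N * ?D) * d" by (simp only: poly_eval_commute)
    also have "\<dots> = d * ?N" using d by (simp add: mult.assoc)
    finally show ?thesis .
  qed
  define e where "e = ?N * d"
  have "starA ?N = ?N" using involution_poly_eval[OF star(1), of x N] by (simp add: xs real)
  then have es: "starA e = e" unfolding e_def Nd by (simp add: involutionD(3)[OF star(1)] ds Nd)
  have \<phi>e: "\<phi> e = 2 *\<^sub>R q - 1"
  proof -
    have pD: "poly_eval q D = poly D 0 *\<^sub>C (1 - q) + poly D 1 *\<^sub>C q"
      and pN: "poly_eval q N = poly N 0 *\<^sub>C (1 - q) + poly N 1 *\<^sub>C q"
      by (rule poly_eval_idempotent[OF q2])+
    have "(2 *\<^sub>R q - 1) * poly_eval q D = poly_eval q N"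
    proof -
      have 1: "(2 *\<^sub>R q - 1) * (1 - q) = - (1 - q)"
        by (simp add: right_diff_distrib left_diff_distrib q2)
      have 2: "(2 *\<^sub>R q - 1) * q = q"
        by (simp add: left_diff_distrib distrib_right q2 scaleR_2)
      show ?thesis unfolding pD pN
        by (simp only: distrib_left mult_scaleC_right 1 2 ND scaleC_minus_left scaleC_minus_right)
    qed
    then have "(2 *\<^sub>R q - 1) * \<phi> ?D = \<phi> ?N"
      by (simp add: unital_star_hom_poly_eval[OF hom(1)] \<phi>x)
    then have "\<phi> ?N * \<phi> d = (2 *\<^sub>R q - 1) * \<phi> (?D * d)"
      by (metis mult.assoc unital_star_homD(3)[OF hom(1)])
    then show ?thesis by (simp add: e_def d unital_star_homD(3,4)[OF hom(1)])
  qed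
  have "invertible_elt (1 - l *\<^sub>C (e * e - 1))" if l: "norm l \<le> 2" for l
  proof -
    \<comment> \<open>\<open>M\<close> is \<open>1 - l * ((N / D)\<^sup>2 - 1)\<close> with
      denominators cleared. On \<open>K\<close> the subtracted term has modulus below
      \<open>1\<close>, so \<open>M\<close> has no zero there and its value at \<open>x\<close> is
      invertible.\<close>
    define M where "M = D * D - smult l (N * N - D * D)"
    have M: "poly M z \<noteq> 0" if "z \<in> K" for z
    proof
      assume "poly M z = 0"
      then have "1 = l * ((poly N z / poly D z)\<^sup>2 - 1)"
        using D[OF that] by (simp add: M_def field_simps power2_eq_square)
      then have "1 = norm l * norm ((poly N z / poly D z)\<^sup>2 - 1)" by (metis norm_mult norm_one)
      also have "\<dots> \<le> 2 * norm ((poly N z / poly D z)\<^sup>2 - 1)" using l by (intro mult_right_mono) auto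
      also have "\<dots> < 1" using small[OF that] by simp
      finally show False by simp
    qed
    have invd: "invertible_elt d" using d by (auto simp: invertible_elt_def)
    have "invertible_elt (poly_eval x M)"
      by (rule invertible_poly_eval) (use M K0 Kx in force)+
    then have "invertible_elt (poly_eval x M * (d * d))"
      by (intro invertible_elt_mult invd)
    also have "poly_eval x M * (d * d) = 1 - l *\<^sub>C (e * e - 1)"
    proof -
      have DD: "?D * ?D * (d * d) = 1" by (metis d(2) mult.assoc mult_1_left)
      have NN: "?N * ?N * (d * d) = e * e" by (metis Nd e_def mult.assoc)
      have "poly_eval x M * (d * d) = ?D * ?D * (d * d) - l *\<^sub>C (?N * ?N * (d * d) - ?D * ?D * (d * d))"
        by (simp add: M_def left_diff_distrib mult_scaleC_left)
      then show ?thesis by (simp only: DD NN)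
    qed
    finally show ?thesis .
  qed
  then have sm: "summable (\<lambda>n. norm ((e * e - 1) ^ n))"
    by (rule summable_norm_power_of_resolvent)
  show ?thesis
    by (rule that[OF self_adjoint_idempotents_of_near_symmetry(1)[OF star(1,2) es sm]
          self_adjoint_idempotents_of_near_symmetry(2)[OF star(1,2) es sm hom(1,2) q2 \<phi>e]])
qed

subsection \<open>Banach-valued power series\<close>

text \<open>Fubini for absolutely summable double series, obtained by passing to unordered sums,
  where the two indices can be exchanged.\<close>

lemma double_series:
  fixes h :: "nat \<Rightarrow> nat \<Rightarrow> 'a::banach"
  assumes row: "\<And>n. summable (\<lambda>m. norm (h n m))"
    and total: "summable (\<lambda>n. \<Sum>m. norm (h n m))"
  shows "\<And>m. summable (\<lambda>n. norm (h n m))"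
    and "(\<lambda>m. \<Sum>n. h n m) sums (\<Sum>n. \<Sum>m. h n m)"
    and "summable (\<lambda>m. norm (\<Sum>n. h n m))"
      "(\<Sum>m. norm (\<Sum>n. h n m)) \<le> (\<Sum>n. \<Sum>m. norm (h n m))"
proof -
  have suminf_infsum: "(\<Sum>n. f n) = (\<Sum>\<^sub>\<infinity>n. f n)" if "summable (\<lambda>n. norm (f n))" for f :: "nat \<Rightarrow> 'b::banach"
    by (metis infsumI norm_summable_imp_has_sum summable_norm_cancel summable_sums that)
  have nonneg: "(\<Sum>m. norm (h n m)) \<ge> 0" for n by (intro suminf_nonneg row) auto
  have abs: "(\<lambda>p. norm (h (fst p) (snd p))) summable_on (UNIV \<times> UNIV)"
  proof (rule Infinite_Sum.abs_summable_on_Sigma_iff[THEN iffD2],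
      intro conjI ballI)
    show "(\<lambda>y. norm (h (fst (x, y)) (snd (x, y)))) summable_on UNIV" for x
      using row[of x] by (simp add: summable_on_UNIV_nonneg_real_iff)
    have "(\<Sum>\<^sub>\<infinity>y. norm (h x y)) = (\<Sum>y. norm (h x y))" for x
      using suminf_infsum[of "\<lambda>y. norm (h x y)"] row[of x] by simp
    then show "(\<lambda>x. norm (\<Sum>\<^sub>\<infinity>y. norm (h (fst (x, y)) (snd (x, y))))) summable_on UNIV"
      using total nonneg by (simp add: summable_on_UNIV_nonneg_real_iff)
  qed
  then have "(\<lambda>p. norm (h (fst p) (snd p))) summable_on (prod.swap ` (UNIV \<times> UNIV))"
    by simp
  then have "(\<lambda>p. norm (h (snd p) (fst p))) summable_on (UNIV \<times> UNIV)"
    by (subst (asm) summable_on_reindex) (auto simp: o_def)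
  note abs' = Infinite_Sum.abs_summable_on_Sigma_iff[where f = "\<lambda>p. h (snd p) (fst p)" and A = UNIV and B = "\<lambda>_. UNIV",
      THEN iffD1, OF this]
  show col: "summable (\<lambda>n. norm (h n m))" for m
    using abs' by (simp add: summable_on_UNIV_nonneg_real_iff)
  have "(\<lambda>m. \<Sum>\<^sub>\<infinity>n. norm (h n m)) summable_on UNIV"
    using conjunct2[OF abs'] by (simp add: infsum_nonneg)
  then have "summable (\<lambda>m. \<Sum>\<^sub>\<infinity>n. norm (h n m))"
    by (simp add: summable_on_UNIV_nonneg_real_iff infsum_nonneg)
  then have total': "summable (\<lambda>m. \<Sum>n. norm (h n m))"
    using suminf_infsum[of "\<lambda>n. norm (h n _)"] col by simp
  have le: "norm (\<Sum>n. h n m) \<le> (\<Sum>n. norm (h n m))" for m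
    by (rule summable_norm[OF col])
  show nsum: "summable (\<lambda>m. norm (\<Sum>n. h n m))"
    by (rule summable_comparison_test'[OF total']) (use le in auto)
  \<comment> \<open>Stated for an arbitrary Banach-valued \<open>g\<close> because it is applied
    both to \<open>h\<close> and to its norms.\<close>
  have swap: "(\<Sum>m. \<Sum>n. g n m) = (\<Sum>n. \<Sum>m. g n m)"
    if g: "(\<lambda>p. g (fst p) (snd p)) summable_on (UNIV \<times> UNIV)"
      and r: "\<And>n. summable (\<lambda>m. norm (g n m))" and rr: "summable (\<lambda>n. norm (\<Sum>m. g n m))"
      and c: "\<And>m. summable (\<lambda>n. norm (g n m))" and cc: "summable (\<lambda>m. norm (\<Sum>n. g n m))"
    for g :: "nat \<Rightarrow> nat \<Rightarrow> 'b::banach"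
  proof -
    have "(\<Sum>\<^sub>\<infinity>n. \<Sum>\<^sub>\<infinity>m. g n m) = (\<Sum>\<^sub>\<infinity>m. \<Sum>\<^sub>\<infinity>n. g n m)"
      by (rule infsum_swap_banach) (use g in \<open>simp only: case_prod_unfold\<close>)
    then show ?thesis
      using suminf_infsum[OF r] suminf_infsum[OF c] suminf_infsum[OF rr] suminf_infsum[OF cc] by simp
  qed
  have nrow: "summable (\<lambda>n. norm (\<Sum>m. h n m))"
    by (rule summable_comparison_test'[OF total]) (use summable_norm[OF row] in auto)
  have "(\<Sum>m. \<Sum>n. h n m) = (\<Sum>n. \<Sum>m. h n m)"
    by (intro swap Infinite_Sum.abs_summable_summable[OF abs] row nrow col nsum)
  then show "(\<lambda>m. \<Sum>n. h n m) sums (\<Sum>n. \<Sum>m. h n m)"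
    using summable_sums[OF summable_norm_cancel[OF nsum]] by simp
  have "(\<Sum>m. norm (\<Sum>n. h n m)) \<le> (\<Sum>m. \<Sum>n. norm (h n m))"
    by (intro suminf_le le nsum total')
  also have "\<dots> = (\<Sum>n. \<Sum>m. norm (h n m))"
  proof (rule swap)
    have "(\<Sum>n. norm (h n m)) \<ge> 0" for m by (intro suminf_nonneg col) auto
    then show "summable (\<lambda>m. norm (\<Sum>n. norm (h n m)))" using total' by simp
    show "summable (\<lambda>n. norm (\<Sum>m. norm (h n m)))" using total nonneg by simp
  qed (use abs row col in auto)
  finally show "(\<Sum>m. norm (\<Sum>n. h n m)) \<le> (\<Sum>n. \<Sum>m. norm (h n m))" .
qed

text \<open>The weighted sum of coefficient norms is a weighted l1 norm on power series. It is
  submultiplicative, so products and series of functions are estimated without returning to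
  coefficients.\<close>

definition power_series_on :: "real \<Rightarrow> (nat \<Rightarrow> 'a::real_normed_vector) \<Rightarrow> (real \<Rightarrow> 'a) \<Rightarrow> bool" where
  "power_series_on r a f \<longleftrightarrow> summable (\<lambda>m. norm (a m) * r ^ m) \<and>
     (\<forall>t. \<bar>t\<bar> \<le> r \<longrightarrow> (\<lambda>m. t ^ m *\<^sub>R a m) sums f t)"

text \<open>The coefficients are hidden: \<open>c\<close> bounds the weighted norm, and later steps
  only keep track of such constants.\<close>

definition power_series_bounded :: "real \<Rightarrow> real \<Rightarrow> (real \<Rightarrow> 'a::real_normed_vector) \<Rightarrow> bool" where
  "power_series_bounded r c f \<longleftrightarrow> (\<exists>a. power_series_on r a f \<and> (\<Sum>m. norm (a m) * r ^ m) \<le> c)"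

lemma power_series_boundedI:
  "power_series_on r a f \<Longrightarrow> (\<Sum>m. norm (a m) * r ^ m) \<le> c \<Longrightarrow> power_series_bounded r c f"
  by (auto simp: power_series_bounded_def)

lemma summable_norm_power_series:
  assumes "power_series_on r a f" "\<bar>t\<bar> \<le> r"
  shows "summable (\<lambda>m. norm (t ^ m *\<^sub>R a m))" "(\<Sum>m. norm (t ^ m *\<^sub>R a m)) \<le> (\<Sum>m. norm (a m) * r ^ m)"
proof -
  have le: "norm (t ^ m *\<^sub>R a m) \<le> norm (a m) * r ^ m" for m
    using mult_left_mono[OF power_mono[OF assms(2) abs_ge_zero, of m], of "norm (a m)"]
    by (simp add: power_abs mult.commute)
  have sm: "summable (\<lambda>m. norm (a m) * r ^ m)" using assms(1) by (simp add: power_series_on_def)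
  show 1: "summable (\<lambda>m. norm (t ^ m *\<^sub>R a m))"
    by (rule summable_comparison_test'[OF sm]) (use le in auto)
  show "(\<Sum>m. norm (t ^ m *\<^sub>R a m)) \<le> (\<Sum>m. norm (a m) * r ^ m)"
    by (rule suminf_le[OF le 1 sm])
qed

lemma norm_power_series_bounded:
  fixes f :: "real \<Rightarrow> 'a::banach"
  assumes "power_series_bounded r c f" "\<bar>t\<bar> \<le> r"
  shows "norm (f t) \<le> c"
proof -
  obtain a where a: "power_series_on r a f" "(\<Sum>m. norm (a m) * r ^ m) \<le> c"
    using assms(1) by (auto simp: power_series_bounded_def)
  have "f t = (\<Sum>m. t ^ m *\<^sub>R a m)"
    using a(1) assms(2) by (simp add: power_series_on_def sums_iff)
  also have "norm \<dots> \<le> (\<Sum>m. norm (t ^ m *\<^sub>R a m))"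
    by (rule summable_norm[OF summable_norm_power_series(1)[OF a(1) assms(2)]])
  finally show ?thesis using summable_norm_power_series(2)[OF a(1) assms(2)] a(2) by linarith
qed

text \<open>Completeness of the weighted norm: the coefficients of the sum are column sums of an
  absolutely summable double series whose rows are the given power series.\<close>

lemma power_series_on_suminf:
  fixes a :: "nat \<Rightarrow> nat \<Rightarrow> 'a::banach"
  assumes "r > 0" and ps: "\<And>n. power_series_on r (a n) (f n)"
    and total: "summable (\<lambda>n. \<Sum>m. norm (a n m) * r ^ m)"
  shows "power_series_on r (\<lambda>m. \<Sum>n. a n m) (\<lambda>t. \<Sum>n. f n t)"
    and "(\<Sum>m. norm (\<Sum>n. a n m) * r ^ m) \<le> (\<Sum>n. \<Sum>m. norm (a n m) * r ^ m)"
proof -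
  define h where "h t n m = (t::real) ^ m *\<^sub>R a n m" for t n m
  have row: "summable (\<lambda>m. norm (h t n m))" if "\<bar>t\<bar> \<le> r" for t n
    using summable_norm_power_series(1)[OF ps that] by (simp add: h_def)
  have nn: "(\<Sum>m. norm (h t n m)) \<ge> 0" if "\<bar>t\<bar> \<le> r" for t n
    by (intro suminf_nonneg row that) auto
  have tot: "summable (\<lambda>n. \<Sum>m. norm (h t n m))" if "\<bar>t\<bar> \<le> r" for t
    by (rule summable_comparison_test'[OF total])
      (use nn[OF that] summable_norm_power_series(2)[OF ps that] in \<open>auto simp: h_def simp del: norm_scaleR\<close>)
  have rr: "\<bar>r\<bar> \<le> r" using \<open>r > 0\<close> by simp
  have hr: "norm (h r n m) = norm (a n m) * r ^ m" for n m
    using \<open>r > 0\<close> by (simp add: h_def)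
  have col: "summable (\<lambda>n. a n m)" for m
  proof -
    have "summable (\<lambda>n. norm (h r n m) / r ^ m)"
      by (intro summable_divide double_series(1)[OF row[OF rr] tot[OF rr]])
    then show ?thesis using \<open>r > 0\<close> by (intro summable_norm_cancel[of "\<lambda>n. a n m"]) (simp add: hr)
  qed
  have hsum: "(\<Sum>n. h t n m) = t ^ m *\<^sub>R (\<Sum>n. a n m)" for t m
    unfolding h_def by (rule suminf_scaleR_right[OF col, symmetric])
  have "norm (\<Sum>n. h r n m) = norm (\<Sum>n. a n m) * r ^ m" for m
    using \<open>r > 0\<close> by (simp add: hsum)
  then have n: "summable (\<lambda>m. norm (\<Sum>n. a n m) * r ^ m)"
    "(\<Sum>m. norm (\<Sum>n. a n m) * r ^ m) \<le> (\<Sum>n. \<Sum>m. norm (a n m) * r ^ m)"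
    using double_series(3,4)[OF row[OF rr] tot[OF rr]] by (simp_all add: hr)
  have "(\<lambda>m. t ^ m *\<^sub>R (\<Sum>n. a n m)) sums (\<Sum>n. f n t)" if "\<bar>t\<bar> \<le> r" for t
  proof -
    have "(\<Sum>m. h t n m) = f n t" for n
      using ps[of n] that by (simp add: power_series_on_def h_def sums_iff)
    then show ?thesis
      using double_series(2)[OF row[OF that] tot[OF that]] by (simp add: hsum)
  qed
  with n show "power_series_on r (\<lambda>m. \<Sum>n. a n m) (\<lambda>t. \<Sum>n. f n t)"
    "(\<Sum>m. norm (\<Sum>n. a n m) * r ^ m) \<le> (\<Sum>n. \<Sum>m. norm (a n m) * r ^ m)"
    by (simp_all add: power_series_on_def)
qed

lemma power_series_bounded_suminf:
  fixes f :: "nat \<Rightarrow> real \<Rightarrow> 'a::banach"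
  assumes "r > 0" and ps: "\<And>n. power_series_bounded r (c n) (f n)" and "summable c"
  shows "power_series_bounded r (\<Sum>n. c n) (\<lambda>t. \<Sum>n. f n t)"
proof -
  obtain a where a: "\<And>n. power_series_on r (a n) (f n)" "\<And>n. (\<Sum>m. norm (a n m) * r ^ m) \<le> c n"
    using ps unfolding power_series_bounded_def by metis
  have nn: "(\<Sum>m. norm (a n m) * r ^ m) \<ge> 0" for n
    using a(1)[of n] \<open>r > 0\<close> by (intro suminf_nonneg) (auto simp: power_series_on_def)
  have sm: "summable (\<lambda>n. \<Sum>m. norm (a n m) * r ^ m)"
    by (rule summable_comparison_test'[OF \<open>summable c\<close>]) (use a(2) nn in auto)
  have "(\<Sum>n. \<Sum>m. norm (a n m) * r ^ m) \<le> (\<Sum>n. c n)"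
    by (rule suminf_le[OF a(2) sm \<open>summable c\<close>])
  then show ?thesis
    using power_series_on_suminf[OF \<open>r > 0\<close> a(1) sm] by (auto intro: power_series_boundedI)
qed

text \<open>A general bilinear \<open>prod\<close> covers both multiplication in an algebra and the
  application of an operator-valued series to a vector-valued one.\<close>

lemma power_series_on_bilinear:
  fixes prod :: "'a::banach \<Rightarrow> 'b::banach \<Rightarrow> 'c::banach"
  assumes "r > 0" and bil: "bounded_bilinear prod" and le: "\<And>x y. norm (prod x y) \<le> norm x * norm y"
    and f: "power_series_on r a f" and g: "power_series_on r b g"
  shows "power_series_on r (\<lambda>m. \<Sum>k\<le>m. prod (a k) (b (m - k))) (\<lambda>t. prod (f t) (g t))"
    and "(\<Sum>m. norm (\<Sum>k\<le>m. prod (a k) (b (m - k))) * r ^ m)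
      \<le> (\<Sum>m. norm (a m) * r ^ m) * (\<Sum>m. norm (b m) * r ^ m)"
proof -
  interpret bounded_bilinear prod by (rule bil)
  \<comment> \<open>Row \<open>n\<close> is the series of \<open>g\<close> multiplied by the single
    term \<open>t ^ n *\<^sub>R a n\<close>, hence shifted by \<open>n\<close>; summing the rows
    reduces the product to a series of power series.\<close>
  define A where "A n m = (if n \<le> m then prod (a n) (b (m - n)) else 0)" for n m
  have sa: "summable (\<lambda>m. norm (a m) * r ^ m)" and sb: "summable (\<lambda>m. norm (b m) * r ^ m)"
    using f g by (auto simp: power_series_on_def)
  let ?B = "\<Sum>m. norm (b m) * r ^ m"
  have An: "summable (\<lambda>m. norm (A n m) * r ^ m) \<and> (\<Sum>m. norm (A n m) * r ^ m) \<le> norm (a n) * r ^ n * ?B" for n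
  proof -
    have le': "norm (A n (m + n)) * r ^ (m + n) \<le> norm (a n) * r ^ n * (norm (b m) * r ^ m)" for m
      using mult_right_mono[OF le[of "a n" "b m"], of "r ^ (m + n)"] \<open>r > 0\<close>
      by (simp add: A_def power_add mult_ac)
    have s1: "summable (\<lambda>m. norm (A n (m + n)) * r ^ (m + n))"
      by (rule summable_comparison_test'[OF summable_mult[OF sb, of "norm (a n) * r ^ n"]])
        (use le' \<open>r > 0\<close> in auto)
    have "(\<Sum>m. norm (A n (m + n)) * r ^ (m + n)) \<le> (\<Sum>m. norm (a n) * r ^ n * (norm (b m) * r ^ m))"
      by (rule suminf_le[OF le' s1 summable_mult[OF sb]])
    also have "\<dots> = norm (a n) * r ^ n * ?B" by (rule suminf_mult[OF sb])
    finally have "(\<Sum>m. norm (A n (m + n)) * r ^ (m + n)) \<le> norm (a n) * r ^ n * ?B" .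
    moreover have "(\<lambda>m. norm (A n m) * r ^ m) sums (\<Sum>m. norm (A n (m + n)) * r ^ (m + n))"
      using summable_sums[OF s1] by (subst (asm) sums_zero_iff_shift) (auto simp: A_def)
    ultimately show ?thesis by (auto simp: sums_iff)
  qed
  have ps: "power_series_on r (A n) (\<lambda>t. t ^ n *\<^sub>R prod (a n) (g t))" for n
    unfolding power_series_on_def
  proof (intro conjI allI impI)
    show "summable (\<lambda>m. norm (A n m) * r ^ m)" using An by blast
    fix t assume "\<bar>t\<bar> \<le> r"
    then have "(\<lambda>m. t ^ m *\<^sub>R b m) sums g t" using g by (simp add: power_series_on_def)
    then have "(\<lambda>m. prod (t ^ n *\<^sub>R a n) (t ^ m *\<^sub>R b m)) sums prod (t ^ n *\<^sub>R a n) (g t)"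
      by (rule bounded_linear.sums[OF bounded_linear_right])
    moreover have "prod (t ^ n *\<^sub>R a n) (t ^ m *\<^sub>R b m) = t ^ (m + n) *\<^sub>R A n (m + n)" for m
      by (simp add: A_def scaleR_left scaleR_right power_add mult.commute)
    ultimately have "(\<lambda>m. t ^ (m + n) *\<^sub>R A n (m + n)) sums (t ^ n *\<^sub>R prod (a n) (g t))"
      by (simp add: scaleR_left)
    then show "(\<lambda>m. t ^ m *\<^sub>R A n m) sums (t ^ n *\<^sub>R prod (a n) (g t))"
      by (subst (asm) sums_zero_iff_shift) (auto simp: A_def)
  qed
  have nn: "0 \<le> (\<Sum>m. norm (A n m) * r ^ m)" for n
    using An[of n] \<open>r > 0\<close> by (intro suminf_nonneg) auto
  have tot: "summable (\<lambda>n. \<Sum>m. norm (A n m) * r ^ m)"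
    by (rule summable_comparison_test'[OF summable_mult2[OF sa, of ?B]]) (use An nn in auto)
  have bound: "(\<Sum>n. \<Sum>m. norm (A n m) * r ^ m) \<le> (\<Sum>m. norm (a m) * r ^ m) * ?B"
  proof -
    have "(\<Sum>n. \<Sum>m. norm (A n m) * r ^ m) \<le> (\<Sum>n. norm (a n) * r ^ n * ?B)"
      using An by (intro suminf_le tot summable_mult2 sa) auto
    then show ?thesis by (simp add: suminf_mult2[OF sa])
  qed
  have "(\<Sum>n. A n m) = (\<Sum>n\<le>m. A n m)" for m
    by (rule suminf_finite) (auto simp: A_def)
  then have coeff: "(\<Sum>n. A n m) = (\<Sum>k\<le>m. prod (a k) (b (m - k)))" for m
    by (simp add: A_def)
  have fg: "(\<Sum>n. t ^ n *\<^sub>R prod (a n) (g t)) = prod (f t) (g t)" if "\<bar>t\<bar> \<le> r" for t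
  proof -
    have "(\<lambda>n. t ^ n *\<^sub>R a n) sums f t" using f that by (simp add: power_series_on_def)
    then have "(\<lambda>n. prod (t ^ n *\<^sub>R a n) (g t)) sums prod (f t) (g t)"
      by (rule bounded_linear.sums[OF bounded_linear_left])
    then show ?thesis by (simp add: scaleR_left sums_iff)
  qed
  show "power_series_on r (\<lambda>m. \<Sum>k\<le>m. prod (a k) (b (m - k))) (\<lambda>t. prod (f t) (g t))"
    using power_series_on_suminf(1)[OF \<open>r > 0\<close> ps tot] fg by (simp add: power_series_on_def coeff)
  show "(\<Sum>m. norm (\<Sum>k\<le>m. prod (a k) (b (m - k))) * r ^ m)
      \<le> (\<Sum>m. norm (a m) * r ^ m) * (\<Sum>m. norm (b m) * r ^ m)"
    using power_series_on_suminf(2)[OF \<open>r > 0\<close> ps tot] bound by (simp add: coeff)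
qed

lemma power_series_bounded_mult:
  fixes f g :: "real \<Rightarrow> 'a::{real_normed_algebra,banach}"
  assumes "r > 0" "power_series_bounded r c f" "power_series_bounded r d g"
  shows "power_series_bounded r (c * d) (\<lambda>t. f t * g t)"
proof -
  obtain a b where ab: "power_series_on r a f" "(\<Sum>m. norm (a m) * r ^ m) \<le> c"
    "power_series_on r b g" "(\<Sum>m. norm (b m) * r ^ m) \<le> d"
    using assms(2,3) unfolding power_series_bounded_def by blast
  have nn: "0 \<le> (\<Sum>m. norm (a m) * r ^ m)" "0 \<le> (\<Sum>m. norm (b m) * r ^ m)"
    using ab \<open>r > 0\<close> by (auto simp: power_series_on_def intro!: suminf_nonneg)
  then have "(\<Sum>m. norm (a m) * r ^ m) * (\<Sum>m. norm (b m) * r ^ m) \<le> c * d"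
    using ab by (intro mult_mono) auto
  then show ?thesis
    using power_series_on_bilinear[OF \<open>r > 0\<close> bounded_bilinear_mult norm_mult_ineq ab(1,3)]
    by (intro power_series_boundedI) auto
qed

lemma power_series_bounded_const:
  fixes x :: "'a::banach"
  shows "power_series_bounded r (norm x) (\<lambda>_. x)"
proof (rule power_series_boundedI)
  let ?a = "\<lambda>m. if m = 0 then x else 0"
  have eq: "norm (?a m) * r ^ m = (if m = 0 then norm x else 0)" for m by simp
  have "(\<lambda>m. t ^ m *\<^sub>R ?a m) sums x" for t :: real
  proof -
    have "(\<lambda>m. t ^ m *\<^sub>R ?a m) = (\<lambda>m. if m = 0 then x else 0)" by auto
    then show ?thesis using sums_single[of 0 "\<lambda>_. x"] by (simp only:)
  qed
  moreover have 1: "(\<lambda>m. norm (?a m) * r ^ m) sums norm x"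
    unfolding eq using sums_single[of 0 "\<lambda>_. norm x"] by (simp only:)
  ultimately show "power_series_on r ?a (\<lambda>_. x)"
    by (simp add: power_series_on_def sums_iff)
  show "(\<Sum>m. norm (?a m) * r ^ m) \<le> norm x" using 1 by (simp add: sums_iff)
qed

lemma power_series_bounded_add:
  fixes f g :: "real \<Rightarrow> 'a::banach"
  assumes "r > 0" "power_series_bounded r c f" "power_series_bounded r d g"
  shows "power_series_bounded r (c + d) (\<lambda>t. f t + g t)"
proof -
  obtain a b where ab: "power_series_on r a f" "(\<Sum>m. norm (a m) * r ^ m) \<le> c"
    "power_series_on r b g" "(\<Sum>m. norm (b m) * r ^ m) \<le> d"
    using assms(2,3) unfolding power_series_bounded_def by blast
  have sa: "summable (\<lambda>m. norm (a m) * r ^ m)" and sb: "summable (\<lambda>m. norm (b m) * r ^ m)"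
    using ab by (auto simp: power_series_on_def)
  have le: "norm (a m + b m) * r ^ m \<le> norm (a m) * r ^ m + norm (b m) * r ^ m" for m
    using mult_right_mono[OF norm_triangle_ineq[of "a m" "b m"], of "r ^ m"] \<open>r > 0\<close>
    by (simp add: distrib_right)
  have s: "summable (\<lambda>m. norm (a m + b m) * r ^ m)"
    by (rule summable_comparison_test'[OF summable_add[OF sa sb]]) (use le \<open>r > 0\<close> in auto)
  have "(\<Sum>m. norm (a m + b m) * r ^ m) \<le> (\<Sum>m. norm (a m) * r ^ m + norm (b m) * r ^ m)"
    by (rule suminf_le[OF le s summable_add[OF sa sb]])
  also have "\<dots> \<le> c + d" using ab(2,4) by (simp add: suminf_add[OF sa sb, symmetric])
  finally show ?thesis
    using ab(1,3) s
    by (intro power_series_boundedI[of r "\<lambda>m. a m + b m"])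
      (auto simp: power_series_on_def scaleR_add_right intro: sums_add)
qed

lemma power_series_bounded_scaleR:
  fixes f :: "real \<Rightarrow> 'a::banach"
  assumes "power_series_bounded r c f"
  shows "power_series_bounded r (\<bar>k\<bar> * c) (\<lambda>t. k *\<^sub>R f t)"
proof -
  obtain a where a: "power_series_on r a f" "(\<Sum>m. norm (a m) * r ^ m) \<le> c"
    using assms unfolding power_series_bounded_def by blast
  have sa: "summable (\<lambda>m. norm (a m) * r ^ m)" using a by (simp add: power_series_on_def)
  have "(\<lambda>m. t ^ m *\<^sub>R (k *\<^sub>R a m)) sums (k *\<^sub>R f t)" if "\<bar>t\<bar> \<le> r" for t
    using a(1) that sums_scaleR_right[of "\<lambda>m. t ^ m *\<^sub>R a m" "f t" k]
    by (simp add: power_series_on_def mult.commute)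
  moreover have "(\<lambda>m. norm (k *\<^sub>R a m) * r ^ m) sums (\<bar>k\<bar> * (\<Sum>m. norm (a m) * r ^ m))"
    using sums_mult[OF summable_sums[OF sa], of "\<bar>k\<bar>"] by (simp add: mult.assoc)
  ultimately show ?thesis
    using mult_left_mono[OF a(2), of "\<bar>k\<bar>"]
    by (intro power_series_boundedI[of r "\<lambda>m. k *\<^sub>R a m"]) (auto simp: power_series_on_def sums_iff)
qed

lemma power_series_bounded_power:
  fixes f :: "real \<Rightarrow> 'a::complex_banach_algebra"
  assumes "r > 0" "power_series_bounded r c f"
  shows "power_series_bounded r (norm (1::'a) * c ^ n) (\<lambda>t. f t ^ n)"
proof (induction n)
  case (Suc n)
  then show ?case
    using power_series_bounded_mult[OF assms Suc] by (simp add: mult_ac)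
qed (use power_series_bounded_const[of r "1::'a"] in simp)

text \<open>A Schwarz-type estimate: without a constant term every summand gains at least one factor
  \<open>s / r\<close>.\<close>

lemma power_series_bounded_shrink:
  fixes f :: "real \<Rightarrow> 'a::banach"
  assumes "power_series_bounded r c f" "f 0 = 0" "0 < s" "s \<le> r"
  shows "power_series_bounded s (c * (s / r)) f"
proof -
  obtain a where a: "power_series_on r a f" "(\<Sum>m. norm (a m) * r ^ m) \<le> c"
    using assms unfolding power_series_bounded_def by blast
  have sa: "summable (\<lambda>m. norm (a m) * r ^ m)" using a by (simp add: power_series_on_def)
  have "(\<lambda>m. t ^ m *\<^sub>R a m) sums f t" if "\<bar>t\<bar> \<le> r" for t
    using a(1) that by (simp add: power_series_on_def)
  then have "(\<lambda>m. (0::real) ^ m *\<^sub>R a m) sums f 0" using assms(3,4) by force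
  moreover have "(\<lambda>m. (0::real) ^ m *\<^sub>R a m) = (\<lambda>m. if m = 0 then a 0 else 0)" by auto
  ultimately have "a 0 = 0"
    using sums_single[of 0 "\<lambda>_. a 0"] sums_unique2 assms(2) by metis
  have le: "norm (a m) * s ^ m \<le> norm (a m) * r ^ m * (s / r)" for m
  proof (cases m)
    case (Suc k)
    have "s ^ m = s ^ k * s" using Suc by simp
    also have "\<dots> \<le> r ^ k * s" using assms by (intro mult_right_mono power_mono) auto
    also have "\<dots> = r ^ m * (s / r)" using Suc assms by simp
    finally show ?thesis by (metis mult.assoc mult_left_mono norm_ge_zero)
  qed (simp add: \<open>a 0 = 0\<close>)
  have s: "summable (\<lambda>m. norm (a m) * s ^ m)"
    by (rule summable_comparison_test'[OF summable_mult2[OF sa, of "s / r"]]) (use le \<open>s > 0\<close> in auto)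
  have "(\<Sum>m. norm (a m) * s ^ m) \<le> (\<Sum>m. norm (a m) * r ^ m * (s / r))"
    by (rule suminf_le[OF le s summable_mult2[OF sa]])
  also have "\<dots> = (\<Sum>m. norm (a m) * r ^ m) * (s / r)" by (rule suminf_mult2[OF sa, symmetric])
  also have "\<dots> \<le> c * (s / r)" using a(2) assms by (intro mult_right_mono) auto
  finally show ?thesis
    using a(1) s assms by (intro power_series_boundedI[of s a]) (auto simp: power_series_on_def)
qed

lemma power_series_bounded_linear:
  fixes f :: "real \<Rightarrow> 'a::banach" and T :: "'a \<Rightarrow> 'b::banach"
  assumes "r > 0" "power_series_bounded r c f" "bounded_linear T"
  shows "\<exists>d. power_series_bounded r d (\<lambda>t. T (f t))"
proof -
  interpret bounded_linear T by fact
  obtain a where a: "power_series_on r a f"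
    using assms unfolding power_series_bounded_def by blast
  have sa: "summable (\<lambda>m. norm (a m) * r ^ m)" using a by (simp add: power_series_on_def)
  obtain K where K: "\<And>x. norm (T x) \<le> norm x * K" using bounded by blast
  have le: "norm (T (a m)) * r ^ m \<le> norm (a m) * r ^ m * K" for m
    using mult_right_mono[OF K[of "a m"], of "r ^ m"] \<open>r > 0\<close> by (simp add: mult_ac)
  have "summable (\<lambda>m. norm (T (a m)) * r ^ m)"
    by (rule summable_comparison_test'[OF summable_mult2[OF sa, of K]]) (use le \<open>r > 0\<close> in auto)
  moreover have "(\<lambda>m. t ^ m *\<^sub>R T (a m)) sums T (f t)" if "\<bar>t\<bar> \<le> r" for t
    using sums[of "\<lambda>m. t ^ m *\<^sub>R a m" "f t"] a that by (simp add: power_series_on_def scaleR)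
  ultimately show ?thesis
    by (intro exI power_series_boundedI[of r "\<lambda>m. T (a m)"]) (auto simp: power_series_on_def)
qed

text \<open>Re-expansion about \<open>x0\<close>: the binomial theorem spreads each term over powers
  of \<open>x - x0\<close>, and the double series converges absolutely up to the distance from
  \<open>x0\<close> to the end of the interval.\<close>

lemma power_series_bounded_real_analytic:
  fixes f :: "real \<Rightarrow> 'a::banach"
  assumes "power_series_bounded r c f"
  shows "f real_analytic_on {- r<..<r}"
  unfolding real_analytic_on_def
proof
  fix x0 assume x0: "x0 \<in> {- r<..<r}"
  obtain a where a: "power_series_on r a f"
    using assms unfolding power_series_bounded_def by blast
  define \<rho> where "\<rho> = r - \<bar>x0\<bar>"
  have "\<rho> > 0" using x0 by (auto simp: \<rho>_def)
  \<comment> \<open>The coefficient of \<open>y ^ k\<close> in the \<open>n\<close>-th term. For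
    \<open>k > n\<close> the truncated exponent is harmless, as the binomial coefficient
    vanishes.\<close>
  define w where "w n k = (real (n choose k) * x0 ^ (n - k)) *\<^sub>R a n" for n k
  define h where "h y n k = (y::real) ^ k *\<^sub>R w n k" for y n k
  have w0: "w n k = 0" if "n < k" for n k using that by (simp add: w_def binomial_eq_0)
  have fin: "(\<lambda>k. h y n k) sums ((x0 + y) ^ n *\<^sub>R a n)" for y n
  proof -
    have "(\<lambda>k. h y n k) sums (\<Sum>k\<le>n. h y n k)"
      by (rule sums_finite) (auto simp: h_def w0)
    also have "(\<Sum>k\<le>n. h y n k) = (\<Sum>k\<le>n. real (n choose k) * y ^ k * x0 ^ (n - k)) *\<^sub>R a n"
      by (simp add: h_def w_def scaleR_sum_left mult_ac)
    also have "(\<Sum>k\<le>n. real (n choose k) * y ^ k * x0 ^ (n - k)) = (x0 + y) ^ n"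
      using binomial_ring[of y x0 n] by (simp add: add.commute)
    finally show ?thesis .
  qed
  have nfin: "(\<lambda>k. norm (h y n k)) sums ((\<bar>x0\<bar> + \<bar>y\<bar>) ^ n * norm (a n))" for y n
  proof -
    have "(\<lambda>k. norm (h y n k)) sums (\<Sum>k\<le>n. norm (h y n k))"
      by (rule sums_finite) (auto simp: h_def w0)
    also have "(\<Sum>k\<le>n. norm (h y n k)) = (\<Sum>k\<le>n. real (n choose k) * \<bar>y\<bar> ^ k * \<bar>x0\<bar> ^ (n - k)) * norm (a n)"
      by (simp add: h_def w_def sum_distrib_left abs_mult power_abs mult_ac)
    also have "(\<Sum>k\<le>n. real (n choose k) * \<bar>y\<bar> ^ k * \<bar>x0\<bar> ^ (n - k)) = (\<bar>x0\<bar> + \<bar>y\<bar>) ^ n"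
      using binomial_ring[of "\<bar>y\<bar>" "\<bar>x0\<bar>" n] by (simp add: add.commute)
    finally show ?thesis .
  qed
  have tot: "summable (\<lambda>n. \<Sum>k. norm (h y n k))" if "\<bar>y\<bar> \<le> \<rho>" for y
  proof -
    have "summable (\<lambda>n. norm ((\<bar>x0\<bar> + \<bar>y\<bar>) ^ n *\<^sub>R a n))"
      by (rule summable_norm_power_series(1)[OF a]) (use that in \<open>auto simp: \<rho>_def\<close>)
    then show ?thesis using nfin by (simp add: sums_iff)
  qed
  have row: "summable (\<lambda>k. norm (h y n k))" for y n using nfin by (simp add: sums_iff)
  have col: "summable (\<lambda>n. w n k)" for k
  proof -
    have "summable (\<lambda>n. norm (h \<rho> n k) / \<rho> ^ k)"
      using \<open>\<rho> > 0\<close> by (intro summable_divide double_series(1)[OF row tot]) auto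
    then show ?thesis
      using \<open>\<rho> > 0\<close> by (intro summable_norm_cancel[of "\<lambda>n. w n k"]) (simp add: h_def)
  qed
  have "(\<lambda>k. (x - x0) ^ k *\<^sub>R (\<Sum>n. w n k)) sums f x" if "\<bar>x - x0\<bar> < \<rho>" for x
  proof -
    have "(\<lambda>k. \<Sum>n. h (x - x0) n k) sums (\<Sum>n. \<Sum>k. h (x - x0) n k)"
      by (rule double_series(2)[OF row tot]) (use that in auto)
    moreover have "(\<Sum>n. h (x - x0) n k) = (x - x0) ^ k *\<^sub>R (\<Sum>n. w n k)" for k
      unfolding h_def by (rule suminf_scaleR_right[OF col, symmetric])
    moreover have "(\<Sum>n. \<Sum>k. h (x - x0) n k) = (\<Sum>n. x ^ n *\<^sub>R a n)"
      using fin[of "x - x0"] by (simp add: sums_iff)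
    moreover have "(\<lambda>n. x ^ n *\<^sub>R a n) sums f x"
      using a that by (auto simp: power_series_on_def \<rho>_def)
    ultimately show ?thesis by (simp add: sums_iff)
  qed
  then show "\<exists>s>0. \<exists>b. \<forall>x\<in>{- r<..<r}. \<bar>x - x0\<bar> < s \<longrightarrow> (\<lambda>n. (x - x0) ^ n *\<^sub>R b n) sums f x"
    using \<open>\<rho> > 0\<close> by (intro exI[of _ \<rho>] exI[of _ "\<lambda>k. \<Sum>n. w n k"] conjI ballI impI)
qed

lemma power_series_bounded_inv_sqrt_series:
  fixes u :: "real \<Rightarrow> 'a::complex_banach_algebra"
  assumes "r > 0" "power_series_bounded r c u" "0 \<le> c" "c < 1"
  shows "\<exists>d. power_series_bounded r d (\<lambda>t. inv_sqrt_series (u t))"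
proof -
  let ?b = "\<lambda>n. (- 1 / 2 :: real) gchoose n"
  have ps: "power_series_bounded r (\<bar>?b n\<bar> * (norm (1::'a) * c ^ n)) (\<lambda>t. ?b n *\<^sub>R u t ^ n)" for n
    by (intro power_series_bounded_scaleR power_series_bounded_power assms)
  have sm: "summable (\<lambda>n. \<bar>?b n\<bar> * (norm (1::'a) * c ^ n))"
  proof (rule summable_comparison_test')
    show "summable (\<lambda>n. norm (1::'a) * c ^ n)"
      using assms by (intro summable_mult summable_geometric) auto
    show "norm (\<bar>?b n\<bar> * (norm (1::'a) * c ^ n)) \<le> norm (1::'a) * c ^ n" if "n \<ge> 0" for n
      using abs_gbinomial_minus_half_le[of n] \<open>0 \<le> c\<close>
      by (simp add: abs_mult mult_left_le_one_le)
  qed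
  show ?thesis
    unfolding inv_sqrt_series_def by (rule exI, rule power_series_bounded_suminf[OF \<open>r > 0\<close> ps sm])
qed

subsection \<open>Lifting power series\<close>

text \<open>The quantitative open mapping theorem. By Baire the closed image of some ball contains a
  ball; this gives approximate preimages that halve the error at linear cost, and iterating sums to
  an exact preimage.\<close>

lemma open_mapping_bound:
  fixes T :: "'a::banach \<Rightarrow>\<^sub>L 'b::banach"
  assumes "surj (blinfun_apply T)"
  obtains C where "C > 0" "\<And>y. \<exists>x. blinfun_apply T x = y \<and> norm x \<le> C * norm y"
proof -
  define F where "F n = closure (blinfun_apply T ` cball 0 (real n))" for n
  have cover: "\<Union> (range F) = UNIV"
  proof -
    have "y \<in> \<Union> (range F)" for y
    proof -
      obtain x where x: "T x = y" using assms by (metis surjD)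
      obtain n where "norm x \<le> real n" using real_arch_simple by blast
      then have "y \<in> F n" using x unfolding F_def by (intro closure_subset[THEN subsetD]) auto
      then show ?thesis by blast
    qed
    then show ?thesis by blast
  qed
  have "\<exists>n. interior (F n) \<noteq> {}"
  proof (rule ccontr)
    assume *: "\<not> ?thesis"
    have "Met_TC.mcomplete TYPE('b)" by (simp add: complete_UNIV)
    then have "Met_TC.mtopology interior_of \<Union> (range F) = {}"
      by (rule Met_TC.metric_Baire_category_alt) (use * in \<open>auto simp: F_def\<close>)
    then show False by (simp add: cover)
  qed
  then obtain n y0 e where "e > 0" and e: "ball y0 e \<subseteq> F n"
    by (metis equals0I mem_interior)
  \<comment> \<open>After rescaling \<open>y\<close> to length \<open>e / 2\<close>, the difference
    of two approximations of accuracy \<open>e / 8\<close> leaves at most half of it; scaling back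
    by \<open>2 * norm y / e\<close> a vector of norm at most \<open>2 * n\<close> gives the
    constant.\<close>
  have half: "\<exists>x. norm x \<le> (4 * real n / e) * norm y \<and> norm (y - T x) \<le> norm y / 2" for y
  proof (cases "y = 0")
    case True
    then show ?thesis by (intro exI[of _ 0]) (simp add: blinfun.zero_right)
  next
    case False
    define z where "z = (e / (2 * norm y)) *\<^sub>R y"
    have nz: "norm z = e / 2" using False \<open>e > 0\<close> by (simp add: z_def)
    have "y0 + z \<in> F n" "y0 \<in> F n"
      using e nz \<open>e > 0\<close> by (auto simp: dist_norm subset_iff)
    moreover have "\<exists>a. norm a \<le> n \<and> dist (T a) w < e / 8" if w: "w \<in> F n" for w
    proof -
      have "e / 8 > 0" using \<open>e > 0\<close> by simp
      then obtain v where "v \<in> blinfun_apply T ` cball 0 (real n)" "dist v w < e / 8"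
        using closure_approachable[THEN iffD1, rule_format, OF w[unfolded F_def]] by metis
      then show ?thesis by auto
    qed
    ultimately obtain a b where a: "norm a \<le> n" "dist (T a) (y0 + z) < e / 8"
      and b: "norm b \<le> n" "dist (T b) y0 < e / 8"
      by blast
    have "norm (z - T (a - b)) \<le> e / 4"
    proof -
      have "z - T (a - b) = (y0 + z - T a) - (y0 - T b)" by (simp add: blinfun.diff_right)
      then have "norm (z - T (a - b)) \<le> norm (y0 + z - T a) + norm (y0 - T b)"
        by (simp only: norm_triangle_ineq4)
      then show ?thesis using a(2) b(2) by (simp add: dist_norm norm_minus_commute)
    qed
    let ?x = "(2 * norm y / e) *\<^sub>R (a - b)"
    have y: "y = (2 * norm y / e) *\<^sub>R z" using False \<open>e > 0\<close> by (simp add: z_def)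
    have "y - T ?x = (2 * norm y / e) *\<^sub>R z - (2 * norm y / e) *\<^sub>R T (a - b)"
      by (simp only: y[symmetric] blinfun.scaleR_right)
    also have "\<dots> = (2 * norm y / e) *\<^sub>R (z - T (a - b))" by (rule scaleR_diff_right[symmetric])
    finally have "norm (y - T ?x) = (2 * norm y / e) * norm (z - T (a - b))"
      using \<open>e > 0\<close> by simp
    also have "\<dots> \<le> (2 * norm y / e) * (e / 4)"
      using \<open>e > 0\<close> \<open>norm (z - T (a - b)) \<le> e / 4\<close> by (intro mult_left_mono) auto
    finally have 1: "norm (y - T ?x) \<le> norm y / 2" using \<open>e > 0\<close> by simp
    have "norm (a - b) \<le> 2 * real n" using norm_triangle_ineq4[of a b] a b by linarith
    then have "norm ?x \<le> (2 * norm y / e) * (2 * real n)"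
      using \<open>e > 0\<close> by (simp del: times_divide_eq_left add: mult_left_mono)
    then show ?thesis using 1 by (intro exI[of _ ?x]) (simp add: mult_ac)
  qed
  define c where "c = 4 * real n / e"
  have "c \<ge> 0" using \<open>e > 0\<close> by (simp add: c_def)
  obtain g where g: "\<And>y. norm (g y) \<le> c * norm y" "\<And>y. norm (y - T (g y)) \<le> norm y / 2"
    using half unfolding c_def by metis
  have "\<exists>x. T x = y \<and> norm x \<le> (2 * c + 1) * norm y" for y
  proof -
    \<comment> \<open>The residual after \<open>k\<close> corrections. It tends to \<open>0\<close>,
      so the series of corrections telescopes to \<open>y\<close>.\<close>
    define r where "r k = ((\<lambda>y. y - T (g y)) ^^ k) y" for k
    have r_Suc: "r (Suc k) = r k - T (g (r k))" for k by (simp add: r_def)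
    have r: "norm (r k) \<le> norm y * (1 / 2) ^ k" for k
    proof (induction k)
      case (Suc k)
      then show ?case using g(2)[of "r k"] by (simp add: r_Suc)
    qed (simp add: r_def)
    have gr: "norm (g (r k)) \<le> c * norm y * (1 / 2) ^ k" for k
      using order_trans[OF g(1) mult_left_mono[OF r \<open>c \<ge> 0\<close>]] by (simp add: mult.assoc)
    have geo: "(\<lambda>k. c * norm y * (1 / 2) ^ k) sums (c * norm y * 2)"
      using geometric_sums[of "1 / 2 :: real"] by (intro sums_mult) simp
    have sm: "summable (\<lambda>k. norm (g (r k)))"
      by (rule summable_comparison_test'[OF sums_summable[OF geo]]) (use gr in auto)
    define x where "x = (\<Sum>k. g (r k))"
    have "norm x \<le> (\<Sum>k. norm (g (r k)))" unfolding x_def by (rule summable_norm[OF sm])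
    also have "\<dots> \<le> c * norm y * 2"
      using suminf_le[OF gr sm sums_summable[OF geo]] geo by (simp add: sums_iff)
    also have "\<dots> \<le> (2 * c + 1) * norm y" by (simp add: distrib_right)
    finally have "norm x \<le> (2 * c + 1) * norm y" .
    moreover have "T x = y"
    proof -
      have "(\<lambda>k. T (g (r k))) sums T x"
        unfolding x_def
        by (rule bounded_linear.sums[OF blinfun.bounded_linear_right summable_sums[OF summable_norm_cancel[OF sm]]])
      moreover have "(\<lambda>k. T (g (r k))) sums y"
      proof -
        have "r \<longlonglongrightarrow> 0"
        proof (rule Lim_null_comparison)
          show "\<forall>\<^sub>F k in sequentially. norm (r k) \<le> norm y * (1 / 2) ^ k" using r by simp
          show "(\<lambda>k. norm y * (1 / 2) ^ k) \<longlonglongrightarrow> 0"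
            by (intro tendsto_mult_right_zero LIMSEQ_power_zero) simp
        qed
        then have "(\<lambda>k. r k - r (Suc k)) sums (r 0 - 0)" by (rule telescope_sums')
        then show ?thesis by (simp add: r_Suc) (simp add: r_def)
      qed
      ultimately show ?thesis by (rule sums_unique2)
    qed
    ultimately show ?thesis by blast
  qed
  then show ?thesis using that[of "2 * c + 1"] \<open>c \<ge> 0\<close> by simp
qed

text \<open>Convergence at the single point \<open>\<rho>\<close> already bounds the terms there,
  which plays the role of Cauchy's estimate. Taking at most \<open>r / 2\<close> keeps
  \<open>\<rho>\<close> strictly inside the region of convergence.\<close>

lemma real_analytic_coeff_bound:
  fixes f :: "real \<Rightarrow> 'a::banach"
  assumes "f real_analytic_on G" "open G" "0 \<in> G"
  obtains a \<rho> M where "\<rho> > 0" "M > 0" "\<And>n. norm (a n) * \<rho> ^ n \<le> M"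
    "\<And>t. \<bar>t\<bar> \<le> \<rho> \<Longrightarrow> t \<in> G" "\<And>t. \<bar>t\<bar> \<le> \<rho> \<Longrightarrow> (\<lambda>n. t ^ n *\<^sub>R a n) sums f t"
proof -
  obtain r a where "r > 0" and a: "\<And>x. x \<in> G \<Longrightarrow> \<bar>x\<bar> < r \<Longrightarrow> (\<lambda>n. x ^ n *\<^sub>R a n) sums f x"
    using assms(1,3) unfolding real_analytic_on_def by (metis diff_zero)
  obtain s where "s > 0" and s: "cball 0 s \<subseteq> G"
    using assms(2,3) open_contains_cball by blast
  define \<rho> where "\<rho> = min s (r / 2)"
  have "\<rho> > 0" using \<open>r > 0\<close> \<open>s > 0\<close> by (simp add: \<rho>_def)
  have G: "t \<in> G" if "\<bar>t\<bar> \<le> \<rho>" for t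
    using s that by (auto simp: \<rho>_def subset_iff)
  have sm: "(\<lambda>n. t ^ n *\<^sub>R a n) sums f t" if "\<bar>t\<bar> \<le> \<rho>" for t
    by (rule a[OF G[OF that]]) (use that \<open>r > 0\<close> in \<open>auto simp: \<rho>_def\<close>)
  have "(\<lambda>n. \<rho> ^ n *\<^sub>R a n) \<longlonglongrightarrow> 0"
    using sm[of \<rho>] \<open>\<rho> > 0\<close> by (intro summable_LIMSEQ_zero) (auto simp: sums_iff)
  then have "Bseq (\<lambda>n. \<rho> ^ n *\<^sub>R a n)" by (intro convergent_imp_Bseq convergentI)
  then obtain M where "M > 0" "\<And>n. norm (\<rho> ^ n *\<^sub>R a n) \<le> M" by (auto simp: Bseq_def)
  then show ?thesis
    using that[of \<rho> M a] \<open>\<rho> > 0\<close> G sm by (simp add: mult.commute)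
qed

lemma power_series_on_of_bound:
  fixes a :: "nat \<Rightarrow> 'a::banach"
  assumes "0 < r" "r < \<rho>" and M: "\<And>n. norm (a n) * \<rho> ^ n \<le> M"
  shows "power_series_on r a (\<lambda>t. \<Sum>n. t ^ n *\<^sub>R a n)"
proof -
  have le: "norm (a n) * r ^ n \<le> M * (r / \<rho>) ^ n" for n
    using mult_right_mono[OF M[of n], of "(r / \<rho>) ^ n"] assms(1,2) by (simp add: power_divide)
  have sm: "summable (\<lambda>n. norm (a n) * r ^ n)"
  proof (rule summable_comparison_test')
    show "summable (\<lambda>n. M * (r / \<rho>) ^ n)"
      using assms(1,2) by (intro summable_mult summable_geometric) auto
    show "norm (norm (a n) * r ^ n) \<le> M * (r / \<rho>) ^ n" if "n \<ge> 0" for n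
      using le[of n] assms(1) by simp
  qed
  have "(\<lambda>n. t ^ n *\<^sub>R a n) sums (\<Sum>n. t ^ n *\<^sub>R a n)" if "\<bar>t\<bar> \<le> r" for t
  proof (rule summable_sums, rule summable_norm_cancel, rule summable_comparison_test'[OF sm])
    show "norm (norm (t ^ n *\<^sub>R a n)) \<le> norm (a n) * r ^ n" if "n \<ge> 0" for n
      using mult_left_mono[OF power_mono[OF \<open>\<bar>t\<bar> \<le> r\<close> abs_ge_zero, of n], of "norm (a n)"]
      by (simp add: power_abs mult.commute)
  qed
  then show ?thesis using sm by (simp add: power_series_on_def)
qed

text \<open>The coefficients of \<open>x\<close> are found recursively; the open mapping bound keeps their growth geometric.\<close>
lemma lift_power_series:
  fixes \<pi> :: "real \<Rightarrow> 'a::banach \<Rightarrow>\<^sub>L 'b::banach" and q :: "real \<Rightarrow> 'b"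
  assumes G: "open G" "0 \<in> G" and an: "\<pi> real_analytic_on G" "q real_analytic_on G"
    and surj: "surj (blinfun_apply (\<pi> 0))" and p0: "\<pi> 0 p0 = q 0"
  obtains r c x where "r > 0" "power_series_bounded r c x" "x 0 = p0"
    "\<And>t. \<bar>t\<bar> \<le> r \<Longrightarrow> t \<in> G" "\<And>t. \<bar>t\<bar> \<le> r \<Longrightarrow> \<pi> t (x t) = q t"
proof -
  obtain a \<rho>1 M1 where a: "\<rho>1 > 0" "M1 > 0" "\<And>n. norm (a n) * \<rho>1 ^ n \<le> M1"
    "\<And>t. \<bar>t\<bar> \<le> \<rho>1 \<Longrightarrow> t \<in> G" "\<And>t. \<bar>t\<bar> \<le> \<rho>1 \<Longrightarrow> (\<lambda>n. t ^ n *\<^sub>R a n) sums \<pi> t"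
    by (rule real_analytic_coeff_bound[OF an(1) G]) (rule that)
  obtain b \<rho>2 M2 where b: "\<rho>2 > 0" "M2 > 0" "\<And>n. norm (b n) * \<rho>2 ^ n \<le> M2"
    "\<And>t. \<bar>t\<bar> \<le> \<rho>2 \<Longrightarrow> t \<in> G" "\<And>t. \<bar>t\<bar> \<le> \<rho>2 \<Longrightarrow> (\<lambda>n. t ^ n *\<^sub>R b n) sums q t"
    by (rule real_analytic_coeff_bound[OF an(2) G]) (rule that)
  define \<rho> M where "\<rho> = min \<rho>1 \<rho>2" and "M = max M1 M2"
  have "\<rho> > 0" "M > 0" using a b by (auto simp: \<rho>_def M_def)
  have aM: "norm (a n) * \<rho> ^ n \<le> M" for n
  proof -
    have "norm (a n) * \<rho> ^ n \<le> norm (a n) * \<rho>1 ^ n"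
      using \<open>\<rho> > 0\<close> by (intro mult_left_mono power_mono) (auto simp: \<rho>_def)
    then show ?thesis using a(3)[of n] by (simp add: M_def)
  qed
  have bM: "norm (b n) * \<rho> ^ n \<le> M" for n
  proof -
    have "norm (b n) * \<rho> ^ n \<le> norm (b n) * \<rho>2 ^ n"
      using \<open>\<rho> > 0\<close> by (intro mult_left_mono power_mono) (auto simp: \<rho>_def)
    then show ?thesis using b(3)[of n] by (simp add: M_def)
  qed
  have at0: "f 0 = d 0" if "(\<lambda>n. (0::real) ^ n *\<^sub>R d n) sums f 0" for f d :: "_ \<Rightarrow> 'c::real_normed_vector"
  proof -
    have "(\<lambda>n. (0::real) ^ n *\<^sub>R d n) = (\<lambda>n. if n = 0 then d 0 else 0)" by auto
    then show ?thesis using that sums_single[of 0 "\<lambda>_. d 0"] sums_unique2 by metis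
  qed
  have a0: "a 0 = \<pi> 0" using at0[of a \<pi>] a(1) a(5)[of 0] by simp
  have b0: "b 0 = q 0" using at0[of b q] b(1) b(5)[of 0] by simp
  obtain C where "C > 0" and C: "\<And>y. \<exists>x. \<pi> 0 x = y \<and> norm x \<le> C * norm y"
    by (rule open_mapping_bound[OF surj]) (rule that)
  obtain g where g: "\<And>y. \<pi> 0 (g y) = y" "\<And>y. norm (g y) \<le> C * norm y"
    using C by metis
  \<comment> \<open>In the coefficient of \<open>t ^ n\<close> of the equation to be solved,
    \<open>x n\<close> is multiplied only by \<open>a 0 = \<pi> 0\<close>, for which
    \<open>g\<close> is a right inverse with linear growth; \<open>g\<close> itself need not be
    linear.\<close>
  define x where "x = wfrec less_than (\<lambda>x n. if n = 0 then p0 else g (b n - (\<Sum>k\<in>{1..n}. a k (x (n - k)))))"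
  have x_eq: "x n = (if n = 0 then p0 else g (b n - (\<Sum>k\<in>{1..n}. a k (x (n - k)))))" for n
    by (subst x_def, subst wfrec, simp, unfold x_def[symmetric])
      (auto simp: cut_def intro!: arg_cong[where f = g] sum.cong)
  have x0: "x 0 = p0" by (simp add: x_eq)
  have conv: "(\<Sum>k\<le>n. a k (x (n - k))) = b n" for n
  proof (cases "n = 0")
    case False
    have "{..n} = insert 0 {1..n}" by auto
    then have "(\<Sum>k\<le>n. a k (x (n - k))) = a 0 (x n) + (\<Sum>k\<in>{1..n}. a k (x (n - k)))"
      by simp
    also have "a 0 (x n) = b n - (\<Sum>k\<in>{1..n}. a k (x (n - k)))"
      using False by (subst x_eq) (simp add: a0 g)
    finally show ?thesis by simp
  qed (simp add: x0 a0 b0 p0)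
  \<comment> \<open>Chosen so that \<open>\<theta> = 1 / (L * \<rho>)\<close> closes the induction
    \<open>xK\<close>: \<open>\<theta> \<le> 1 / 2\<close> bounds the convolution by
    \<open>2 * \<theta>\<close>, the term \<open>b n\<close> contributes one more
    \<open>\<theta>\<close>, and \<open>3 * C * M * \<theta> \<le> 1\<close> absorbs the
    total.\<close>
  define L where "L = max (2 / \<rho>) (3 * C * M / \<rho>)"
  define K where "K = max 1 (norm p0)"
  have "L > 0" using \<open>\<rho> > 0\<close> by (simp add: L_def less_max_iff_disj)
  have Lr: "2 \<le> L * \<rho>" "3 * C * M \<le> L * \<rho>"
    using \<open>\<rho> > 0\<close> by (simp_all add: L_def max_def field_simps split: if_splits)
  have "K \<ge> 1" by (simp add: K_def)
  define \<theta> where "\<theta> = 1 / (L * \<rho>)"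
  have \<theta>: "0 < \<theta>" "\<theta> \<le> 1 / 2" "3 * C * M * \<theta> \<le> 1"
    using Lr \<open>L > 0\<close> \<open>\<rho> > 0\<close> by (simp_all add: \<theta>_def field_simps)
  have \<theta>pow: "1 / \<rho> ^ k = \<theta> ^ k * L ^ k" for k
    using \<open>L > 0\<close> by (simp add: \<theta>_def power_mult_distrib power_divide)
  have an_le: "norm (a k) \<le> M * \<theta> ^ k * L ^ k" and bn_le: "norm (b k) \<le> M * \<theta> ^ k * L ^ k" for k
    using aM[of k] bM[of k] \<open>\<rho> > 0\<close> by (simp_all add: mult.assoc pos_le_divide_eq flip: \<theta>pow)
  have geo: "(\<Sum>k\<in>{1..n}. \<theta> ^ k) \<le> 2 * \<theta>" for n
  proof -
    \<comment> \<open>The subtracted remainder is what lets the induction go through.\<close>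
    have "(\<Sum>k\<in>{1..n}. \<theta> ^ k) \<le> 2 * \<theta> - 2 * (\<theta> ^ n * \<theta>)"
    proof (induction n)
      case (Suc n)
      have "\<theta> ^ n * \<theta> * \<theta> \<le> \<theta> ^ n * \<theta> * (1 / 2)" using \<theta> by (intro mult_left_mono) auto
      then have "2 * (\<theta> ^ Suc n * \<theta>) \<le> \<theta> ^ n * \<theta>" by (simp add: mult_ac)
      moreover have "(\<Sum>k\<in>{1..Suc n}. \<theta> ^ k) = (\<Sum>k\<in>{1..n}. \<theta> ^ k) + \<theta> ^ n * \<theta>"
        by (simp add: mult.commute)
      ultimately show ?case using Suc by linarith
    qed simp
    moreover have "0 \<le> \<theta> ^ n * \<theta>" using \<theta>(1) by simp
    ultimately show ?thesis by linarith
  qed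
  have xK: "norm (x n) \<le> K * L ^ n" for n
  proof (induction n rule: less_induct)
    case (less n)
    show ?case
    proof (cases "n = 0")
      case True
      then show ?thesis by (simp add: x0 K_def)
    next
      case False
      have summand: "norm (a k (x (n - k))) \<le> M * K * L ^ n * \<theta> ^ k" if "k \<in> {1..n}" for k
      proof -
        have "norm (a k (x (n - k))) \<le> norm (a k) * norm (x (n - k))" by (rule norm_blinfun)
        also have "\<dots> \<le> (M * \<theta> ^ k * L ^ k) * (K * L ^ (n - k))"
          using that less.IH[of "n - k"] \<open>M > 0\<close> \<theta> \<open>L > 0\<close> by (intro mult_mono an_le) auto
        also have "\<dots> = M * K * (L ^ k * L ^ (n - k)) * \<theta> ^ k" by simp
        also have "L ^ k * L ^ (n - k) = L ^ n" using that by (simp flip: power_add)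
        finally show ?thesis .
      qed
      have "norm (\<Sum>k\<in>{1..n}. a k (x (n - k))) \<le> (\<Sum>k\<in>{1..n}. M * K * L ^ n * \<theta> ^ k)"
        by (rule sum_norm_le[OF summand])
      also have "\<dots> = M * K * L ^ n * (\<Sum>k\<in>{1..n}. \<theta> ^ k)" by (simp add: sum_distrib_left)
      also have "\<dots> \<le> M * K * L ^ n * (2 * \<theta>)"
        using \<open>M > 0\<close> \<open>K \<ge> 1\<close> \<open>L > 0\<close> by (intro mult_left_mono geo) auto
      finally have s: "norm (\<Sum>k\<in>{1..n}. a k (x (n - k))) \<le> M * K * L ^ n * (2 * \<theta>)" .
      have "norm (b n) \<le> M * \<theta> ^ n * L ^ n" by (rule bn_le)
      also have "\<theta> ^ n \<le> \<theta> ^ 1" using False \<theta> by (intro power_decreasing) auto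
      also have "M * \<theta> ^ 1 * L ^ n \<le> M * K * L ^ n * \<theta>"
      proof -
        have "M * L ^ n * \<theta> * 1 \<le> M * L ^ n * \<theta> * K"
          using \<open>M > 0\<close> \<open>K \<ge> 1\<close> \<open>L > 0\<close> \<theta> by (intro mult_left_mono) auto
        then show ?thesis by (simp add: mult_ac)
      qed
      finally have bn: "norm (b n) \<le> M * K * L ^ n * \<theta>"
        using \<open>M > 0\<close> \<open>L > 0\<close> by (simp add: mult_right_mono mult_left_mono)
      have "norm (x n) \<le> C * norm (b n - (\<Sum>k\<in>{1..n}. a k (x (n - k))))"
        using False g(2) by (subst x_eq) auto
      also have "norm (b n - (\<Sum>k\<in>{1..n}. a k (x (n - k)))) \<le> M * K * L ^ n * (3 * \<theta>)"
        using norm_triangle_ineq4[of "b n" "\<Sum>k\<in>{1..n}. a k (x (n - k))"] s bn by linarith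
      also have "C * (M * K * L ^ n * (3 * \<theta>)) = (3 * C * M * \<theta>) * (K * L ^ n)" by simp
      also have "\<dots> \<le> 1 * (K * L ^ n)"
        using \<theta>(3) \<open>K \<ge> 1\<close> \<open>L > 0\<close> by (intro mult_right_mono) auto
      finally show ?thesis using \<open>C > 0\<close> by (simp add: mult_left_mono)
    qed
  qed
  define r where "r = min (\<rho> / 2) (1 / (2 * L))"
  have "r > 0" "r < \<rho>" "r < 1 / L" using \<open>\<rho> > 0\<close> \<open>L > 0\<close> by (auto simp: r_def min_def field_simps)
  define X where "X t = (\<Sum>n. t ^ n *\<^sub>R x n)" for t :: real
  have X: "power_series_on r x X"
    unfolding X_def using \<open>r > 0\<close> \<open>r < 1 / L\<close>
  proof (rule power_series_on_of_bound)
    show "norm (x n) * (1 / L) ^ n \<le> K" for n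
      using xK[of n] \<open>L > 0\<close> by (simp add: power_divide divide_le_eq)
  qed
  have P: "power_series_on r a (\<lambda>t. \<Sum>n. t ^ n *\<^sub>R a n)"
    by (rule power_series_on_of_bound[OF \<open>r > 0\<close> \<open>r < \<rho>\<close> aM])
  have tr: "\<bar>t\<bar> \<le> \<rho>1" "\<bar>t\<bar> \<le> \<rho>2" if "\<bar>t\<bar> \<le> r" for t
    using that \<open>r < \<rho>\<close> by (auto simp: \<rho>_def)
  have prod: "power_series_on r b (\<lambda>t. blinfun_apply (\<Sum>n. t ^ n *\<^sub>R a n) (X t))"
    using power_series_on_bilinear(1)[OF \<open>r > 0\<close> bounded_bilinear_blinfun_apply norm_blinfun P X]
    by (simp add: conv)
  have "\<pi> t (X t) = q t" if "\<bar>t\<bar> \<le> r" for t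
  proof -
    have "(\<lambda>n. t ^ n *\<^sub>R b n) sums (blinfun_apply (\<Sum>n. t ^ n *\<^sub>R a n) (X t))"
      using prod that by (simp add: power_series_on_def)
    moreover have "(\<Sum>n. t ^ n *\<^sub>R a n) = \<pi> t" using a(5)[OF tr(1)[OF that]] by (simp add: sums_iff)
    ultimately show ?thesis using b(5)[OF tr(2)[OF that]] sums_unique2 by metis
  qed
  moreover have "X 0 = p0"
    using at0[of x X] X \<open>r > 0\<close> by (simp add: power_series_on_def x0)
  moreover have "power_series_bounded r (\<Sum>m. norm (x m) * r ^ m) X"
    using X by (rule power_series_boundedI) simp
  ultimately show ?thesis using that[of r _ X] \<open>r > 0\<close> a(4) tr(1) by blast
qed

section \<open>The analytic family of self-adjoint idempotents\<close>

text \<open>An involution is conjugate-linear, hence real-linear. Its continuity therefore gives a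
  bound, which is what lets it act termwise on power series in a real variable.\<close>

lemma bounded_linear_of_continuous:
  fixes T :: "'a::real_normed_vector \<Rightarrow> 'b::real_normed_vector"
  assumes add: "\<And>x y. T (x + y) = T x + T y" and scale: "\<And>r x. T (r *\<^sub>R x) = r *\<^sub>R T x"
    and cont: "continuous_on UNIV T"
  shows "bounded_linear T"
proof -
  have T0: "T 0 = 0" using scale[of 0 0] by simp
  obtain d where "d > 0" and d: "\<And>x. norm x < d \<Longrightarrow> norm (T x) < 1"
    using cont unfolding continuous_on_iff by (metis T0 UNIV_I diff_zero dist_norm zero_less_one)
  have "norm (T x) \<le> norm x * (2 / d)" for x
  proof (cases "x = 0")
    case False
    have "norm (T ((d / (2 * norm x)) *\<^sub>R x)) < 1"
      using False \<open>d > 0\<close> by (intro d) simp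
    then show ?thesis using False \<open>d > 0\<close> by (simp add: scale field_simps)
  qed (simp add: T0)
  with add scale show ?thesis by (rule bounded_linear_intro)
qed

lemma power_series_bounded_mono:
  "power_series_bounded r c f \<Longrightarrow> c \<le> d \<Longrightarrow> power_series_bounded r d f"
  unfolding power_series_bounded_def by (meson order_trans)

lemma power_series_bounded_restrict:
  fixes f :: "real \<Rightarrow> 'a::banach"
  assumes "power_series_bounded r c f" "0 < s" "s \<le> r"
  shows "power_series_bounded s c f"
proof -
  obtain a where a: "power_series_on r a f" "(\<Sum>m. norm (a m) * r ^ m) \<le> c"
    using assms unfolding power_series_bounded_def by blast
  have sa: "summable (\<lambda>m. norm (a m) * r ^ m)" using a by (simp add: power_series_on_def)
  have le: "norm (a m) * s ^ m \<le> norm (a m) * r ^ m" for m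
    using assms by (intro mult_left_mono power_mono) auto
  have s: "summable (\<lambda>m. norm (a m) * s ^ m)"
    by (rule summable_comparison_test'[OF sa]) (use le \<open>s > 0\<close> in auto)
  have "(\<Sum>m. norm (a m) * s ^ m) \<le> c" using suminf_le[OF le s sa] a(2) by linarith
  then show ?thesis
    using a(1) s assms by (intro power_series_boundedI[of s a]) (auto simp: power_series_on_def)
qed

theorem theorem2:
  fixes G :: "real set"
    and starA :: "'a::complex_banach_algebra \<Rightarrow> 'a"
    and starB :: "'b::complex_banach_algebra \<Rightarrow> 'b"
    and \<pi> :: "real \<Rightarrow> 'a \<Rightarrow>\<^sub>L 'b"
    and q :: "real \<Rightarrow> 'b"
  assumes "open G" and "0 \<in> G"
    and "involution starA" and "continuous_on UNIV starA"
    and "involution starB" and "continuous_on UNIV starB"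
    and "\<pi> real_analytic_on G"
    and "\<And>t. t \<in> G \<Longrightarrow> unital_star_hom starA starB (blinfun_apply (\<pi> t))"
    and "surj (blinfun_apply (\<pi> 0))"
    and "\<And>x. blinfun_apply (\<pi> 0) x = 0 \<Longrightarrow> totally_disconnected (spectrum x)"
    and "q real_analytic_on G"
    and "\<And>t. t \<in> G \<Longrightarrow> q t \<in> self_adjoint_idempotents starB"
  shows "\<exists>H p. open H \<and> 0 \<in> H \<and> H \<subseteq> G \<and> p real_analytic_on H \<and>
           (\<forall>t\<in>H. p t \<in> self_adjoint_idempotents starA) \<and>
           (\<forall>t\<in>H. blinfun_apply (\<pi> t) (p t) = q t)"
proof -
  note G = assms(1,2) and starA = assms(3,4) and starB = assms(5) and hom = assms(8)
  obtain p0 where p0: "p0 \<in> self_adjoint_idempotents starA" "\<pi> 0 p0 = q 0"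
    by (rule lift_idempotent[OF starA starB hom[OF G(2)] blinfun.bounded_linear_right assms(9,10) assms(12)[OF G(2)]])
      (auto intro: that)
  obtain r c x where "r > 0" and x: "power_series_bounded r c x" "x 0 = p0"
    and rG: "\<And>t. \<bar>t\<bar> \<le> r \<Longrightarrow> t \<in> G" and lift: "\<And>t. \<bar>t\<bar> \<le> r \<Longrightarrow> \<pi> t (x t) = q t"
    by (rule lift_power_series[OF G assms(7,11,9) p0(2)]) (rule that)
  have blA: "bounded_linear starA"
    by (rule bounded_linear_of_continuous) (simp_all add: starA involutionD involution_scaleR)
  define y where "y t = (1 / 2) *\<^sub>R (x t + starA (x t))" for t
  \<comment> \<open>Adding \<open>- 1\<close> in place of subtracting \<open>1\<close> matches the
    rules for sums and constants of power series; likewise for \<open>u\<close>.\<close>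
  define e where "e t = 2 *\<^sub>R y t + (- 1)" for t
  define u where "u t = e t * e t + (- 1)" for t
  define s where "s t = inv_sqrt_series (u t)" for t
  define p where "p t = (1 / 2) *\<^sub>R (1 + e t * s t)" for t
  have ys: "starA (y t) = y t" for t
    by (simp add: y_def involution_scaleR starA(1) involutionD(1,4)[OF starA(1)] add.commute)
  have es: "starA (e t) = e t" for t
    by (simp add: e_def involution_scaleR involution_diff involution_one starA(1) ys)
  have \<pi>y: "\<pi> t (y t) = q t" if "\<bar>t\<bar> \<le> r" for t
  proof -
    have "starB (q t) = q t" using assms(12)[OF rG[OF that]] by (simp add: self_adjoint_idempotents_def)
    then show ?thesis
      using unital_star_homD(5)[OF hom[OF rG[OF that]], of "x t"] lift[OF that]
      by (simp add: y_def blinfun.scaleR_right blinfun.add_right)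
  qed
  have y0: "y 0 = p0" and p02: "p0 * p0 = p0"
    using p0(1) by (simp_all add: y_def x(2) self_adjoint_idempotents_def power2_eq_square)
  \<comment> \<open>Since \<open>p0\<close> is exactly idempotent, the series of \<open>u\<close>
    has no constant term, so shrinking the radius makes its weighted norm as small as
    desired.\<close>
  have u0: "u 0 = 0"
    using idempotent_symmetry_square[OF p02] by (simp add: u_def e_def y0)
  obtain cy where cy: "power_series_bounded r cy y"
    unfolding y_def
    using power_series_bounded_linear[OF \<open>r > 0\<close> x(1) blA]
      power_series_bounded_scaleR[OF power_series_bounded_add[OF \<open>r > 0\<close> x(1)]] by blast
  obtain ce where ce: "power_series_bounded r ce e"
    unfolding e_def
    using power_series_bounded_add[OF \<open>r > 0\<close> power_series_bounded_scaleR[OF cy] power_series_bounded_const] by blast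
  obtain cu where cu: "power_series_bounded r cu u"
    unfolding u_def
    using power_series_bounded_add[OF \<open>r > 0\<close> power_series_bounded_mult[OF \<open>r > 0\<close> ce ce] power_series_bounded_const]
    by blast
  define k where "k = \<bar>cu\<bar> + 1"
  have "k \<ge> 1" by (simp add: k_def)
  \<comment> \<open>At this radius the shrunken bound \<open>k * (\<sigma> / r)\<close> equals
    \<open>1 / 2\<close>, small enough for the binomial series; \<open>k \<ge> 1\<close> ensures
    \<open>\<sigma> \<le> r\<close>.\<close>
  define \<sigma> where "\<sigma> = r / (2 * k)"
  have \<sigma>: "0 < \<sigma>" "\<sigma> \<le> r" using \<open>r > 0\<close> \<open>k \<ge> 1\<close> by (simp_all add: \<sigma>_def divide_le_eq)
  have "power_series_bounded r k u"
    by (rule power_series_bounded_mono[OF cu]) (simp add: k_def)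
  then have "power_series_bounded \<sigma> (k * (\<sigma> / r)) u"
    using u0 \<sigma> by (rule power_series_bounded_shrink)
  moreover have "k * (\<sigma> / r) = 1 / 2"
    using \<open>r > 0\<close> \<open>k \<ge> 1\<close> by (simp add: \<sigma>_def)
  ultimately have half: "power_series_bounded \<sigma> (1 / 2) u" by (simp only:)
  obtain cs where cs: "power_series_bounded \<sigma> cs s"
    unfolding s_def using power_series_bounded_inv_sqrt_series[OF \<sigma>(1) half] by auto
  have "\<exists>cp. power_series_bounded \<sigma> cp p"
    unfolding p_def
    using power_series_bounded_scaleR[OF power_series_bounded_add[OF \<sigma>(1) power_series_bounded_const
        power_series_bounded_mult[OF \<sigma>(1) power_series_bounded_restrict[OF ce \<sigma>] cs]]] by blast
  then have analytic: "p real_analytic_on {- \<sigma><..<\<sigma>}"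
    using power_series_bounded_real_analytic by blast
  have p: "p t \<in> self_adjoint_idempotents starA \<and> \<pi> t (p t) = q t" if "t \<in> {- \<sigma><..<\<sigma>}" for t
  proof -
    have t: "\<bar>t\<bar> \<le> \<sigma>" "\<bar>t\<bar> \<le> r" using that \<sigma> by auto
    have "norm (u t) \<le> 1 / 2" by (rule norm_power_series_bounded[OF half t(1)])
    then have sm: "summable (\<lambda>n. norm ((e t * e t - 1) ^ n))"
      by (intro summable_norm_power) (simp add: u_def)
    have pt: "p t = (1 / 2) *\<^sub>R (1 + e t * inv_sqrt_series (e t * e t - 1))"
      by (simp add: p_def s_def u_def)
    note homt = hom[OF rG[OF t(2)]]
    have "q t * q t = q t"
      using assms(12)[OF rG[OF t(2)]] by (simp add: self_adjoint_idempotents_def power2_eq_square)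
    moreover have "\<pi> t (e t) = 2 *\<^sub>R q t - 1"
      by (simp add: e_def blinfun.diff_right blinfun.scaleR_right \<pi>y[OF t(2)]
          unital_star_homD(4)[OF homt])
    ultimately show ?thesis
      unfolding pt
      using self_adjoint_idempotents_of_near_symmetry[OF starA es sm] homt blinfun.bounded_linear_right
      by blast
  qed
  show ?thesis
  proof (intro exI conjI ballI)
    show "open {- \<sigma><..<\<sigma>}" "0 \<in> {- \<sigma><..<\<sigma>}" using \<sigma> by auto
    show "{- \<sigma><..<\<sigma>} \<subseteq> G" using rG \<sigma> by auto
  qed (use analytic p in auto)
qed

end
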